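(* Let $F$ be a field of characteristic $p\ge 0$, let $m>l\ge 2$ be integers with $\gcd(l,m)=1$, and $n=lm$. Let $f,g,h,g^*,h^*\in F[x]$ be monic and original with $\deg g=\deg h^*=m$, $\deg h=\deg g^*=l$, $g'(g^* )'\ne 0$, and $f=g\circ h=g^*\circ h^*$. Then either (1) or (2) holds, and (3) is also valid. (1) (First Case) Let $m=sl+k$ be the division with remainder, with $1\le k<l$. There exist a monic $w\in F[x]$ of degree $s$ and $a\in F$ with $$f=(x-a^{kl}w^l(a^l))\circ x^{kl}w^l(x^l)\circ(x+a).$$ Furthermore $kw+lxw'\ne 0$ and $p\nmid l$, and $g=(x-a^{kl}w^l(a^l))\circ x^kw^l\circ(x+a^l)$, $h=(x-a^l)\circ x^l\circ(x+a)$, $g^*=(x-a^{kl}w^l(a^l))\circ x^l\circ(x+a^kw(a^l))$, $h^*=(x-a^kw(a^l))\circ x^kw(x^l)\circ(x+a)$. Conversely, any monic $w\in F[x]$ of degree $s$ and $a\in F$ with $kw+lxw'\ne0$ and $p\nmid l$ yield, via these formulas, polynomials $f,g,h,g^*,h^*$ satisfying all the hypotheses above. If $p\nmid m$, then $(w,a)$ is uniquely determined by $f$ and $l$. (2) (Second Case) There exist $z,a\in F$ with $z\ne 0$ such that $$f=(x-T_n(a,z))\circ T_n(x,z)\circ(x+a),$$ and $(z,a)$ is uniquely determined by $f$. Furthermore $p\nmid n$, and $g=(x-T_n(a,z))\circ T_m(x,z^l)\circ(x+T_l(a,z))$, $h=(x-T_l(a,z))\circ T_l(x,z)\circ(x+a)$,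 $g^*=(x-T_n(a,z))\circ T_l(x,z^m)\circ(x+T_m(a,z))$, $h^*=(x-T_m(a,z))\circ T_m(x,z)\circ(x+a)$. Conversely, if $p\nmid n$, then any $z,a\in F$ with $z\ne0$ yield, via these formulas, polynomials satisfying all the hypotheses above. (3) When $l\ge 3$, the First and Second Cases are mutually exclusive. For $l=2$, every $f$ of the Second Case also occurs in the First Case.
   Context: $g\circ h=g(h)$ denotes composition; a polynomial $f$ is monic if its leading coefficient is 1 and original if $f(0)=0$; $g'$ is the derivative. The notation $x^{kl}w^l(x^l)$ means the polynomial $x^{kl}\cdot(w(x^l))^l$, and $x^kw(x^l)$ means $x^k\cdot w(x^l)$. The Dickson polynomials $T_m\in F[x,y]$ are defined by $T_0=2$, $T_1=x$, $T_m=xT_{m-1}-yT_{m-2}$ for $m\ge 2$; $T_m(x,z)$ denotes substitution of $z$ for $y$. *)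

theory Defs
  imports "HOL-Computational_Algebra.Polynomial"
begin

fun dickson :: "'a::comm_ring_1 \<Rightarrow> nat \<Rightarrow> 'a poly" where
  "dickson z 0 = [:2:]"
| "dickson z (Suc 0) = [:0, 1:]"
| "dickson z (Suc (Suc m)) = [:0, 1:] * dickson z (Suc m) - smult z (dickson z m)"

definition original :: "'a::comm_ring_1 poly \<Rightarrow> bool" where
  "original f \<longleftrightarrow> poly f 0 = 0"

definition xplus :: "'a::comm_ring_1 \<Rightarrow> 'a poly" where
  "xplus c = [:c, 1:]"

definition decomp_hyps ::
  "nat \<Rightarrow> nat \<Rightarrow> 'a::field poly \<Rightarrow> 'a poly \<Rightarrow> 'a poly \<Rightarrow> 'a poly \<Rightarrow> 'a poly \<Rightarrow> bool" where
  "decomp_hyps l m f g h gs hs \<longleftrightarrow>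
     lead_coeff f = 1 \<and> lead_coeff g = 1 \<and> lead_coeff h = 1 \<and> lead_coeff gs = 1 \<and> lead_coeff hs = 1 \<and>
     original f \<and> original g \<and> original h \<and> original gs \<and> original hs \<and>
     degree g = m \<and> degree hs = m \<and> degree h = l \<and> degree gs = l \<and>
     pderiv g * pderiv gs \<noteq> 0 \<and>
     f = pcompose g h \<and> f = pcompose gs hs"

definition fc_f :: "nat \<Rightarrow> nat \<Rightarrow> 'a::field poly \<Rightarrow> 'a \<Rightarrow> 'a poly" where
  "fc_f l m w a = (let k = m mod l in
     pcompose (xplus (- (a ^ (k * l) * (poly w (a ^ l)) ^ l)))
       (pcompose (monom 1 (k * l) * (pcompose w (monom 1 l)) ^ l) (xplus a)))"

definition fc_g :: "nat \<Rightarrow> nat \<Rightarrow> 'a::field poly \<Rightarrow> 'a \<Rightarrow> 'a poly" where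
  "fc_g l m w a = (let k = m mod l in
     pcompose (xplus (- (a ^ (k * l) * (poly w (a ^ l)) ^ l)))
       (pcompose (monom 1 k * w ^ l) (xplus (a ^ l))))"

definition fc_h :: "nat \<Rightarrow> nat \<Rightarrow> 'a::field poly \<Rightarrow> 'a \<Rightarrow> 'a poly" where
  "fc_h l m w a =
     pcompose (xplus (- (a ^ l))) (pcompose (monom 1 l) (xplus a))"

definition fc_gs :: "nat \<Rightarrow> nat \<Rightarrow> 'a::field poly \<Rightarrow> 'a \<Rightarrow> 'a poly" where
  "fc_gs l m w a = (let k = m mod l in
     pcompose (xplus (- (a ^ (k * l) * (poly w (a ^ l)) ^ l)))
       (pcompose (monom 1 l) (xplus (a ^ k * poly w (a ^ l)))))"

definition fc_hs :: "nat \<Rightarrow> nat \<Rightarrow> 'a::field poly \<Rightarrow> 'a \<Rightarrow> 'a poly" where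
  "fc_hs l m w a = (let k = m mod l in
     pcompose (xplus (- (a ^ k * poly w (a ^ l))))
       (pcompose (monom 1 k * pcompose w (monom 1 l)) (xplus a)))"

definition fc_param :: "nat \<Rightarrow> nat \<Rightarrow> 'a::field poly \<Rightarrow> bool" where
  "fc_param l m w \<longleftrightarrow> lead_coeff w = 1 \<and> degree w = m div l \<and>
     smult (of_nat (m mod l)) w + smult (of_nat l) ([:0, 1:] * pderiv w) \<noteq> 0 \<and>
     \<not> CHAR('a) dvd l"

definition first_case ::
  "nat \<Rightarrow> nat \<Rightarrow> 'a::field poly \<Rightarrow> 'a poly \<Rightarrow> 'a poly \<Rightarrow> 'a poly \<Rightarrow> 'a poly \<Rightarrow> bool" where
  "first_case l m f g h gs hs \<longleftrightarrow>
     (\<exists>w a. fc_param l m w \<and> f = fc_f l m w a \<and>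
        g = fc_g l m w a \<and> h = fc_h l m w a \<and> gs = fc_gs l m w a \<and> hs = fc_hs l m w a)"

definition sc_f :: "nat \<Rightarrow> nat \<Rightarrow> 'a::field \<Rightarrow> 'a \<Rightarrow> 'a poly" where
  "sc_f l m z a = pcompose (xplus (- poly (dickson z (l * m)) a))
       (pcompose (dickson z (l * m)) (xplus a))"

definition sc_g :: "nat \<Rightarrow> nat \<Rightarrow> 'a::field \<Rightarrow> 'a \<Rightarrow> 'a poly" where
  "sc_g l m z a = pcompose (xplus (- poly (dickson z (l * m)) a))
       (pcompose (dickson (z ^ l) m) (xplus (poly (dickson z l) a)))"

definition sc_h :: "nat \<Rightarrow> nat \<Rightarrow> 'a::field \<Rightarrow> 'a \<Rightarrow> 'a poly" where
  "sc_h l m z a = pcompose (xplus (- poly (dickson z l) a))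
       (pcompose (dickson z l) (xplus a))"

definition sc_gs :: "nat \<Rightarrow> nat \<Rightarrow> 'a::field \<Rightarrow> 'a \<Rightarrow> 'a poly" where
  "sc_gs l m z a = pcompose (xplus (- poly (dickson z (l * m)) a))
       (pcompose (dickson (z ^ m) l) (xplus (poly (dickson z m) a)))"

definition sc_hs :: "nat \<Rightarrow> nat \<Rightarrow> 'a::field \<Rightarrow> 'a \<Rightarrow> 'a poly" where
  "sc_hs l m z a = pcompose (xplus (- poly (dickson z m) a))
       (pcompose (dickson z m) (xplus a))"

definition second_case ::
  "nat \<Rightarrow> nat \<Rightarrow> 'a::field poly \<Rightarrow> 'a poly \<Rightarrow> 'a poly \<Rightarrow> 'a poly \<Rightarrow> 'a poly \<Rightarrow> bool" where
  "second_case l m f g h gs hs \<longleftrightarrow> \<not> CHAR('a) dvd (l * m) \<and>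
     (\<exists>z a. z \<noteq> 0 \<and> f = sc_f l m z a \<and>
        g = sc_g l m z a \<and> h = sc_h l m z a \<and> gs = sc_gs l m z a \<and> hs = sc_hs l m z a)"

end

theory Submission
  imports "HOL-Algebra.Algebraic_Closure_Type" "HOL-Computational_Algebra.Polynomial_FPS" Defs
begin

text \<open>Over the algebraic closure, let the ramification index of p at t be the order of p - p(t) at t.
  Since the degrees l and m are coprime, hs maps the fibre of h over x onto the fibre of gs over g(x),
  and this ties the ramification of g, gs and h over a critical value to each other. As the
  derivatives of gs and h have only l - 1 zeros, counting leaves three possibilities. If gs and h are
  totally and tamely ramified at one point, they are translates of the power x^l. If gs and g have two
  critical values and indices 1 and 2 only, then g and h solve a Pell equation and are Dickson
  polynomials. Otherwise there is wild ramification at a single critical value; comparing the power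
  series branches of gs there forces characteristic 2 and an analogue of the Pell equation, so Dickson
  polynomials appear again. The translations and the parameter z lie in the ground field because they
  can be read off the two coefficients of h below the leading one.\<close>

section \<open>Ramification and fibres\<close>

text \<open>The count is a budget argument. The derivative of h has exactly l - 1 zeros, and above
  every point where g is unramified h has to repeat the ramification of gs. The derivative of g has
  at most m - 1 zeros, so most fibres of g contain many unramified points, and each of them charges
  the ramification of gs once more to the budget. As m > l, only extremal configurations can pay,
  and for them every estimate is an equality.

  The obstacle is positive characteristic. An index may be divisible by p, the order of the
  derivative is then not determined by the index, and the derivative of g may have too small a
  degree. What remains exact is l: comparing degrees in the differentiated identity, with l < m,
  shows that l is nonzero in the field, so the derivatives of gs and h do have degree l - 1. For g
  only an upper bound is available, and the count is arranged to need no more.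

  Coprimality of l and m acts twice: it makes h and hs generate the function field, hence gives the
  fibre correspondence, and it excludes the configurations in which some d > 1 divides all indices
  of g and all indices of gs over one value.\<close>

definition ram :: "'a::field poly \<Rightarrow> 'a \<Rightarrow> nat" where
  "ram f t = Polynomial.order t (f - [:poly f t:])"

lemma order_power: "p \<noteq> 0 \<Longrightarrow> Polynomial.order t (p ^ n) = n * Polynomial.order t (p::'a::field poly)"
  by (induction n) (simp_all add: order_mult)

lemma diff_const_nz: "0 < degree f \<Longrightarrow> f - [:c:] \<noteq> (0::'a::field poly)"
  by (metis degree_pCons_0 eq_iff_diff_eq_0 less_irrefl)

lemma degree_diff_const: "0 < degree f \<Longrightarrow> degree (f - [:c:]) = degree (f::'a::field poly)"
  using degree_add_eq_left[of "[:- c:]" f] by (simp add: minus_pCons diff_conv_add_uminus del: add_uminus_conv_diff)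

lemma lead_coeff_diff_const: "0 < degree f \<Longrightarrow> lead_coeff (f - [:c:]) = lead_coeff (f::'a::field poly)"
  by (simp add: degree_diff_const coeff_pCons split: nat.splits)

lemma ram_pos: "0 < degree f \<Longrightarrow> 0 < ram f t"
  using diff_const_nz[of f "poly f t"] by (simp add: ram_def order_gt_0_iff)

lemma order_pcompose:
  fixes p q :: "'a::field poly"
  assumes "p \<noteq> 0" "0 < degree q"
  shows "Polynomial.order t (pcompose p q) = Polynomial.order (poly q t) p * ram q t"
proof -
  define c where "c = poly q t"
  define n where "n = Polynomial.order c p"
  obtain r where r: "p = [:-c, 1:] ^ n * r" "\<not> [:-c, 1:] dvd r"
    using order_decomp[OF assms(1), of c] unfolding n_def by blast
  have rc: "poly r c \<noteq> 0" using r(2) by (simp add: poly_eq_0_iff_dvd)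
  have pow: "pcompose ([:-c, 1:] ^ n) q = (q - [:c:]) ^ n"
    by (induction n) (simp_all add: pcompose_mult pcompose_1 pcompose_pCons del: mult_pCons_left)
  have eq: "pcompose p q = (q - [:c:]) ^ n * pcompose r q"
    by (subst r(1)) (simp add: pcompose_mult pow)
  have "poly (pcompose r q) t \<noteq> 0" using rc by (simp add: poly_pcompose c_def)
  moreover from this have "pcompose r q \<noteq> 0" by auto
  moreover have "q - [:c:] \<noteq> 0" using diff_const_nz[OF assms(2)] .
  ultimately show ?thesis
    by (simp add: eq order_mult order_0I order_power_n_n ram_def c_def[symmetric] n_def[symmetric]
        order_power mult.commute)
qed

lemma pcompose_diff_const: "pcompose p q - [:poly p (poly q t):] = pcompose (p - [:poly p (poly q t):]) q"
  for p :: "'a::comm_ring_1 poly"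
  by (simp add: pcompose_diff)

lemma ram_pcompose:
  fixes g h :: "'a::field poly"
  assumes "0 < degree g" "0 < degree h"
  shows "ram (pcompose g h) t = ram g (poly h t) * ram h t"
  unfolding ram_def[of "pcompose g h"] poly_pcompose pcompose_diff_const
  using order_pcompose[OF diff_const_nz[OF assms(1)] assms(2)] by (simp add: ram_def)

lemma order_pderiv_pcompose:
  fixes g h :: "'a::field poly"
  assumes "0 < degree h" "pderiv g \<noteq> 0" "pderiv h \<noteq> 0"
  shows "Polynomial.order t (pderiv (pcompose g h)) =
         Polynomial.order (poly h t) (pderiv g) * ram h t + Polynomial.order t (pderiv h)"
  unfolding pderiv_pcompose using assms
  by (subst order_mult) (auto simp: order_pcompose pcompose_eq_0_iff)

lemma pderiv_diff_const [simp]: "pderiv (f - [:c:]) = pderiv (f :: 'a::field poly)"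
  by (simp add: pderiv_diff pderiv_pCons)

text \<open>With f - f(t) = (x - t)^n q and q(t) \<noteq> 0 the derivative is (x - t)^(n-1) (n q +
  (x - t) q'), and the bracket vanishes at t exactly when n is zero in the field. This is the
  distinction between tame and wild: in the tame case the index determines the order of the
  derivative, in the wild case it only bounds it from below.\<close>

lemma order_pderiv_eq:
  fixes f :: "'a::field poly" and t :: 'a
  assumes "pderiv f \<noteq> 0"
  defines "n \<equiv> ram f t"
  shows "(of_nat n \<noteq> (0::'a) \<longrightarrow> Polynomial.order t (pderiv f) = n - 1) \<and>
         (of_nat n = (0::'a) \<longrightarrow> n \<le> Polynomial.order t (pderiv f)) \<and>
         n \<le> Polynomial.order t (pderiv f) + 1"
proof -
  have deg: "0 < degree f"
    using assms(1) by (metis degree_eq_zeroE gr0I pderiv_0 pderiv_pCons add.right_neutral mult_zero_right pCons_0_0)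
  obtain q where q: "f - [:poly f t:] = [:-t, 1:] ^ n * q" "\<not> [:-t, 1:] dvd q"
    using order_decomp[OF diff_const_nz[OF deg]] unfolding n_def ram_def by blast
  have "0 < n" using ram_pos[OF deg] by (simp add: n_def)
  then obtain k where k: "n = Suc k" by (cases n) auto
  have d: "pderiv f = [:-t, 1:] ^ Suc k * pderiv q + smult (of_nat (Suc k)) (q * [:-t, 1:] ^ k)"
    using arg_cong[OF q(1), of pderiv] unfolding k lemma_order_pderiv1 by simp
  hence fac: "pderiv f = [:-t, 1:] ^ k * ([:-t, 1:] * pderiv q + smult (of_nat (Suc k)) q)"
    by (simp add: algebra_simps)
  have "k \<le> Polynomial.order t (pderiv f)"
    using assms(1) fac by (metis dvd_triv_left order_divides)
  moreover have "Suc k \<le> Polynomial.order t (pderiv f)" if "of_nat n = (0::'a)"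
  proof -
    have "pderiv f = [:-t, 1:] ^ Suc k * pderiv q" using d that k by simp
    thus ?thesis using assms(1) by (metis dvd_triv_left order_divides)
  qed
  moreover have "Polynomial.order t (pderiv f) = k" if "of_nat n \<noteq> (0::'a)"
  proof -
    have "poly ([:-t, 1:] * pderiv q + smult (of_nat (Suc k)) q) t \<noteq> 0"
      using that k q(2) by (simp add: poly_eq_0_iff_dvd)
    hence "Polynomial.order t ([:-t, 1:] * pderiv q + smult (of_nat (Suc k)) q) = 0" by (rule order_0I)
    thus ?thesis using assms(1) unfolding fac
      by (subst order_mult) (auto simp: order_power_n_n)
  qed
  ultimately show ?thesis using k by auto
qed

lemma pcompose_right_cancel:
  fixes p q h :: "'a::field poly"
  assumes "0 < degree h" "pcompose p h = pcompose q h"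
  shows "p = q"
  using assms pcompose_eq_0_iff[of h "p - q"] by (simp add: pcompose_diff)

section \<open>Roots and orders over an algebraically closed field\<close>

lemma infinite_alg_closed: "infinite (UNIV :: 'a::alg_closed_field set)"
proof
  assume fin: "finite (UNIV :: 'a set)"
  define p where "p = (\<Prod>a\<in>(UNIV :: 'a set). [:-a, 1:]) + 1"
  have "degree (\<Prod>a\<in>(UNIV :: 'a set). [:-a, 1:]) = card (UNIV :: 'a set)"
    by (subst degree_prod_eq_sum_degree) auto
  moreover have c: "0 < card (UNIV :: 'a set)" using fin by (simp add: card_gt_0_iff)
  ultimately have "degree p = card (UNIV :: 'a set)"
    unfolding p_def by (subst degree_add_eq_left) auto
  then obtain x where "poly p x = 0" using alg_closed_imp_poly_has_root[of p] c by auto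
  moreover have "(\<Prod>a\<in>(UNIV :: 'a set). x - a) = 0" using fin by (intro prod_zero) auto
  ultimately show False by (simp add: p_def poly_prod)
qed

lemma proots_prod_linear: "proots (\<Prod>x\<in>#M. [:- f x, 1:]) = image_mset f (M :: 'b multiset)"
  for f :: "'b \<Rightarrow> 'a::field"
proof (induction M)
  case (add x M)
  have "(\<Prod>x\<in>#M. [:- f x, 1:]) \<noteq> 0" by (auto simp: prod_mset_zero_iff)
  thus ?case using add by (simp add: proots_mult del: mult_pCons_left)
qed simp

lemma alg_closed_factor:
  fixes p :: "'a::alg_closed_field poly"
  assumes "p \<noteq> 0"
  shows "size (proots p) = degree p" "p = smult (lead_coeff p) (\<Prod>x\<in>#proots p. [:-x, 1:])"
proof -
  obtain M where M: "size M = degree p" "p = smult (lead_coeff p) (\<Prod>x\<in>#M. [:-x, 1:])"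
    using alg_closed_imp_factorization[OF assms] by blast
  have "proots p = proots (\<Prod>x\<in>#M. [:-x, 1:])"
    using assms by (subst M(2)) (simp add: proots_smult)
  also have "\<dots> = M" using proots_prod_linear[of "\<lambda>x. x" M] by simp
  finally show "size (proots p) = degree p" "p = smult (lead_coeff p) (\<Prod>x\<in>#proots p. [:-x, 1:])"
    using M by auto
qed

lemma sum_order_eq_degree:
  fixes p :: "'a::alg_closed_field poly"
  assumes "p \<noteq> 0" "finite A" "\<And>x. poly p x = 0 \<Longrightarrow> x \<in> A"
  shows "(\<Sum>x\<in>A. Polynomial.order x p) = degree p"
proof -
  have "degree p = size (proots p)" using alg_closed_factor(1)[OF assms(1)] by simp
  also have "\<dots> = (\<Sum>x\<in>set_mset (proots p). count (proots p) x)" by (simp add: size_multiset_overloaded_eq)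
  also have "\<dots> = (\<Sum>x | poly p x = 0. Polynomial.order x p)" using assms(1) by simp
  also have "\<dots> = (\<Sum>x\<in>A. Polynomial.order x p)"
    using assms by (intro sum.mono_neutral_left) (auto simp: order_0I)
  finally show ?thesis ..
qed

lemma poly_eqI_order:
  fixes p q :: "'a::alg_closed_field poly"
  assumes "p \<noteq> 0" "q \<noteq> 0" "lead_coeff p = lead_coeff q"
    and "\<And>x. Polynomial.order x p = Polynomial.order x q"
  shows "p = q"
proof -
  have "proots p = proots q" using assms by (intro multiset_eqI) simp
  thus ?thesis using alg_closed_factor(2)[OF assms(1)] alg_closed_factor(2)[OF assms(2)] assms(3) by metis
qed

lemma poly_eq_cofinite:
  fixes p q :: "'a::alg_closed_field poly"
  assumes "finite A" "\<And>x. x \<notin> A \<Longrightarrow> poly p x = poly q x"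
  shows "p = q"
proof (rule ccontr)
  assume "p \<noteq> q"
  hence "finite {x. poly (p - q) x = 0}" by (intro poly_roots_finite) simp
  moreover have "- A \<subseteq> {x. poly (p - q) x = 0}" using assms(2) by auto
  ultimately have "finite (- A)" by (rule finite_subset[rotated])
  hence "finite (UNIV :: 'a set)" using assms(1) by (metis finite_Un Compl_partition)
  thus False using infinite_alg_closed by blast
qed

section \<open>The algebra generated by two polynomials of coprime degrees\<close>

inductive_set gen_alg :: "'a::comm_ring_1 poly \<Rightarrow> 'a poly \<Rightarrow> 'a poly set" for h k where
  const: "[:c:] \<in> gen_alg h k"
| gen1: "h \<in> gen_alg h k"
| gen2: "k \<in> gen_alg h k"
| add: "p \<in> gen_alg h k \<Longrightarrow> q \<in> gen_alg h k \<Longrightarrow> p + q \<in> gen_alg h k"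
| mult: "p \<in> gen_alg h k \<Longrightarrow> q \<in> gen_alg h k \<Longrightarrow> p * q \<in> gen_alg h k"

lemma gen_alg_smult: "p \<in> gen_alg h k \<Longrightarrow> smult c p \<in> gen_alg h k"
  using gen_alg.mult[OF gen_alg.const[of c]] by fastforce

lemma gen_alg_power: "p \<in> gen_alg h k \<Longrightarrow> p ^ n \<in> gen_alg h k"
  by (induction n) (auto intro: gen_alg.mult gen_alg.const[of 1, folded one_pCons])

lemma gen_alg_sum: "(\<And>i. i \<in> I \<Longrightarrow> p i \<in> gen_alg h k) \<Longrightarrow> sum p I \<in> gen_alg h k"
  by (induction I rule: infinite_finite_induct) (auto intro: gen_alg.add gen_alg.const[of 0, simplified])

lemma gen_alg_poly:
  assumes "p \<in> gen_alg h k" "poly h s = poly h t" "poly k s = poly k t"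
  shows "poly p s = poly p t"
  using assms(1) by induction (auto simp: assms)

text \<open>Solve m j = e modulo l with j < l; then m j \<le> l m \<le> e, and the rest of e is a
  multiple of l. The bound l m is not sharp, but any explicit bound serves below.\<close>

lemma numerical_semigroup:
  fixes l m e :: nat
  assumes "coprime l m" "0 < l" "0 < m" "l * m \<le> e"
  shows "\<exists>i j. e = l * i + m * j"
proof -
  obtain x y where xy: "m * x = l * y + 1"
    using bezout_nat[of m l] assms by (auto simp: coprime_iff_gcd_eq_1 gcd.commute)
  define j where "j = (x * e) mod l"
  have "m * j \<le> m * l" using assms(2) by (intro mult_left_mono) (auto simp: j_def less_imp_le)
  hence le: "m * j \<le> e" using assms(4) by (metis mult.commute order_trans)
  have "(m * j) mod l = (m * x * e) mod l"
    by (simp add: j_def mod_mult_right_eq mult.assoc)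
  also have "\<dots> = (e + l * (y * e)) mod l" by (simp add: xy algebra_simps)
  also have "\<dots> = e mod l" by simp
  finally have "l dvd e - m * j" using le by (metis mod_eq_dvd_iff_nat)
  then obtain i where "e - m * j = l * i" by blast
  thus ?thesis using le by (metis le_add_diff_inverse2)
qed

text \<open>From degree l m on, every degree is that of some product h^i k^j, so the leading term
  can be cancelled by an element of the algebra. In other words the algebra has finite codimension,
  at most l m, in the ring of all polynomials.\<close>

lemma gen_alg_reduce:
  fixes h k p :: "'a::field poly"
  assumes "lead_coeff h = 1" "lead_coeff k = 1" "degree h = l" "degree k = m"
    and "coprime l m" "0 < l" "0 < m"
  shows "\<exists>r\<in>gen_alg h k. \<forall>i\<ge>l * m. coeff (p - r) i = 0"
proof (induction "degree p" arbitrary: p rule: less_induct)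
  case less
  show ?case
  proof (cases "degree p < l * m")
    case True
    thus ?thesis by (intro bexI[of _ 0]) (auto simp: coeff_eq_0 intro: gen_alg.const[of 0, simplified])
  next
    case False
    then obtain i j where ij: "degree p = l * i + m * j"
      using numerical_semigroup[OF assms(5-7)] by (metis not_less)
    define r where "r = smult (lead_coeff p) (h ^ i * k ^ j)"
    have hk: "degree (h ^ i * k ^ j) = degree p" "lead_coeff (h ^ i * k ^ j) = 1"
    proof -
      have "h \<noteq> 0" "k \<noteq> 0" using assms by auto
      thus "degree (h ^ i * k ^ j) = degree p"
        using assms by (simp add: degree_mult_eq degree_power_eq ij mult.commute)
      show "lead_coeff (h ^ i * k ^ j) = 1"
        using assms(1,2) by (simp only: lead_coeff_mult lead_coeff_power) simp
    qed
    have r: "r \<in> gen_alg h k"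
      unfolding r_def by (intro gen_alg_smult gen_alg.mult gen_alg_power gen_alg.gen1 gen_alg.gen2)
    have p0: "0 < degree p" using False assms by (metis nat_0_less_mult_iff not_less neq0_conv less_le_trans)
    have "degree (p - r) < degree p"
    proof -
      have "coeff (p - r) (degree p) = 0" using hk by (simp add: r_def)
      moreover have "degree (p - r) \<le> degree p"
        using hk by (intro degree_diff_le) (auto simp: r_def degree_smult_le)
      ultimately show ?thesis using p0 by (metis degree_0 le_neq_implies_less leading_coeff_0_iff)
    qed
    then obtain r' where "r' \<in> gen_alg h k" "\<forall>i\<ge>l * m. coeff (p - r - r') i = 0"
      using less by blast
    thus ?thesis using r by (intro bexI[of _ "r + r'"]) (auto intro: gen_alg.add simp: algebra_simps)
  qed
qed

text \<open>N + 1 vectors in a space of dimension N. Dependence in \<open>vector_space\<close> is a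
  property of sets, whereas \<rho> is a family, so a repeated member is treated separately.\<close>

lemma bounded_degree_dependent:
  fixes \<rho> :: "nat \<Rightarrow> 'a::field poly"
  assumes "\<And>i k. k \<ge> N \<Longrightarrow> coeff (\<rho> i) k = 0"
  shows "\<exists>c. (\<exists>i\<le>N. c i \<noteq> 0) \<and> (\<Sum>i\<le>N. smult (c i) (\<rho> i)) = 0"
proof (cases "inj_on \<rho> {..N}")
  case False
  then obtain i j where ij: "i \<le> N" "j \<le> N" "i \<noteq> j" "\<rho> i = \<rho> j" by (auto simp: inj_on_def)
  define c :: "nat \<Rightarrow> 'a" where "c = (\<lambda>k. if k = i then 1 else if k = j then -1 else 0)"
  have "(\<Sum>k\<le>N. smult (c k) (\<rho> k)) = (\<Sum>k\<in>{i, j}. smult (c k) (\<rho> k))"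
    using ij by (intro sum.mono_neutral_right) (auto simp: c_def)
  also have "\<dots> = 0" using ij by (simp add: c_def)
  finally show ?thesis using ij by (intro exI[of _ c]) (auto simp: c_def)
next
  case True
  interpret pv: vector_space "smult :: 'a \<Rightarrow> 'a poly \<Rightarrow> 'a poly"
    by unfold_locales (auto simp: smult_add_right smult_add_left)
  define B where "B = (\<lambda>i. monom (1::'a) i) ` {..<N}"
  have "\<rho> i \<in> pv.span B" for i
  proof -
    have "\<rho> i = (\<Sum>k<N. smult (coeff (\<rho> i) k) (monom 1 k))"
      by (rule poly_eqI) (use assms in \<open>auto simp: coeff_sum if_distrib sum.delta cong: if_cong\<close>)
    moreover have "\<dots> \<in> pv.span B"
      by (intro pv.span_sum pv.span_scale pv.span_base) (auto simp: B_def)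
    ultimately show ?thesis by simp
  qed
  hence sub: "\<rho> ` {..N} \<subseteq> pv.span B" by blast
  have "card B \<le> N" unfolding B_def using card_image_le[of "{..<N}" "\<lambda>i. monom (1::'a) i"] by simp
  hence "\<not> card (\<rho> ` {..N}) \<le> card B" using True by (simp add: card_image)
  hence "pv.dependent (\<rho> ` {..N})"
    using pv.independent_span_bound[of B "\<rho> ` {..N}"] sub by (auto simp: B_def)
  then obtain u where u: "\<exists>v\<in>\<rho> ` {..N}. u v \<noteq> 0" "(\<Sum>v\<in>\<rho> ` {..N}. smult (u v) v) = 0"
    by (subst (asm) pv.dependent_finite) auto
  show ?thesis
    using u True by (intro exI[of _ "\<lambda>i. u (\<rho> i)"]) (auto simp: sum.reindex)
qed

text \<open>Means that x is a quotient of two elements of the algebra, so h and k generate the whole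
  function field. Modulo the algebra the l m + 1 products x h^i fall into a space of dimension at
  most l m; a linear relation between them reads x P(h) \<in> \<open>gen_alg h k\<close> with P
  \<noteq> 0, and q = P(h) does it.\<close>

lemma gen_alg_conductor:
  fixes h k :: "'a::field poly"
  assumes "lead_coeff h = 1" "lead_coeff k = 1" "degree h = l" "degree k = m"
    and "coprime l m" "0 < l" "0 < m"
  shows "\<exists>q\<in>gen_alg h k. q \<noteq> 0 \<and> [:0, 1:] * q \<in> gen_alg h k"
proof -
  define N where "N = l * m"
  have "\<exists>r\<in>gen_alg h k. \<forall>j\<ge>N. coeff ([:0, 1:] * h ^ i - r) j = 0" for i
    unfolding N_def by (rule gen_alg_reduce[OF assms])
  then obtain r where r: "\<And>i. r i \<in> gen_alg h k" "\<And>i j. j \<ge> N \<Longrightarrow> coeff ([:0, 1:] * h ^ i - r i) j = 0"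
    by metis
  obtain c where c: "\<exists>i\<le>N. c i \<noteq> 0" "(\<Sum>i\<le>N. smult (c i) ([:0, 1:] * h ^ i - r i)) = 0"
    using bounded_degree_dependent[of N "\<lambda>i. [:0, 1:] * h ^ i - r i"] r(2) by blast
  define P where "P = (\<Sum>i\<le>N. monom (c i) i)"
  have "coeff P i = c i" if "i \<le> N" for i
    unfolding P_def using that by (simp add: coeff_sum)
  hence "P \<noteq> 0" using c(1) by (metis coeff_0)
  have "pcompose (monom d i) h = smult d (h ^ i)" for d i
    by (induction i) (simp_all add: monom_0 monom_Suc pcompose_pCons)
  hence q: "pcompose P h = (\<Sum>i\<le>N. smult (c i) (h ^ i))" by (simp add: P_def pcompose_sum)
  have "pcompose P h \<noteq> 0" using \<open>P \<noteq> 0\<close> assms by (subst pcompose_eq_0_iff) auto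
  moreover have "pcompose P h \<in> gen_alg h k"
    unfolding q by (intro gen_alg_sum gen_alg_smult gen_alg_power gen_alg.gen1)
  moreover have "[:0, 1:] * pcompose P h = (\<Sum>i\<le>N. smult (c i) (r i))"
    using c(2) by (simp add: q smult_diff_right sum_subtractf sum_distrib_left mult_smult_right del: mult_pCons_left)
  moreover have "(\<Sum>i\<le>N. smult (c i) (r i)) \<in> gen_alg h k" by (intro gen_alg_sum gen_alg_smult r)
  ultimately show ?thesis by metis
qed

text \<open>This holds for generic x because h and hs generate the function field, and extends to all x
  because the coefficients of the product of y - hs(t) over the fibre of h are polynomial in x.\<close>

lemma image_fibre:
  fixes g h gs hs :: "'a::alg_closed_field poly"
  assumes lc: "lead_coeff h = 1" "lead_coeff hs = 1" "lead_coeff gs = 1"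
    and deg: "degree h = l" "degree hs = m" "degree gs = l"
    and cop: "coprime l m" and pos: "0 < l" "0 < m"
    and eq: "pcompose g h = pcompose gs hs" and h': "pderiv h \<noteq> 0"
  shows "image_mset (poly hs) (proots (h - [:x:])) = proots (gs - [:poly g x:])"
proof -
  define \<Phi> where "\<Phi> x = (\<Prod>t\<in>#proots (h - [:x:]). [:- poly hs t, 1:])" for x
  have nz: "h - [:x:] \<noteq> 0" "hs - [:y:] \<noteq> 0" "gs - [:x:] \<noteq> 0" for x y
    using diff_const_nz deg pos by auto
  obtain q where q: "q \<in> gen_alg h hs" "q \<noteq> 0" "[:0, 1:] * q \<in> gen_alg h hs"
    using gen_alg_conductor[OF lc(1,2) deg(1,2) cop pos] by blast
  \<comment> \<open>Off \<open>Bad\<close> the fibre of h has no multiple points and q does not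
    vanish on it. A point t of the fibre is then determined by h t and hs t, because q t and t q t
    are.\<close>
  define Bad where "Bad = poly h ` {t. poly (pderiv h) t = 0} \<union> poly h ` {t. poly q t = 0}"
  have finBad: "finite Bad"
    unfolding Bad_def using h' q(2) by (intro finite_UnI finite_imageI poly_roots_finite)
  have generic: "\<Phi> x = gs - [:poly g x:]" if x: "x \<notin> Bad" for x
  proof -
    define S where "S = {t. poly h t = x}"
    have finS: "finite S" using poly_roots_finite[OF nz(1)[of x]] by (simp add: S_def)
    have ord1: "Polynomial.order t (h - [:x:]) = 1" if "t \<in> S" for t
    proof -
      have "poly (pderiv h) t \<noteq> 0" using x that by (auto simp: Bad_def S_def)
      hence "Polynomial.order t (pderiv h) = 0" by (rule order_0I)
      hence "ram h t \<le> 1" using order_pderiv_eq[OF h', of t] by simp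
      thus ?thesis using ram_pos[of h t] deg pos that by (simp add: ram_def S_def)
    qed
    have pr: "proots (h - [:x:]) = mset_set S"
    proof (rule multiset_eqI)
      fix t show "count (proots (h - [:x:])) t = count (mset_set S) t"
        using nz(1)[of x] finS ord1[of t] by (cases "t \<in> S") (auto simp: S_def order_0I)
    qed
    have inj: "inj_on (poly hs) S"
    proof (rule inj_onI)
      fix s t assume st: "s \<in> S" "t \<in> S" "poly hs s = poly hs t"
      have "poly h s = poly h t" using st by (simp add: S_def)
      from gen_alg_poly[OF q(1) this st(3)] gen_alg_poly[OF q(3) this st(3)]
      have "s * poly q s = t * poly q s" by simp
      moreover have "poly q s \<noteq> 0" using x st by (auto simp: Bad_def S_def)
      ultimately show "s = t" by simp
    qed
    have cardS: "card S = l"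
      using alg_closed_factor(1)[OF nz(1)[of x]] pr deg pos by (simp add: degree_diff_const)
    have im: "image_mset (poly hs) (mset_set S) = mset_set (poly hs ` S)"
      using inj by (rule image_mset_mset_set)
    have "mset_set (poly hs ` S) \<subseteq># proots (gs - [:poly g x:])"
    proof (rule mset_subset_eqI)
      fix y
      show "count (mset_set (poly hs ` S)) y \<le> count (proots (gs - [:poly g x:])) y"
      proof (cases "y \<in> poly hs ` S")
        case True
        then obtain t where t: "poly h t = x" "y = poly hs t" by (auto simp: S_def)
        have "poly gs (poly hs t) = poly g (poly h t)" using eq by (metis poly_pcompose)
        hence "poly (gs - [:poly g x:]) y = 0" using t by simp
        hence "0 < Polynomial.order y (gs - [:poly g x:])" using nz by (simp add: order_gt_0_iff)
        thus ?thesis using nz finS True by simp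
      qed (use finS in simp)
    qed
    moreover have "size (proots (gs - [:poly g x:])) = size (mset_set (poly hs ` S))"
      using alg_closed_factor(1)[OF nz(3)[of "poly g x"]] cardS card_image[OF inj] deg pos
      by (simp add: degree_diff_const)
    ultimately have "mset_set (poly hs ` S) = proots (gs - [:poly g x:])"
      by (metis mset_subset_size subset_mset.le_neq_trans less_irrefl)
    hence "proots (gs - [:poly g x:]) = image_mset (poly hs) (proots (h - [:x:]))"
      using pr im by simp
    hence "\<Phi> x = (\<Prod>y\<in>#proots (gs - [:poly g x:]). [:- y, 1:])"
      by (simp add: \<Phi>_def image_mset.compositionality o_def)
    also have "\<dots> = gs - [:poly g x:]"
    proof -
      have "lead_coeff (gs - [:poly g x:]) = 1" using lc deg pos by (subst lead_coeff_diff_const) auto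
      thus ?thesis using alg_closed_factor(2)[OF nz(3)[of "poly g x"]] by simp
    qed
    finally show ?thesis .
  qed
  \<comment> \<open>Up to sign both sides are the resultant of h - x and hs - y, a double product of
    differences s - t over the two fibres. Exchanging the order of the products shows that for fixed
    y it is a polynomial in x, which is what extends the generic identity to the values in
    \<open>Bad\<close>.\<close>
  have prodform: "poly (\<Phi> x) y = (-1) ^ (l + l * m) * (\<Prod>s\<in>#proots (hs - [:y:]). poly h s - x)" for x y
  proof -
    have h_eq: "poly h s - x = (\<Prod>t\<in>#proots (h - [:x:]). s - t)" for s
    proof -
      have "h - [:x:] = (\<Prod>t\<in>#proots (h - [:x:]). [:- t, 1:])"
        using alg_closed_factor(2)[OF nz(1)[of x]] lead_coeff_diff_const[of h x] lc deg pos by simp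
      hence "poly (h - [:x:]) s = poly (\<Prod>t\<in>#proots (h - [:x:]). [:- t, 1:]) s" by simp
      thus ?thesis by (simp add: poly_prod_mset image_mset.compositionality o_def)
    qed
    have hs_eq: "poly hs t - y = (\<Prod>s\<in>#proots (hs - [:y:]). t - s)" for t
    proof -
      have "hs - [:y:] = (\<Prod>s\<in>#proots (hs - [:y:]). [:- s, 1:])"
        using alg_closed_factor(2)[OF nz(2)[of y]] lead_coeff_diff_const[of hs y] lc deg pos by simp
      hence "poly (hs - [:y:]) t = poly (\<Prod>s\<in>#proots (hs - [:y:]). [:- s, 1:]) t" by simp
      thus ?thesis by (simp add: poly_prod_mset image_mset.compositionality o_def)
    qed
    have sz: "size (proots (h - [:x:])) = l" "size (proots (hs - [:y:])) = m"
      using alg_closed_factor(1)[OF nz(1)] alg_closed_factor(1)[OF nz(2)] deg pos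
      by (auto simp: degree_diff_const)
    have neg: "(\<Prod>t\<in>#M. - f t) = (-1) ^ size M * (\<Prod>t\<in>#M. f t)" for M :: "'a multiset" and f :: "'a \<Rightarrow> 'a"
      by (induction M) auto
    have neg': "(\<Prod>t\<in>#M. (-1) ^ n * f t) = (-1) ^ (n * size M) * (\<Prod>t\<in>#M. f t)"
      for M :: "'a multiset" and f :: "'a \<Rightarrow> 'a" and n
      by (induction M) (auto simp: power_add)
    have "poly (\<Phi> x) y = (\<Prod>t\<in>#proots (h - [:x:]). y - poly hs t)"
      by (simp add: \<Phi>_def poly_prod_mset image_mset.compositionality o_def)
    also have "\<dots> = (\<Prod>t\<in>#proots (h - [:x:]). - (poly hs t - y))" by simp
    also have "\<dots> = (-1) ^ l * (\<Prod>t\<in>#proots (h - [:x:]). poly hs t - y)"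
      unfolding neg sz ..
    also have "(\<Prod>t\<in>#proots (h - [:x:]). poly hs t - y) =
               (\<Prod>t\<in>#proots (h - [:x:]). \<Prod>s\<in>#proots (hs - [:y:]). - (s - t))"
      by (simp add: hs_eq)
    also have "\<dots> = (\<Prod>t\<in>#proots (h - [:x:]). (-1) ^ m * (\<Prod>s\<in>#proots (hs - [:y:]). s - t))"
      unfolding neg sz ..
    also have "\<dots> = (-1) ^ (m * l) * (\<Prod>t\<in>#proots (h - [:x:]). \<Prod>s\<in>#proots (hs - [:y:]). s - t)"
      unfolding neg' sz ..
    also have "(\<Prod>t\<in>#proots (h - [:x:]). \<Prod>s\<in>#proots (hs - [:y:]). s - t) =
               (\<Prod>s\<in>#proots (hs - [:y:]). \<Prod>t\<in>#proots (h - [:x:]). s - t)"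
      by (rule prod_mset.swap)
    finally show ?thesis by (simp add: h_eq power_add mult.assoc mult.commute[of m])
  qed
  have all: "poly (\<Phi> x) y = poly gs y - poly g x" for x y
  proof -
    define P where "P = smult ((-1) ^ (l + l * m)) (\<Prod>s\<in>#proots (hs - [:y:]). [:poly h s, -1:])"
    have P: "poly P x = poly (\<Phi> x) y" for x
      by (simp add: P_def prodform poly_prod_mset image_mset.compositionality o_def)
    have "P = [:poly gs y:] - g"
      by (rule poly_eq_cofinite[OF finBad]) (simp add: P generic)
    thus ?thesis using P[of x] by simp
  qed
  have "\<Phi> x = gs - [:poly g x:]"
    by (rule poly_eq_cofinite[of "{}"]) (simp_all add: all)
  moreover have "proots (\<Phi> x) = image_mset (poly hs) (proots (h - [:x:]))"
    unfolding \<Phi>_def by (rule proots_prod_linear)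
  ultimately show ?thesis by simp
qed

text \<open>Compares the multiplicity of y in the two multisets of \<open>image_fibre\<close>. Later
  arguments use the fibre correspondence in this form only, once for h over gs and once, with the
  roles exchanged, for hs over g.\<close>

corollary sum_ram_fibre:
  fixes g h gs hs :: "'a::alg_closed_field poly"
  assumes lc: "lead_coeff h = 1" "lead_coeff hs = 1" "lead_coeff gs = 1"
    and deg: "degree h = l" "degree hs = m" "degree gs = l"
    and cop: "coprime l m" and pos: "0 < l" "0 < m"
    and eq: "pcompose g h = pcompose gs hs" and h': "pderiv h \<noteq> 0"
    and xy: "poly g x = poly gs y"
  shows "(\<Sum>t | poly h t = x \<and> poly hs t = y. ram h t) = ram gs y"
proof -
  have nz: "h - [:x:] \<noteq> 0" "gs - [:c:] \<noteq> 0" for c using diff_const_nz deg pos by auto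
  have "ram gs y = count (proots (gs - [:poly g x:])) y" using nz by (simp add: ram_def xy)
  also have "\<dots> = count (image_mset (poly hs) (proots (h - [:x:]))) y"
    using image_fibre[OF lc deg cop pos eq h', of x] by simp
  also have "\<dots> = (\<Sum>t\<in>poly hs -` {y} \<inter> {t. poly h t = x}. Polynomial.order t (h - [:x:]))"
    using nz by (simp add: count_image_mset)
  also have "\<dots> = (\<Sum>t | poly h t = x \<and> poly hs t = y. ram h t)"
    by (intro sum.cong) (auto simp: ram_def)
  finally show ?thesis ..
qed

section \<open>Counting ramification\<close>

text \<open>A proper divisor of a is at most a / 2. So whenever a divisibility between indices
  fails, at least half of an index is lost, and the budget does not allow this often.\<close>

lemma half_gcd:
  fixes a b :: nat
  assumes "0 < a" "\<not> a dvd b" shows "2 * int (gcd a b) \<le> int a"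
proof -
  have "gcd a b dvd a" by simp
  then obtain k where k: "a = gcd a b * k" by blast
  have "k \<noteq> 0" using k assms by (metis mult_0_right less_irrefl)
  moreover have "k \<noteq> 1" using k assms by (metis gcd_dvd2 mult.right_neutral)
  ultimately have "2 \<le> k" by simp
  hence "gcd a b * 2 \<le> a" by (subst (2) k) simp
  thus ?thesis by simp
qed

text \<open>Xs c and Ys c stand for the fibres of g and gs over c, a and b for the ramification indices,
  \<alpha> and \<beta> for the orders of the derivatives (larger than a - 1 and b - 1 in the wild case), and
  D x y for the total order of the derivative of h at the points over both x and y.\<close>

locale ramification_count =
  fixes C :: "'c set" and Xs :: "'c \<Rightarrow> 'x set" and Ys :: "'c \<Rightarrow> 'y set"
    and a \<alpha> :: "'x \<Rightarrow> nat" and b \<beta> :: "'y \<Rightarrow> nat" and D :: "'x \<Rightarrow> 'y \<Rightarrow> nat"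
    and l m :: nat
  assumes finC: "finite C"
    and finX: "\<And>c. c \<in> C \<Longrightarrow> finite (Xs c)" and finY: "\<And>c. c \<in> C \<Longrightarrow> finite (Ys c)"
    and l_ge: "2 \<le> l" and l_less: "l < m" and cop: "coprime l m"
    and a_pos: "\<And>c x. c \<in> C \<Longrightarrow> x \<in> Xs c \<Longrightarrow> 1 \<le> a x"
    and b_pos: "\<And>c y. c \<in> C \<Longrightarrow> y \<in> Ys c \<Longrightarrow> 1 \<le> b y"
    and sum_a: "\<And>c. c \<in> C \<Longrightarrow> (\<Sum>x\<in>Xs c. a x) = m"
    and sum_b: "\<And>c. c \<in> C \<Longrightarrow> (\<Sum>y\<in>Ys c. b y) = l"
    and \<alpha>_ge: "\<And>x. a x \<le> \<alpha> x + 1" and \<beta>_ge: "\<And>y. b y \<le> \<beta> y + 1"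
    and \<alpha>_1: "\<And>x. a x = 1 \<Longrightarrow> \<alpha> x = 0" and \<beta>_1: "\<And>y. b y = 1 \<Longrightarrow> \<beta> y = 0"
    and sum_\<alpha>: "(\<Sum>c\<in>C. \<Sum>x\<in>Xs c. \<alpha> x) \<le> m - 1"
    and sum_\<beta>: "(\<Sum>c\<in>C. \<Sum>y\<in>Ys c. \<beta> y) = l - 1"
    and sum_D: "(\<Sum>c\<in>C. \<Sum>x\<in>Xs c. \<Sum>y\<in>Ys c. D x y) \<le> l - 1"
    and D_ge1: "\<And>c x y. c \<in> C \<Longrightarrow> x \<in> Xs c \<Longrightarrow> y \<in> Ys c \<Longrightarrow>
                  (\<beta> y + 1) * a x \<le> D x y + \<alpha> x * b y + gcd (a x) (b y)"
    and D_ge2: "\<And>c x y. c \<in> C \<Longrightarrow> x \<in> Xs c \<Longrightarrow> y \<in> Ys c \<Longrightarrow> b y \<le> D x y + gcd (a x) (b y)"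
begin

text \<open>The values are integers because differences such as m - 2 A c may be negative. E c x is
  the number of zeros of the derivative of h above the point x, and R c the part of the budget that
  is spent above ramified points of g.\<close>

definition A :: "'c \<Rightarrow> int" where "A c = (\<Sum>x\<in>Xs c. int (\<alpha> x))"
definition B :: "'c \<Rightarrow> int" where "B c = (\<Sum>y\<in>Ys c. int (\<beta> y))"
definition U :: "'c \<Rightarrow> int" where "U c = int (card {x \<in> Xs c. a x = 1})"
definition E :: "'c \<Rightarrow> 'x \<Rightarrow> int" where "E c x = (\<Sum>y\<in>Ys c. int (D x y))"
definition R :: "'c \<Rightarrow> int" where "R c = (\<Sum>x\<in>{x \<in> Xs c. a x \<noteq> 1}. E c x)"

lemma int_l_less: "int l < int m" using l_less by simp

lemma A_nonneg: "0 \<le> A c" and B_nonneg: "0 \<le> B c" and U_nonneg: "0 \<le> U c"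
  and E_nonneg: "0 \<le> E c x" and R_nonneg: "0 \<le> R c"
  unfolding A_def B_def U_def E_def R_def by (auto intro!: sum_nonneg)

lemma sum_A: "(\<Sum>c\<in>C. A c) \<le> int m - 1"
proof -
  have "(\<Sum>c\<in>C. A c) = int (\<Sum>c\<in>C. \<Sum>x\<in>Xs c. \<alpha> x)" by (simp add: A_def)
  thus ?thesis using sum_\<alpha> l_less by linarith
qed

lemma sum_B: "(\<Sum>c\<in>C. B c) = int l - 1"
proof -
  have "(\<Sum>c\<in>C. B c) = int (\<Sum>c\<in>C. \<Sum>y\<in>Ys c. \<beta> y)" by (simp add: B_def)
  thus ?thesis using sum_\<beta> l_ge by linarith
qed

lemma sum_a_int: "c \<in> C \<Longrightarrow> (\<Sum>x\<in>Xs c. int (a x)) = int m"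
  using sum_a[of c] by (metis of_nat_sum)

lemma sum_b_int: "c \<in> C \<Longrightarrow> (\<Sum>y\<in>Ys c. int (b y)) = int l"
  using sum_b[of c] by (metis of_nat_sum)

lemma U_altdef: "c \<in> C \<Longrightarrow> U c = (\<Sum>x\<in>Xs c. if a x = 1 then 1 else 0)"
  unfolding U_def using finX[of c] by (simp add: sum.If_cases Int_def conj_commute)

text \<open>Pointwise: an unramified point contributes nothing on the left, and a ramified one
  satisfies a \<le> \<alpha> + 1 \<le> 2 \<alpha>. So a fibre with little ramification has many
  unramified points.\<close>

lemma U_A:
  assumes "c \<in> C" shows "int m - U c \<le> 2 * A c"
proof -
  have "int m - U c = (\<Sum>x\<in>Xs c. int (a x) - (if a x = 1 then 1 else 0))"
    using assms by (simp add: sum_subtractf sum_a_int U_altdef)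
  also have "\<dots> \<le> (\<Sum>x\<in>Xs c. 2 * int (\<alpha> x))"
  proof (rule sum_mono)
    fix x assume "x \<in> Xs c"
    thus "int (a x) - (if a x = 1 then 1 else 0) \<le> 2 * int (\<alpha> x)"
      using a_pos[OF assms, of x] \<alpha>_ge[of x] by auto
  qed
  finally show ?thesis by (simp add: A_def sum_distrib_left)
qed

lemma U_A_eq:
  assumes "c \<in> C" "int m - U c = 2 * A c" "x \<in> Xs c"
  shows "a x \<in> {1, 2} \<and> \<alpha> x = a x - 1"
proof -
  have "(\<Sum>x\<in>Xs c. 2 * int (\<alpha> x) - (int (a x) - (if a x = 1 then 1 else 0))) = 0"
    using assms by (simp add: sum_subtractf sum_a_int U_altdef A_def flip: sum_distrib_left)
  moreover have "\<forall>x\<in>Xs c. 0 \<le> 2 * int (\<alpha> x) - (int (a x) - (if a x = 1 then 1 else 0))"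
  proof
    fix x assume "x \<in> Xs c"
    thus "0 \<le> 2 * int (\<alpha> x) - (int (a x) - (if a x = 1 then 1 else 0))"
      using a_pos[OF assms(1), of x] \<alpha>_ge[of x] by auto
  qed
  ultimately have "2 * int (\<alpha> x) - (int (a x) - (if a x = 1 then 1 else 0)) = 0"
    using assms finX by (subst (asm) sum_nonneg_eq_0_iff) auto
  thus ?thesis using a_pos[OF assms(1,3)] \<alpha>_ge[of x] by (auto split: if_splits)
qed

text \<open>For a x = 1 both \<alpha> x = 0 and the gcd is 1, and \<open>D_ge1\<close> reduces to
  \<beta> y \<le> D x y. Each unramified point of g thus costs B c out of the l - 1 zeros of the
  derivative of h.\<close>

lemma E_1:
  assumes "c \<in> C" "x \<in> Xs c" "a x = 1" shows "B c \<le> E c x"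
  unfolding B_def E_def
proof (rule sum_mono)
  fix y assume "y \<in> Ys c"
  from D_ge1[OF assms(1,2) this] show "int (\<beta> y) \<le> int (D x y)"
    using assms \<alpha>_1[of x] by simp
qed

lemma sum_E_split:
  assumes "c \<in> C" shows "U c * B c + R c \<le> (\<Sum>x\<in>Xs c. E c x)"
proof -
  have "(\<Sum>x\<in>Xs c. E c x) = (\<Sum>x\<in>{x \<in> Xs c. a x = 1}. E c x) + R c"
    unfolding R_def using finX[OF assms]
    by (subst sum.union_disjoint[symmetric]) (auto intro!: sum.cong)
  moreover have "(\<Sum>x\<in>{x \<in> Xs c. a x = 1}. B c) \<le> (\<Sum>x\<in>{x \<in> Xs c. a x = 1}. E c x)"
    using E_1[OF assms] by (intro sum_mono) auto
  ultimately show ?thesis by (simp add: U_def)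
qed

lemma sum_E: "(\<Sum>c\<in>C. \<Sum>x\<in>Xs c. E c x) \<le> int l - 1"
proof -
  have "(\<Sum>c\<in>C. \<Sum>x\<in>Xs c. E c x) = int (\<Sum>c\<in>C. \<Sum>x\<in>Xs c. \<Sum>y\<in>Ys c. D x y)" by (simp add: E_def)
  thus ?thesis using sum_D l_ge by linarith
qed

text \<open>The budget inequality. The classification consists in bounding U c from below by
  \<open>U_A\<close>, inserting the bound here, and examining what equality means.\<close>

lemma sum_U_B: "(\<Sum>c\<in>C. U c * B c + R c) \<le> int l - 1"
  by (rule order_trans[OF sum_mono sum_E]) (rule sum_E_split)

lemma sum_E_except:
  assumes "c \<in> C"
  shows "(\<Sum>x\<in>Xs c. E c x) + (\<Sum>c'\<in>C - {c}. U c' * B c' + R c') \<le> int l - 1"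
proof -
  have "(\<Sum>x\<in>Xs c. E c x) + (\<Sum>c'\<in>C - {c}. U c' * B c' + R c') \<le>
        (\<Sum>x\<in>Xs c. E c x) + (\<Sum>c'\<in>C - {c}. \<Sum>x\<in>Xs c'. E c' x)"
    by (intro add_mono sum_mono sum_E_split order_refl) auto
  also have "\<dots> = (\<Sum>c\<in>C. \<Sum>x\<in>Xs c. E c x)"
    using finC assms by (simp add: sum.remove)
  finally show ?thesis using sum_E by linarith
qed

lemma A_except: "c \<in> C \<Longrightarrow> A c + (\<Sum>c'\<in>C - {c}. A c') \<le> int m - 1"
  using sum_A finC by (simp add: sum.remove)

lemma B_except: "c \<in> C \<Longrightarrow> B c + (\<Sum>c'\<in>C - {c}. B c') = int l - 1"
  using sum_B finC by (simp add: sum.remove)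

lemma A_le_except:
  assumes "c' \<in> C - {c}" shows "A c' \<le> (\<Sum>c'\<in>C - {c}. A c')"
  using assms finC A_nonneg by (intro member_le_sum) auto

text \<open>Summing \<open>D_ge1\<close> for the wild y over the fibre of g shows that at least b y
  (1 + w) of the budget is spent over c, where w is the ramification of g over the other values.
  Each of those values keeps at least m - 2 w unramified points, so ramification of gs there costs
  at least m - 2 w more. With b y \<ge> 2 the total is at least m + 2, too much for l - 1.\<close>

lemma wild_concentrated:
  assumes c: "c \<in> C" and y: "y \<in> Ys c" and wild: "b y \<le> \<beta> y"
  shows "B c = int l - 1"
proof (rule ccontr)
  assume *: "B c \<noteq> int l - 1"
  define w where "w = (\<Sum>c'\<in>C - {c}. A c')"
  define S where "S = (\<Sum>c'\<in>C - {c}. B c')"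
  have w: "A c + w \<le> int m - 1" "0 \<le> w"
    using A_except[OF c] A_nonneg by (auto simp: w_def intro!: sum_nonneg)
  have S: "B c + S = int l - 1" "0 \<le> S"
    using B_except[OF c] B_nonneg by (auto simp: S_def intro!: sum_nonneg)
  have S1: "1 \<le> S" using S * by linarith
  have b2: "2 \<le> int (b y)"
    using wild b_pos[OF c y] \<beta>_1[of y] by (cases "b y = 1") auto
  have "(\<Sum>x\<in>Xs c. int ((\<beta> y + 1) * a x)) \<le>
        (\<Sum>x\<in>Xs c. int (D x y + \<alpha> x * b y + gcd (a x) (b y)))"
    using D_ge1[OF c _ y] by (intro sum_mono) (simp only: of_nat_le_iff)
  also have "\<dots> = (\<Sum>x\<in>Xs c. int (D x y)) + A c * int (b y) + (\<Sum>x\<in>Xs c. int (gcd (a x) (b y)))"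
    by (simp add: sum.distrib A_def sum_distrib_right)
  also have "(\<Sum>x\<in>Xs c. int (gcd (a x) (b y))) \<le> (\<Sum>x\<in>Xs c. int (a x))"
  proof (rule sum_mono)
    fix x assume "x \<in> Xs c"
    hence "gcd (a x) (b y) \<le> a x" using a_pos[OF c, of x] by (intro gcd_le1_nat) auto
    thus "int (gcd (a x) (b y)) \<le> int (a x)" by simp
  qed
  also have "(\<Sum>x\<in>Xs c. int (a x)) = int m" by (rule sum_a_int[OF c])
  also have "(\<Sum>x\<in>Xs c. int ((\<beta> y + 1) * a x)) = (int (\<beta> y) + 1) * int m"
    using sum_a_int[OF c] by (simp add: sum.distrib algebra_simps flip: sum_distrib_left)
  finally have 1: "int (\<beta> y) * int m \<le> (\<Sum>x\<in>Xs c. int (D x y)) + A c * int (b y)"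
    by (simp add: algebra_simps)
  have "int (b y) * int m \<le> int (\<beta> y) * int m" using wild by (intro mult_right_mono) auto
  moreover have "A c * int (b y) \<le> (int m - 1 - w) * int (b y)"
    using w by (intro mult_right_mono) auto
  ultimately have 2: "int (b y) * (1 + w) \<le> (\<Sum>x\<in>Xs c. int (D x y))"
    using 1 by (simp add: algebra_simps)
  have "(\<Sum>x\<in>Xs c. int (D x y)) \<le> (\<Sum>x\<in>Xs c. E c x)"
    unfolding E_def using y finY[OF c] by (intro sum_mono member_le_sum) auto
  with 2 have 3: "int (b y) * (1 + w) \<le> (\<Sum>x\<in>Xs c. E c x)" by linarith
  have "(int m - 2 * w) * S = (\<Sum>c'\<in>C - {c}. (int m - 2 * w) * B c')"
    by (simp add: S_def sum_distrib_left)
  also have "\<dots> \<le> (\<Sum>c'\<in>C - {c}. U c' * B c' + R c')"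
  proof (rule sum_mono)
    fix c' assume c': "c' \<in> C - {c}"
    have "(int m - 2 * w) * B c' \<le> U c' * B c'"
      using c' U_A[of c'] A_le_except[OF c'] B_nonneg by (intro mult_right_mono) (auto simp: w_def)
    thus "(int m - 2 * w) * B c' \<le> U c' * B c' + R c'" using R_nonneg[of c'] by linarith
  qed
  finally have 4: "int (b y) * (1 + w) + (int m - 2 * w) * S \<le> int l - 1"
    using sum_E_except[OF c] 3 by linarith
  have 5: "2 * (1 + w) \<le> int (b y) * (1 + w)" using b2 w by (intro mult_right_mono) auto
  \<comment> \<open>If 2 w exceeds m, the cost 2 + 2 w over c alone is already more than l -
    1.\<close>
  have 6: "0 \<le> int m - 2 * w"
  proof (rule ccontr)
    assume neg: "\<not> 0 \<le> int m - 2 * w"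
    have "0 \<le> (\<Sum>c'\<in>C - {c}. U c' * B c' + R c')"
      using U_nonneg B_nonneg R_nonneg by (intro sum_nonneg add_nonneg_nonneg mult_nonneg_nonneg) auto
    hence "2 * (1 + w) \<le> int l - 1" using sum_E_except[OF c] 3 5 by linarith
    hence "2 + 2 * w \<le> int l - 1" by simp
    thus False using neg int_l_less by linarith
  qed
  have "(int m - 2 * w) * 1 \<le> (int m - 2 * w) * S" using 6 S1 by (intro mult_left_mono) auto
  hence "2 * (1 + w) + (int m - 2 * w) * 1 \<le> int l - 1"
    using add_mono[OF 5] 4 order_trans by blast
  thus False using int_l_less by simp
qed

text \<open>If 2 B c \<le> l - 2 for all c, then \<open>U_A\<close> makes the total cost at least m
  (l - 1) - (l - 2) (m - 1) = m + l - 2, which exceeds l - 1.\<close>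

lemma exists_large_B: "\<exists>c\<in>C. int l - 1 \<le> 2 * B c \<and> (\<forall>c'\<in>C. B c' \<le> B c)"
proof -
  have ne: "C \<noteq> {}" using sum_B l_ge by auto
  have "Max (B ` C) \<in> B ` C" using finC ne by (intro Max_in) auto
  then obtain c where "c \<in> C" "B c = Max (B ` C)" by auto
  hence c: "c \<in> C" "\<forall>c'\<in>C. B c' \<le> B c" using finC by auto
  have "int l - 1 \<le> 2 * B c"
  proof (rule ccontr)
    assume "\<not> int l - 1 \<le> 2 * B c"
    hence small: "2 * B c' \<le> int l - 2" if "c' \<in> C" for c' using c that by force
    have "int m * (int l - 1) - (int l - 2) * (\<Sum>c\<in>C. A c) =
          (\<Sum>c'\<in>C. int m * B c' - (int l - 2) * A c')"
      by (simp add: sum_subtractf sum_B flip: sum_distrib_left)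
    also have "\<dots> \<le> (\<Sum>c'\<in>C. U c' * B c' + R c')"
    proof (rule sum_mono)
      fix c' assume c': "c' \<in> C"
      have "(int m - 2 * A c') * B c' \<le> U c' * B c'"
        using U_A[OF c'] B_nonneg by (intro mult_right_mono) auto
      moreover have "A c' * (2 * B c') \<le> A c' * (int l - 2)"
        using small[OF c'] A_nonneg by (intro mult_left_mono) auto
      ultimately show "int m * B c' - (int l - 2) * A c' \<le> U c' * B c' + R c'"
        using R_nonneg[of c'] by (simp add: algebra_simps)
    qed
    finally have "int m * (int l - 1) - (int l - 2) * (\<Sum>c\<in>C. A c) \<le> int l - 1"
      using sum_U_B by linarith
    moreover have "(int l - 2) * (\<Sum>c\<in>C. A c) \<le> (int l - 2) * (int m - 1)"
      using sum_A l_ge by (intro mult_left_mono) auto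
    ultimately show False using l_less l_ge by (simp add: algebra_simps)
  qed
  with c show ?thesis by blast
qed

text \<open>The values other than c contribute at least 2 A c - m + 2 copies of
  their share of the ramification of gs.\<close>

lemma excess:
  assumes c: "c \<in> C"
  defines "\<nu> \<equiv> int l - 1 - B c"
  shows "(\<Sum>x\<in>Xs c. E c x + \<nu> * (int (a x) - 2)) +
         2 * \<nu> * (\<Sum>x\<in>Xs c. int (\<alpha> x) + 1 - int (a x)) \<le> B c - \<nu>"
proof -
  have nu: "\<nu> = (\<Sum>c'\<in>C - {c}. B c')" using B_except[OF c] by (simp add: \<nu>_def)
  have "(2 * A c - int m + 2) * \<nu> = (\<Sum>c'\<in>C - {c}. (2 * A c - int m + 2) * B c')"
    by (simp add: nu sum_distrib_left)
  also have "\<dots> \<le> (\<Sum>c'\<in>C - {c}. U c' * B c' + R c')"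
  proof (rule sum_mono)
    fix c' assume c': "c' \<in> C - {c}"
    have "(2 * A c - int m + 2) * B c' \<le> U c' * B c'"
      using c' U_A[of c'] A_le_except[OF c'] A_except[OF c] B_nonneg by (intro mult_right_mono) auto
    thus "(2 * A c - int m + 2) * B c' \<le> U c' * B c' + R c'" using R_nonneg[of c'] by linarith
  qed
  finally have 1: "(\<Sum>x\<in>Xs c. E c x) + (2 * A c - int m + 2) * \<nu> \<le> B c + \<nu>"
    using sum_E_except[OF c] by (simp add: \<nu>_def)
  have 2: "(\<Sum>x\<in>Xs c. int (\<alpha> x) + 1 - int (a x)) = A c + int (card (Xs c)) - int m"
    using sum_a_int[OF c] by (simp add: sum_subtractf sum.distrib A_def)
  have 3: "(\<Sum>x\<in>Xs c. E c x + \<nu> * (int (a x) - 2)) =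
           (\<Sum>x\<in>Xs c. E c x) + \<nu> * (int m - 2 * int (card (Xs c)))"
    using sum_a_int[OF c] by (simp add: sum_subtractf sum.distrib flip: sum_distrib_left)
  show ?thesis using 1 unfolding 2 3 by (simp add: algebra_simps)
qed

lemma tame_\<beta>:
  assumes "\<forall>c\<in>C. B c < int l - 1" "c \<in> C" "y \<in> Ys c"
  shows "\<beta> y = b y - 1"
  using wild_concentrated[OF assms(2,3)] assms \<beta>_ge[of y] b_pos[OF assms(2,3)] by force

text \<open>The ramification of a tame Dickson polynomial T_n(x, z): over its two critical values,
  the square roots of 4 z^n, all indices are 1 or 2. The condition on D says that h has no critical
  point above a ramified point of g, and the last equation that the whole budget is spent above
  unramified ones.\<close>

definition dickson_type :: "'c \<Rightarrow> 'c \<Rightarrow> bool" where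
  "dickson_type c0 c1 \<longleftrightarrow> c0 \<in> C \<and> c1 \<in> C \<and> c0 \<noteq> c1 \<and>
     (\<forall>c\<in>C - {c0, c1}. (\<forall>x\<in>Xs c. \<alpha> x = 0) \<and> (\<forall>y\<in>Ys c. \<beta> y = 0)) \<and>
     (\<forall>c\<in>{c0, c1}. (\<forall>x\<in>Xs c. a x \<in> {1, 2} \<and> \<alpha> x = a x - 1) \<and>
                    (\<forall>y\<in>Ys c. b y \<in> {1, 2} \<and> \<beta> y = b y - 1) \<and>
                    (\<exists>x\<in>Xs c. a x = 2) \<and>
                    (\<forall>x\<in>Xs c. \<forall>y\<in>Ys c. a x = 2 \<longrightarrow> D x y = 0)) \<and>
     (\<Sum>x\<in>Xs c0. \<alpha> x) + (\<Sum>x\<in>Xs c1. \<alpha> x) = m - 1 \<and>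
     (\<Sum>y\<in>Ys c0. \<beta> y) + (\<Sum>y\<in>Ys c1. \<beta> y) = l - 1 \<and>
     U c0 * B c0 + U c1 * B c1 = int l - 1"

lemma A_eq_0D: "A c = 0 \<Longrightarrow> c \<in> C \<Longrightarrow> x \<in> Xs c \<Longrightarrow> \<alpha> x = 0"
  using finX unfolding A_def by (subst (asm) sum_nonneg_eq_0_iff) auto

lemma B_eq_0D: "B c = 0 \<Longrightarrow> c \<in> C \<Longrightarrow> y \<in> Ys c \<Longrightarrow> \<beta> y = 0"
  using finY unfolding B_def by (subst (asm) sum_nonneg_eq_0_iff) auto

lemma R_eq_0D:
  assumes "R c = 0" "c \<in> C" "x \<in> Xs c" "a x \<noteq> 1" "y \<in> Ys c"
  shows "D x y = 0"
proof -
  have "E c x = 0"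
    using assms finX E_nonneg unfolding R_def by (subst (asm) sum_nonneg_eq_0_iff) auto
  thus ?thesis using assms finY unfolding E_def by (subst (asm) sum_nonneg_eq_0_iff) auto
qed

text \<open>Nothing is assumed about the indices of gs. They follow from one point x of index 2: as
  D x y = 0, \<open>D_ge2\<close> becomes b y \<le> gcd 2 (b y).\<close>

lemma dickson_typeI:
  assumes c: "c0 \<in> C" "c1 \<in> C" "c0 \<noteq> c1"
    and rest: "\<And>c. c \<in> C - {c0, c1} \<Longrightarrow> A c = 0 \<and> B c = 0"
    and sumA: "A c0 + A c1 = int m - 1"
    and UA: "\<And>c. c \<in> {c0, c1} \<Longrightarrow> int m - U c = 2 * A c"
    and A_pos: "\<And>c. c \<in> {c0, c1} \<Longrightarrow> 0 < A c"
    and tame: "\<And>c. c \<in> C \<Longrightarrow> B c < int l - 1"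
    and R0: "R c0 = 0" "R c1 = 0"
    and UB: "U c0 * B c0 + U c1 * B c1 = int l - 1"
  shows "dickson_type c0 c1"
proof -
  have a12: "a x \<in> {1, 2} \<and> \<alpha> x = a x - 1" if "c \<in> {c0, c1}" "x \<in> Xs c" for c x
    using U_A_eq[OF _ UA that(2)] that c by blast
  have ex2: "\<exists>x\<in>Xs c. a x = 2" if cc: "c \<in> {c0, c1}" for c
  proof (rule ccontr)
    assume "\<not> ?thesis"
    hence "\<forall>x\<in>Xs c. \<alpha> x = 0" using a12[OF cc] by force
    hence "A c = 0" by (simp add: A_def)
    thus False using A_pos[OF cc] by simp
  qed
  have D0: "D x y = 0" if "c \<in> {c0, c1}" "x \<in> Xs c" "y \<in> Ys c" "a x = 2" for c x y
    using R_eq_0D[of c x y] that R0 c by auto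
  have b12: "b y \<in> {1, 2} \<and> \<beta> y = b y - 1" if cc: "c \<in> {c0, c1}" and y: "y \<in> Ys c" for c y
  proof -
    have cC: "c \<in> C" using cc c by auto
    obtain x where x: "x \<in> Xs c" "a x = 2" using ex2[OF cc] by blast
    have "b y \<le> gcd 2 (b y)" using D_ge2[OF cC x(1) y] D0[OF cc x(1) y x(2)] x by simp
    also have "\<dots> \<le> 2" by (rule gcd_le1_nat) simp
    finally have "b y \<in> {1, 2}" using b_pos[OF cC y] by auto
    moreover have "\<beta> y = b y - 1" using tame_\<beta>[OF _ cC y] tame by blast
    ultimately show ?thesis by blast
  qed
  have "(\<Sum>c\<in>C. B c) = (\<Sum>c\<in>{c0, c1}. B c)"
    using c finC rest by (intro sum.mono_neutral_right) auto
  hence sumB: "B c0 + B c1 = int l - 1" using c sum_B by simp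
  have rest0: "(\<forall>x\<in>Xs c. \<alpha> x = 0) \<and> (\<forall>y\<in>Ys c. \<beta> y = 0)" if "c \<in> C - {c0, c1}" for c
    using rest[OF that] that A_eq_0D B_eq_0D by blast
  have "int ((\<Sum>x\<in>Xs c0. \<alpha> x) + (\<Sum>x\<in>Xs c1. \<alpha> x)) = int (m - 1)"
    using sumA l_less by (simp add: A_def of_nat_diff)
  moreover have "int ((\<Sum>y\<in>Ys c0. \<beta> y) + (\<Sum>y\<in>Ys c1. \<beta> y)) = int (l - 1)"
    using sumB l_ge by (simp add: B_def of_nat_diff)
  ultimately show ?thesis
    unfolding dickson_type_def of_nat_eq_iff
    using c UB ex2 D0 a12 b12 rest0 by auto
qed

text \<open>No value carries more than half of the ramification of gs, and c carries exactly half.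
  The budget then forces all slacks to vanish: g ramifies only over values that carry half of the
  ramification of gs, so over at most two. A single one is impossible, since 2 A c = m - U c does
  not allow A c = m - 1.\<close>

lemma balanced_dickson:
  assumes c: "c \<in> C" and bal: "2 * B c = int l - 1" and max: "\<forall>c'\<in>C. B c' \<le> B c"
  shows "\<exists>c0 c1. dickson_type c0 c1"
proof -
  have l3: "3 \<le> l" using bal l_ge by presburger
  have le: "2 * B c' \<le> int l - 1" if "c' \<in> C" for c' using that bal max by force
  \<comment> \<open>Three nonnegative slacks: the one of \<open>U_A\<close> weighted by B, the
    distance of 2 B from l - 1 weighted by A, and R. Added up over all values the products A B
    cancel, and the budget together with \<open>sum_A\<close> bounds the total by 0.\<close>
  define F where "F c = (U c - (int m - 2 * A c)) * B c + A c * (int l - 1 - 2 * B c) + R c" for c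
  have F_nonneg: "0 \<le> (U c - (int m - 2 * A c)) * B c" "0 \<le> A c * (int l - 1 - 2 * B c)" "0 \<le> R c"
    if "c \<in> C" for c
    using U_A[OF that] le[OF that] A_nonneg B_nonneg R_nonneg by auto
  have "(\<Sum>c\<in>C. F c) = (\<Sum>c\<in>C. (U c * B c + R c) - int m * B c + (int l - 1) * A c)"
    by (intro sum.cong) (auto simp: F_def algebra_simps)
  also have "\<dots> = (\<Sum>c\<in>C. U c * B c + R c) - int m * (int l - 1) + (int l - 1) * (\<Sum>c\<in>C. A c)"
    by (simp add: sum.distrib sum_subtractf sum_B flip: sum_distrib_left)
  finally have F: "(\<Sum>c\<in>C. F c) = (\<Sum>c\<in>C. U c * B c + R c) - int m * (int l - 1) + (int l - 1) * (\<Sum>c\<in>C. A c)" .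
  have A1: "(int l - 1) * (\<Sum>c\<in>C. A c) \<le> (int l - 1) * (int m - 1)"
    using sum_A l_ge by (intro mult_left_mono) auto
  have "0 \<le> (\<Sum>c\<in>C. F c)" unfolding F_def using F_nonneg by (intro sum_nonneg add_nonneg_nonneg) auto
  hence F0: "(\<Sum>c\<in>C. F c) = 0" and A2: "(int l - 1) * (\<Sum>c\<in>C. A c) = (int l - 1) * (int m - 1)"
    using F A1 sum_U_B by (auto simp: algebra_simps)
  have Fz: "F c = 0" if "c \<in> C" for c
    using F0 that finC F_nonneg unfolding F_def by (subst (asm) sum_nonneg_eq_0_iff) auto
  hence z: "(U c - (int m - 2 * A c)) * B c = 0" "A c * (int l - 1 - 2 * B c) = 0" "R c = 0"
    if "c \<in> C" for c
    using F_nonneg[OF that] Fz[OF that] unfolding F_def by linarith+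
  have sA: "(\<Sum>c\<in>C. A c) = int m - 1" using A2 l_ge by simp
  define P where "P = {c \<in> C. 2 * B c = int l - 1}"
  have finP: "finite P" using finC by (simp add: P_def)
  have "(\<Sum>c\<in>P. int l - 1) = (\<Sum>c\<in>P. 2 * B c)" by (intro sum.cong) (auto simp: P_def)
  also have "\<dots> \<le> (\<Sum>c\<in>C. 2 * B c)"
    using finC B_nonneg by (intro sum_mono2) (auto simp: P_def)
  also have "\<dots> = 2 * (int l - 1)" by (simp add: sum_B flip: sum_distrib_left)
  finally have "int (card P) * (int l - 1) \<le> 2 * (int l - 1)" by simp
  hence "int (card P) \<le> 2" using l3 by (subst (asm) mult_le_cancel_right) auto
  have APos: "c \<in> P" if "c \<in> C" "A c \<noteq> 0" for c using z(2)[of c] that by (auto simp: P_def)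
  have AP: "(\<Sum>c\<in>P. A c) = int m - 1"
    unfolding sA[symmetric] using finC APos by (intro sum.mono_neutral_left) (auto simp: P_def)
  have UAP: "int m - U c = 2 * A c" if "c \<in> P" for c
    using z(1)[of c] that l3 by (auto simp: P_def)
  have lt: "A c < int m - 1" if "c \<in> P" for c
    using UAP[OF that] U_nonneg[of c] l_less l3 by linarith
  have "card P \<noteq> 0" using AP finP l_less l3 by auto
  moreover have "card P \<noteq> 1"
  proof
    assume "card P = 1"
    then obtain c where "P = {c}" by (auto simp: card_1_singleton_iff)
    thus False using AP lt[of c] by simp
  qed
  ultimately have "card P = 2" using \<open>int (card P) \<le> 2\<close> by linarith
  then obtain c0 c1 where P: "P = {c0, c1}" "c0 \<noteq> c1" by (auto simp: card_2_iff)
  have inC: "c0 \<in> C" "c1 \<in> C" and B01: "2 * B c0 = int l - 1" "2 * B c1 = int l - 1"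
    using P(1) by (auto simp: P_def)
  have sA01: "A c0 + A c1 = int m - 1" using AP P by simp
  have "(\<Sum>c\<in>C - {c0, c1}. B c) = 0"
    using sum_B inC P(2) finC B01 sum.subset_diff[of "{c0, c1}" C B] by simp
  hence restB: "B c = 0" if "c \<in> C - {c0, c1}" for c
    using that finC B_nonneg by (subst (asm) sum_nonneg_eq_0_iff) auto
  have UAs: "U c0 = int m - 2 * A c0" "U c1 = int m - 2 * A c1"
    using UAP[of c0] UAP[of c1] P(1) by auto
  have "dickson_type c0 c1"
  proof (rule dickson_typeI)
    show "A c = 0 \<and> B c = 0" if "c \<in> C - {c0, c1}" for c
      using that restB APos[of c] P(1) by auto
    show "int m - U c = 2 * A c" if "c \<in> {c0, c1}" for c using that UAP P(1) by blast
    show "0 < A c" if "c \<in> {c0, c1}" for c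
      using that sA01 lt[of c0] lt[of c1] P(1) by auto
    show "B c < int l - 1" if "c \<in> C" for c using le[OF that] l3 by linarith
    have "2 * (U c0 * B c0 + U c1 * B c1) = (U c0 + U c1) * (int l - 1)"
      unfolding distrib_left distrib_right mult.left_commute[of 2] B01 by simp
    also have "U c0 + U c1 = 2" using UAs sA01 by simp
    finally show "U c0 * B c0 + U c1 * B c1 = int l - 1" by simp
  qed (use inC P sA01 z(3) in auto)
  thus ?thesis by blast
qed

text \<open>By \<open>excess\<close> the costs q and r over c add up to at most \<epsilon> = B c -
  \<nu>, while a single unramified point already has q \<ge> \<epsilon>. So there is exactly one
  such point, every other point of the fibre has index 2 and no zero of the derivative of h above
  it, and such a point forces b \<le> 2. What is left of the budget is tight as well and singles out
  a second value, again with one unramified point.\<close>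

lemma unbalanced_dickson:
  assumes c: "c \<in> C" and B1: "int l - 1 < 2 * B c" and B2: "B c < int l - 1"
    and U1: "1 \<le> U c"
  shows "\<exists>c0 c1. dickson_type c0 c1"
proof -
  define \<nu> where "\<nu> = int l - 1 - B c"
  define \<epsilon> where "\<epsilon> = B c - \<nu>"
  have nu: "1 \<le> \<nu>" "1 \<le> \<epsilon>" using B1 B2 by (auto simp: \<nu>_def \<epsilon>_def)
  have tame: "B c' < int l - 1" if "c' \<in> C" for c'
  proof (cases "c' = c")
    case False
    have "B c' \<le> (\<Sum>c'\<in>C - {c}. B c')"
      using that False finC B_nonneg by (intro member_le_sum) auto
    thus ?thesis using B_except[OF c] B1 l_ge by linarith
  qed (use B2 in auto)
  define q where "q x = E c x + \<nu> * (int (a x) - 2)" for x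
  define r where "r x = 2 * \<nu> * (int (\<alpha> x) + 1 - int (a x))" for x
  have r_nonneg: "0 \<le> r x" for x using nu \<alpha>_ge[of x] by (auto simp: r_def)
  have ex: "(\<Sum>x\<in>Xs c. q x) + (\<Sum>x\<in>Xs c. r x) \<le> \<epsilon>"
    using excess[OF c] unfolding q_def r_def \<nu>_def \<epsilon>_def by (simp add: sum_distrib_left)
  have q1: "\<epsilon> \<le> q x" if "x \<in> Xs c" "a x = 1" for x
    using E_1[OF c that] that by (simp add: q_def \<epsilon>_def)
  have q2: "0 \<le> q x" if "x \<in> Xs c" "a x \<noteq> 1" for x
    using E_nonneg[of c x] a_pos[OF c that(1)] that nu
    by (auto simp: q_def intro!: add_nonneg_nonneg mult_nonneg_nonneg)
  obtain x1 where x1: "x1 \<in> Xs c" "a x1 = 1"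
    using U1 unfolding U_def
    by (metis (mono_tags, lifting) Collect_empty_eq card.empty of_nat_0 linorder_not_le less_numeral_extra(1))
  have q_all: "0 \<le> q x" if "x \<in> Xs c" for x
    using q1[OF that] q2[OF that] nu by (cases "a x = 1") auto
  have "(\<Sum>x\<in>Xs c. q x) = q x1 + (\<Sum>x\<in>Xs c - {x1}. q x)"
    using x1 finX[OF c] by (simp add: sum.remove)
  moreover have "0 \<le> (\<Sum>x\<in>Xs c - {x1}. q x)" "0 \<le> (\<Sum>x\<in>Xs c. r x)"
    using q_all r_nonneg by (auto intro!: sum_nonneg)
  ultimately have z: "(\<Sum>x\<in>Xs c - {x1}. q x) = 0" "(\<Sum>x\<in>Xs c. r x) = 0" "q x1 \<le> \<epsilon>"
    using ex q1[OF x1] by linarith+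
  have q0: "q x = 0" if "x \<in> Xs c - {x1}" for x
    using z(1) that finX[OF c] q_all by (subst (asm) sum_nonneg_eq_0_iff) auto
  have r0: "int (\<alpha> x) + 1 - int (a x) = 0" if "x \<in> Xs c" for x
    using z(2) that finX[OF c] r_nonneg nu by (subst (asm) sum_nonneg_eq_0_iff) (auto simp: r_def)
  have a2: "a x = 2 \<and> E c x = 0" if x: "x \<in> Xs c - {x1}" for x
  proof -
    have "a x \<noteq> 1" using q0[OF x] q1[of x] x nu by auto
    hence ge2: "2 \<le> a x" using a_pos[OF c, of x] x by auto
    have "E c x + \<nu> * (int (a x) - 2) = 0" using q0[OF x] by (simp add: q_def)
    moreover have "0 \<le> \<nu> * (int (a x) - 2)" using ge2 nu by auto
    ultimately have "E c x = 0" "\<nu> * (int (a x) - 2) = 0" using E_nonneg[of c x] by linarith+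
    thus ?thesis using nu by auto
  qed
  have "{x \<in> Xs c. a x = 1} = {x1}" using a2 x1 by fastforce
  hence Uc: "U c = 1" by (simp add: U_def)
  have Rc: "R c = 0" unfolding R_def using a2 x1 by (intro sum.neutral) auto
  have "int m = (\<Sum>x\<in>Xs c. int (a x))" using sum_a_int[OF c] by simp
  also have "\<dots> = 1 + (\<Sum>x\<in>Xs c - {x1}. int (a x))"
    using x1 finX[OF c] by (simp add: sum.remove)
  also have "(\<Sum>x\<in>Xs c - {x1}. int (a x)) = (\<Sum>x\<in>Xs c - {x1}. 2 * int (\<alpha> x))"
    using a2 r0 by (intro sum.cong) force+
  also have "\<dots> = 2 * A c"
    using x1 finX[OF c] \<alpha>_1[OF x1(2)] by (simp add: A_def sum.remove sum_distrib_left)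
  finally have Ac: "int m - 1 = 2 * A c" by simp
  have Apos: "0 < A c" using Ac l_ge l_less by linarith
  have "\<exists>x\<in>Xs c. a x = 2"
  proof (rule ccontr)
    assume "\<not> ?thesis"
    hence "Xs c = {x1}" using a2 x1 by blast
    thus False using sum_a[OF c] x1 l_less l_ge by simp
  qed
  then obtain x2 where x2: "x2 \<in> Xs c" "a x2 = 2" by blast
  have D2: "D x2 y = 0" if "y \<in> Ys c" for y
  proof -
    have "x2 \<noteq> x1" using x1 x2 by auto
    hence "E c x2 = 0" using a2[of x2] x2 by auto
    thus ?thesis using that finY[OF c] unfolding E_def by (subst (asm) sum_nonneg_eq_0_iff) auto
  qed
  have b2: "2 * \<beta> y \<le> b y" if y: "y \<in> Ys c" for y
  proof -
    have "b y \<le> gcd 2 (b y)" using D_ge2[OF c x2(1) y] D2[OF y] x2 by simp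
    also have "\<dots> \<le> 2" by (rule gcd_le1_nat) simp
    finally show ?thesis using b_pos[OF c y] tame_\<beta>[OF _ c y] tame by force
  qed
  have "2 * B c \<le> (\<Sum>y\<in>Ys c. int (b y))"
    unfolding B_def sum_distrib_left using b2 by (intro sum_mono) force
  hence Bl: "2 * B c = int l" using sum_b_int[OF c] B1 by simp
  have Aex: "(\<Sum>c'\<in>C - {c}. A c') \<le> A c" using A_except[OF c] Ac by linarith
  have Bex: "(\<Sum>c'\<in>C - {c}. B c') = \<nu>" using B_except[OF c] by (simp add: \<nu>_def)
  \<comment> \<open>Again slacks over the remaining values. The second one is nonnegative because
    these values together have ramification at most A c = (m - 1) / 2, and what c leaves of the
    budget makes the total at most 0.\<close>
  define F where "F c' = (U c' - (int m - 2 * A c')) * B c' + (int m - 2 * A c' - 1) * B c' + R c'" for c'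
  have F_nonneg: "0 \<le> (U c' - (int m - 2 * A c')) * B c'" "0 \<le> (int m - 2 * A c' - 1) * B c'" "0 \<le> R c'"
    if "c' \<in> C - {c}" for c'
    using U_A[of c'] A_le_except[OF that] B_nonneg[of c'] R_nonneg Aex Ac that
    by (auto intro!: mult_nonneg_nonneg)
  have "(\<Sum>c'\<in>C - {c}. F c') = (\<Sum>c'\<in>C - {c}. (U c' * B c' + R c') - B c')"
    by (intro sum.cong) (auto simp: F_def algebra_simps)
  also have "\<dots> = (\<Sum>c'\<in>C - {c}. U c' * B c' + R c') - \<nu>" by (simp add: sum_subtractf Bex)
  also have "\<dots> \<le> 0" using sum_E_except[OF c] sum_E_split[OF c] Uc Rc by (simp add: \<nu>_def)
  finally have "(\<Sum>c'\<in>C - {c}. F c') \<le> 0" .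
  moreover have "0 \<le> (\<Sum>c'\<in>C - {c}. F c')"
    unfolding F_def using F_nonneg by (intro sum_nonneg add_nonneg_nonneg) auto
  ultimately have "(\<Sum>c'\<in>C - {c}. F c') = 0" by simp
  hence Fz: "F c' = 0" if "c' \<in> C - {c}" for c'
    using that finC F_nonneg unfolding F_def by (subst (asm) sum_nonneg_eq_0_iff) auto
  hence z: "(U c' - (int m - 2 * A c')) * B c' = 0" "(int m - 2 * A c' - 1) * B c' = 0" "R c' = 0"
    if "c' \<in> C - {c}" for c' using F_nonneg[OF that] Fz[OF that] unfolding F_def by linarith+
  have "\<exists>c1\<in>C - {c}. B c1 \<noteq> 0"
  proof (rule ccontr)
    assume "\<not> ?thesis"
    hence "(\<Sum>c'\<in>C - {c}. B c') = 0" by (intro sum.neutral) auto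
    thus False using Bex nu by simp
  qed
  then obtain c1 where c1: "c1 \<in> C - {c}" "B c1 \<noteq> 0" by blast
  have A1: "A c1 = A c" "U c1 = 1" using z(1,2)[OF c1(1)] c1(2) Ac by auto
  have "(\<Sum>c'\<in>C - {c} - {c1}. A c') = 0"
    using Aex A1 c1 finC A_nonneg by (intro antisym sum_nonneg) (auto simp: sum.remove)
  hence A0: "A c' = 0" if "c' \<in> C - {c, c1}" for c'
    using that finC A_nonneg by (subst (asm) sum_nonneg_eq_0_iff) auto
  have B0: "B c' = 0" if "c' \<in> C - {c, c1}" for c'
  proof (rule ccontr)
    assume "B c' \<noteq> 0"
    hence "int m - 1 = 2 * A c'" using z(2)[of c'] that by auto
    thus False using A0[OF that] Ac Apos by simp
  qed
  have "(\<Sum>c'\<in>C. B c') = (\<Sum>c'\<in>{c, c1}. B c')"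
    using c c1 finC B0 by (intro sum.mono_neutral_right) auto
  also have "\<dots> = B c + B c1" using c1 by (subst sum.insert) auto
  finally have B01: "B c + B c1 = int l - 1" using sum_B by simp
  have "dickson_type c c1"
    by (rule dickson_typeI) (use c c1 A0 B0 Ac A1 Uc Rc z(3) tame Apos B01 in auto)
  thus ?thesis by blast
qed

end

text \<open>Rules out the last tame possibility: c carries more than half, but not all, of the
  ramification of gs, and g has no unramified point over c. The hypothesis \<open>le\<close> is
  \<open>excess\<close> with E bounded below by \<open>D_ge2\<close>. If bs is the largest b, its
  right side equals W + bs - 1, where W adds up b - 2 over the remaining y, and each q x is at least
  W plus the loss at bs. With at least two points x this leaves so little room that every a x equals
  bs; then bs divides m, and the few remaining shapes of the b contradict coprimality.\<close>

lemma no_tame_unramified_free_fibre: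
  fixes a :: "'x \<Rightarrow> nat" and b :: "'y \<Rightarrow> nat"
  assumes fin: "finite Xs" "finite Ys"
    and a2: "\<And>x. x \<in> Xs \<Longrightarrow> 2 \<le> a x" and b1: "\<And>y. y \<in> Ys \<Longrightarrow> 1 \<le> b y"
    and sum_a: "(\<Sum>x\<in>Xs. a x) = m" and sum_b: "(\<Sum>y\<in>Ys. b y) = l"
    and cop: "coprime l m" and lm: "l < m"
    and N: "2 \<le> card Ys" "2 * card Ys \<le> l"
    and le: "(\<Sum>x\<in>Xs. (\<Sum>y\<in>Ys. int (b y) - int (gcd (a x) (b y))) + (int (card Ys) - 1) * (int (a x) - 2))
              \<le> int l + 1 - 2 * int (card Ys)"
  shows False
proof -
  define N where "N = int (card Ys)"
  define g where "g x y = int (gcd (a x) (b y))" for x y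
  define q where "q x = (\<Sum>y\<in>Ys. int (b y) - g x y) + (N - 1) * (int (a x) - 2)" for x
  have le': "(\<Sum>x\<in>Xs. q x) \<le> int l + 1 - 2 * N" using le by (simp add: q_def N_def g_def)
  have g_a: "g x y \<le> int (a x)" if "x \<in> Xs" for x y
  proof -
    have "gcd (a x) (b y) \<le> a x" using a2[OF that] by (intro gcd_le1_nat) auto
    thus ?thesis by (simp add: g_def)
  qed
  have g_b: "g x y \<le> int (b y)" if "y \<in> Ys" for x y
  proof -
    have "gcd (a x) (b y) \<le> b y" using b1[OF that] by (intro gcd_le2_nat) auto
    thus ?thesis by (simp add: g_def)
  qed
  have ne: "Ys \<noteq> {}" using N by auto
  have "Max (b ` Ys) \<in> b ` Ys" using fin ne by (intro Max_in) auto
  then obtain ys where ys: "ys \<in> Ys" "b ys = Max (b ` Ys)" by auto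
  define bs where "bs = b ys"
  have b_le: "b y \<le> bs" if "y \<in> Ys" for y using ys fin that by (auto simp: bs_def)
  have card_rest: "int (card (Ys - {ys})) = N - 1"
    using ys fin N by (simp add: N_def card_Diff_singleton of_nat_diff)
  \<comment> \<open>The N - 1 copies of a x - 2 are distributed over the y other than ys, one to
    each; every summand then dominates both b y - 2 and a x - 2.\<close>
  have q_eq: "q x = (int bs - g x ys) + (\<Sum>y\<in>Ys - {ys}. int (b y) - g x y + int (a x) - 2)" for x
  proof -
    have "(\<Sum>y\<in>Ys - {ys}. int (b y) - g x y + int (a x) - 2) =
          (\<Sum>y\<in>Ys - {ys}. int (b y) - g x y) + (\<Sum>y\<in>Ys - {ys}. int (a x) - 2)"
      by (simp add: sum.distrib sum_subtractf algebra_simps)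
    also have "(\<Sum>y\<in>Ys - {ys}. int (a x) - 2) = (N - 1) * (int (a x) - 2)"
      unfolding sum_constant card_rest by simp
    finally show ?thesis using ys fin by (simp add: q_def sum.remove bs_def)
  qed
  have term_ge: "int (b y) - 2 \<le> int (b y) - g x y + int (a x) - 2"
    "int (a x) - 2 \<le> int (b y) - g x y + int (a x) - 2"
    if "x \<in> Xs" "y \<in> Ys" for x y using g_a[OF that(1)] g_b[OF that(2)] by (auto simp: algebra_simps)
  define W where "W = (\<Sum>y\<in>Ys - {ys}. int (b y) - 2)"
  have eps: "int l + 1 - 2 * N = W + int bs - 1"
  proof -
    have "int l = (\<Sum>y\<in>Ys. int (b y))" using sum_b by (metis of_nat_sum)
    also have "\<dots> = int bs + (\<Sum>y\<in>Ys - {ys}. int (b y))"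
      using ys fin by (simp add: sum.remove bs_def)
    finally show ?thesis
      using ys fin N by (simp add: W_def sum_subtractf N_def card_Diff_singleton of_nat_diff)
  qed
  obtain y1 where y1: "y1 \<in> Ys - {ys}"
  proof -
    have "Ys - {ys} \<noteq> {}"
    proof
      assume "Ys - {ys} = {}"
      hence "Ys = {ys}" using ys by auto
      thus False using N by simp
    qed
    thus ?thesis using that by blast
  qed
  have q_ge1: "(int bs - g x ys) + W \<le> q x" if "x \<in> Xs" for x
    unfolding q_eq W_def using term_ge(1)[OF that] by (intro add_left_mono sum_mono) auto
  have q_ge2: "(int bs - g x ys) + (N - 1) * (int (a x) - 2) \<le> q x" if "x \<in> Xs" for x
  proof -
    have "(N - 1) * (int (a x) - 2) = (\<Sum>y\<in>Ys - {ys}. int (a x) - 2)"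
      unfolding sum_constant card_rest by simp
    also have "\<dots> \<le> (\<Sum>y\<in>Ys - {ys}. int (b y) - g x y + int (a x) - 2)"
      using term_ge(2)[OF that] by (intro sum_mono) auto
    finally show ?thesis by (simp add: q_eq)
  qed
  have N2: "1 \<le> N - 1" using N by (simp add: N_def)
  have q_ge3: "(int bs - g x ys) + (int (a x) - 2) \<le> q x" if "x \<in> Xs" for x
  proof -
    have "1 * (int (a x) - 2) \<le> (N - 1) * (int (a x) - 2)"
      using N2 a2[OF that] by (intro mult_right_mono) auto
    hence "(int bs - g x ys) + (int (a x) - 2) \<le> (int bs - g x ys) + (N - 1) * (int (a x) - 2)" by simp
    thus ?thesis using q_ge2[OF that] by (rule order_trans)
  qed
  have q_nonneg: "0 \<le> q x" if "x \<in> Xs" for x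
    using q_ge3[OF that] g_b[OF ys(1), of x] a2[OF that] by (simp add: bs_def)
  have single: "q x \<le> int l + 1 - 2 * N" if "x \<in> Xs" for x
  proof -
    have "q x \<le> (\<Sum>x\<in>Xs. q x)" using that fin q_nonneg by (intro member_le_sum) auto
    thus ?thesis using le' by linarith
  qed
  have two: "q x + q x' \<le> int l + 1 - 2 * N" if "x \<in> Xs" "x' \<in> Xs" "x \<noteq> x'" for x x'
  proof -
    have "(\<Sum>x\<in>{x, x'}. q x) \<le> (\<Sum>x\<in>Xs. q x)"
      using that fin q_nonneg by (intro sum_mono2) auto
    thus ?thesis using le' that by simp
  qed
  have Xne: "Xs \<noteq> {}" using sum_a lm by auto
  have other: "\<exists>x'\<in>Xs. x' \<noteq> x" if x: "x \<in> Xs" for x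
  proof (rule ccontr)
    assume "\<not> ?thesis"
    hence "Xs = {x}" using x by blast
    hence am: "a x = m" using sum_a by simp
    have "1 * (int m - 2) \<le> (N - 1) * (int m - 2)"
      using N2 lm N by (intro mult_right_mono) auto
    hence "int m - 2 \<le> int l + 1 - 2 * N"
      using q_ge2[OF x] single[OF x] g_b[OF ys(1), of x] am by (simp add: bs_def)
    thus False using lm N2 by linarith
  qed
  show False
  proof (cases "bs \<le> 2")
    case True
    have "(\<Sum>y\<in>Ys. 2 - b y) = 0"
    proof -
      have "int (\<Sum>y\<in>Ys. 2 - b y) = (\<Sum>y\<in>Ys. 2 - int (b y))"
        unfolding of_nat_sum using b_le True by (intro sum.cong refl) (force simp: of_nat_diff)
      also have "\<dots> = 2 * N - int l"
        using sum_b by (simp add: sum_subtractf N_def flip: of_nat_sum)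
      also have "\<dots> \<le> 0" using N by (simp add: N_def)
      finally show ?thesis by (simp only: of_nat_le_0_iff)
    qed
    hence b2: "b y = 2" if "y \<in> Ys" for y
      using that fin b_le[OF that] True by (auto simp: sum_eq_0_iff)
    hence l2: "int l = 2 * N" using sum_b by (simp add: N_def mult.commute flip: of_nat_sum)
    hence "even l" by presburger
    hence "odd m" using cop by (metis coprime_common_divisor_nat even_prod_iff odd_one coprime_iff_gcd_eq_1 gcd_greatest)
    hence "\<exists>x\<in>Xs. odd (a x)" using sum_a by (metis dvd_sum)
    then obtain x where x: "x \<in> Xs" "odd (a x)" by blast
    have g1: "g x y = 1" if "y \<in> Ys" for y
    proof -
      have "coprime (a x) 2" using x by simp
      thus ?thesis using b2[OF that] by (simp add: g_def coprime_iff_gcd_eq_1)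
    qed
    have "3 \<le> a x" using x a2[of x] by (cases "a x = 2") auto
    hence "1 * 1 \<le> (N - 1) * (int (a x) - 2)" using N2 by (intro mult_mono) auto
    moreover have "int bs = 2" using b2[OF ys(1)] by (simp add: bs_def)
    ultimately have "2 \<le> q x" using q_ge2[OF x(1)] g1[OF ys(1)] by simp
    thus False using single[OF x(1)] l2 by simp
  next
    case False
    hence bs3: "3 \<le> bs" by simp
    \<comment> \<open>If bs does not divide a x, then g x ys \<le> bs / 2, and the budget left to a
      second point x' gives q x' \<le> g x ys - 1. But q x' \<ge> bs - 2, so bs \<le> 2.\<close>
    have gbs: "g x ys = int bs" if x: "x \<in> Xs" for x
    proof (rule ccontr)
      assume ne: "g x ys \<noteq> int bs"
      obtain x' where x': "x' \<in> Xs" "x' \<noteq> x" using other[OF x] by blast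
      have "\<not> bs dvd a x"
      proof
        assume "bs dvd a x"
        hence "gcd (a x) bs = bs" by (simp add: gcd_nat.absorb2)
        thus False using ne by (simp add: g_def bs_def)
      qed
      hence "2 * int (gcd bs (a x)) \<le> int bs" using half_gcd[of bs "a x"] bs3 by simp
      hence "2 * g x ys \<le> int bs" by (simp add: g_def bs_def gcd.commute)
      moreover have "(int bs - g x' ys) + (int (a x') - 2) \<le> g x ys - 1"
        using two[OF x'(1) x x'(2)] q_ge3[OF x'(1)] q_ge1[OF x] eps by linarith
      ultimately show False using g_a[OF x'(1), of ys] bs3 by linarith
    qed
    have abs: "a x = bs" if x: "x \<in> Xs" for x
    proof -
      obtain x' where x': "x' \<in> Xs" "x' \<noteq> x" using other[OF x] by blast
      have "q x + q x' \<le> W + int bs - 1" using two[OF x x'(1)] x'(2) eps by auto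
      hence le: "int (a x) - 2 \<le> int bs - 1"
        using q_ge3[OF x] q_ge1[OF x'(1)] gbs[OF x] gbs[OF x'(1)] by linarith
      have "gcd (a x) bs = bs" using gbs[OF x] by (simp add: g_def bs_def)
      hence "bs dvd a x" by (metis gcd_dvd1)
      then obtain k where k: "a x = bs * k" by blast
      have "k \<noteq> 0" using k a2[OF x] by (metis mult_0_right not_numeral_le_zero)
      moreover have "k < 2"
      proof (rule ccontr)
        assume "\<not> k < 2"
        hence "bs * 2 \<le> a x" unfolding k by (intro mult_left_mono) auto
        thus False using le bs3 by linarith
      qed
      ultimately have "k = 1" by simp
      thus ?thesis using k by simp
    qed
    obtain x x' where x: "x \<in> Xs" "x' \<in> Xs" "x' \<noteq> x" using Xne other by blast
    have dm: "bs dvd m" unfolding sum_a[symmetric] using abs by (intro dvd_sum) auto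
    have ndl: "\<not> bs dvd l"
    proof
      assume "bs dvd l"
      with dm cop have "is_unit bs" using coprime_common_divisor by blast
      thus False using bs3 by simp
    qed
    have qq: "q x' = q x" using abs x by (simp add: q_def g_def)
    have q2: "2 * q x \<le> W + int bs - 1" using two[OF x(1,2)] x(3) qq eps by auto
    \<comment> \<open>With all indices of g equal to bs, two equal costs give (N - 1) (bs - 2) \<le>
      q x \<le> bs - 1.\<close>
    have "N - 1 \<le> 1 \<or> (N - 1 = 2 \<and> bs = 3)"
    proof -
      have "q x + W \<le> W + int bs - 1" using q2 q_ge1[OF x(1)] gbs[OF x(1)] by linarith
      hence 1: "(N - 1) * (int bs - 2) \<le> int bs - 1"
        using q_ge2[OF x(1), unfolded gbs[OF x(1)] abs[OF x(1)]] by simp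
      have "N - 1 \<le> 2"
      proof (rule ccontr)
        assume "\<not> ?thesis"
        hence "3 * (int bs - 2) \<le> (N - 1) * (int bs - 2)" using bs3 by (intro mult_right_mono) auto
        hence "3 * (int bs - 2) \<le> int bs - 1" using 1 by (rule order_trans)
        thus False using bs3 by simp
      qed
      moreover have "bs = 3" if "N - 1 = 2" using 1 bs3 unfolding that by simp
      ultimately show ?thesis by linarith
    qed
    thus False
    proof
      assume "N - 1 = 2 \<and> bs = 3"
      hence N3: "N = 3" "bs = 3" by auto
      have "2 \<le> q x" using q_ge2[OF x(1)] gbs[OF x(1)] abs[OF x(1)] N3 by simp
      hence W: "2 \<le> W" using q2 N3 by simp
      have "(\<Sum>y\<in>Ys - {ys}. 3 - int (b y)) = 2 - W"
        using ys fin N3 by (simp add: W_def sum_subtractf N_def card_Diff_singleton)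
      hence "(\<Sum>y\<in>Ys - {ys}. 3 - int (b y)) \<le> 0" using W by simp
      moreover have nn: "\<forall>y\<in>Ys - {ys}. 0 \<le> 3 - int (b y)" using b_le N3 by force
      ultimately have "(\<Sum>y\<in>Ys - {ys}. 3 - int (b y)) = 0"
        by (intro antisym sum_nonneg) auto
      hence "\<forall>y\<in>Ys - {ys}. 3 - int (b y) = 0" using nn fin by (subst (asm) sum_nonneg_eq_0_iff) auto
      hence "b y = bs" if "y \<in> Ys" for y using that N3 by (cases "y = ys") (auto simp: bs_def)
      hence "bs dvd l" unfolding sum_b[symmetric] by (intro dvd_sum) auto
      thus False using ndl by blast
    next
      assume "N - 1 \<le> 1"
      hence "card Ys = 2" using N2 by (simp add: N_def)
      hence "card (Ys - {ys}) = 1" using ys fin by simp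
      then obtain y2 where y2: "Ys - {ys} = {y2}" by (rule card_1_singletonE)
      have "y1 = y2" using y1 unfolding y2 by simp
      hence Y: "Ys - {ys} = {y1}" using y2 by (simp only:)
      have qx: "q x = int (b y1) - g x y1 + int bs - 2"
        using q_eq[of x] unfolding gbs[OF x(1)] abs[OF x(1)] Y by simp
      have Wy: "W = int (b y1) - 2" unfolding W_def Y by simp
      have gx: "g x y1 = int (gcd bs (b y1))" using abs[OF x(1)] by (simp add: g_def)
      have yl: "l = bs + b y1"
        using sum_b ys(1) fin Y by (simp add: sum.remove[of Ys ys] bs_def)
      have y1Y: "y1 \<in> Ys" using y1 by auto
      show False
      proof (cases "b y1 dvd bs")
        case True
        hence "b y1 dvd l" "b y1 dvd m" using yl dm by (auto intro: dvd_trans)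
        hence "is_unit (b y1)" using cop coprime_common_divisor by blast
        hence "int (b y1) = 1" by simp
        thus False using q2 qx Wy gx True bs3 by (simp add: gcd_nat.absorb2)
      next
        case False
        hence "2 * g x y1 \<le> int (b y1)" using half_gcd[OF _ False] b1[OF y1Y] gx by (simp add: gcd.commute)
        thus False using q2 qx Wy bs3 by linarith
      qed
    qed
  qed
qed

section \<open>The possible configurations, tame and wild\<close>

context ramification_count begin

text \<open>Decided by a value c that carries at least half of the ramification of gs. Since B c = l
  - card (Ys c) there, carrying all of it means a single point in the fibre of gs; carrying exactly
  half, or more than half with an unramified point of g present, gives the Dickson configuration;
  the rest is excluded above.\<close>

lemma tame_trichotomy:
  assumes tame: "\<And>c y. c \<in> C \<Longrightarrow> y \<in> Ys c \<Longrightarrow> B c = int l - 1 \<Longrightarrow> \<beta> y = b y - 1"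
  shows "(\<exists>c\<in>C. \<exists>y. Ys c = {y}) \<or> (\<exists>c0 c1. dickson_type c0 c1)"
proof -
  obtain c where c: "c \<in> C" "int l - 1 \<le> 2 * B c" "\<forall>c'\<in>C. B c' \<le> B c" using exists_large_B by blast
  have tame': "\<beta> y = b y - 1" if "y \<in> Ys c" for y
    using tame[OF c(1) that] wild_concentrated[OF c(1) that] \<beta>_ge[of y] b_pos[OF c(1) that]
    by (cases "B c = int l - 1"; cases "b y \<le> \<beta> y") auto
  have BN: "B c = int l - int (card (Ys c))"
  proof -
    have "B c = (\<Sum>y\<in>Ys c. int (b y) - 1)"
      unfolding B_def using tame' b_pos[OF c(1)] by (intro sum.cong) (auto simp: of_nat_diff)
    thus ?thesis using sum_b_int[OF c(1)] by (simp add: sum_subtractf)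
  qed
  consider "B c = int l - 1" | "2 * B c = int l - 1" "B c \<noteq> int l - 1"
    | "int l - 1 < 2 * B c" "B c < int l - 1"
    using c(2) B_except[OF c(1)] B_nonneg sum_nonneg[of "C - {c}" B] by force
  thus ?thesis
  proof cases
    case 1
    hence "card (Ys c) = 1" using BN by simp
    then obtain y where "Ys c = {y}" by (auto simp: card_1_singleton_iff)
    thus ?thesis using c(1) by blast
  next
    case 2
    thus ?thesis using balanced_dickson[OF c(1) _ c(3)] by blast
  next
    case 3
    show ?thesis
    proof (cases "1 \<le> U c")
      case True
      thus ?thesis using unbalanced_dickson[OF c(1) 3] by blast
    next
      case False
      hence "U c = 0" using U_nonneg[of c] by linarith
      hence a2: "2 \<le> a x" if "x \<in> Xs c" for x
        using that finX[OF c(1)] a_pos[OF c(1) that] by (auto simp: U_def card_eq_0_iff)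
      define N where "N = int (card (Ys c))"
      have "(\<Sum>x\<in>Xs c. (\<Sum>y\<in>Ys c. int (b y) - int (gcd (a x) (b y))) + (N - 1) * (int (a x) - 2)) \<le>
            (\<Sum>x\<in>Xs c. E c x + (int l - 1 - B c) * (int (a x) - 2))"
        unfolding E_def using D_ge2[OF c(1)]
        by (intro sum_mono add_mono mult_right_mono) (use a2 in \<open>force simp: N_def BN\<close>)+
      also have "\<dots> \<le> int l + 1 - 2 * N"
      proof -
        have "0 \<le> 2 * (int l - 1 - B c) * (\<Sum>x\<in>Xs c. int (\<alpha> x) + 1 - int (a x))"
          using 3 \<alpha>_ge by (intro mult_nonneg_nonneg sum_nonneg) (auto simp: algebra_simps simp flip: of_nat_Suc)
        thus ?thesis using excess[OF c(1)] by (simp add: BN N_def)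
      qed
      finally have False
        using no_tame_unramified_free_fibre[OF finX[OF c(1)] finY[OF c(1)] a2 b_pos[OF c(1)]
            sum_a[OF c(1)] sum_b[OF c(1)] cop l_less] 3 BN by (simp add: N_def)
      thus ?thesis ..
    qed
  qed
qed

text \<open>Summing \<open>D_ge1\<close> over the fibre of g gives \<beta> \<le> b, and B c = l - 1
  says that the differences b - \<beta> add up to 1: there is one y1 with \<beta> = b - 1, and
  \<beta> = b at all other y. Each of the latter spends b y of the budget, so only b y1 - 1 remains
  for V, which measures how far the a x are from dividing b y, and T, which measures how far b y1 is
  from dividing the a x. Coprimality forces T to consume all of it, and V = 0 yields the
  divisibilities.\<close>

lemma wild_structure:
  assumes c: "c \<in> C" and Bc: "B c = int l - 1" and ex_wild: "\<exists>y\<in>Ys c. b y \<le> \<beta> y"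
    and wild: "\<And>y. y \<in> Ys c \<Longrightarrow> b y \<le> \<beta> y \<Longrightarrow> p dvd b y"
    and Dp: "\<And>x y. x \<in> Xs c \<Longrightarrow> y \<in> Ys c \<Longrightarrow> p dvd b y \<Longrightarrow> \<not> p dvd a x \<Longrightarrow> b y \<le> D x y"
    and ex_tame: "\<exists>x\<in>Xs c. \<not> p dvd a x"
  obtains x1 y1 L where "x1 \<in> Xs c" "y1 \<in> Ys c" "Xs c - {x1} \<noteq> {}" "Ys c - {y1} \<noteq> {}"
    "\<forall>x\<in>Xs c - {x1}. a x = L" "\<forall>y\<in>Ys c - {y1}. b y = L" "a x1 dvd L" "b y1 dvd L"
    "\<not> p dvd a x1" "p dvd L" "\<forall>x\<in>Xs c - {x1}. \<forall>y\<in>Ys c. D x y = 0"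
    "\<forall>y\<in>Ys c - {y1}. \<beta> y = L"
proof -
  define G where "G y = (\<Sum>x\<in>Xs c. int (gcd (a x) (b y)))" for y
  define SD where "SD y = (\<Sum>x\<in>Xs c. int (D x y))" for y
  note fX = finX[OF c] and fY = finY[OF c]
  have g_le_a: "int (gcd (a x) (b y)) \<le> int (a x)" if "x \<in> Xs c" for x y
  proof -
    have "gcd (a x) (b y) \<le> a x" using a_pos[OF c that] by (intro gcd_le1_nat) auto
    thus ?thesis by simp
  qed
  have g_le_b: "int (gcd (a x) (b y)) \<le> int (b y)" if "y \<in> Ys c" for x y
  proof -
    have "gcd (a x) (b y) \<le> b y" using b_pos[OF c that] by (intro gcd_le2_nat) auto
    thus ?thesis by simp
  qed
  have b_le_l: "b y \<le> l" if "y \<in> Ys c" for y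
    using member_le_sum[of y "Ys c" b] that fY sum_b[OF c] by simp
  have A_le: "A c \<le> int m - 1"
    using A_except[OF c] sum_nonneg[of "C - {c}" A] A_nonneg by force
  have K: "(int (\<beta> y) + 1) * int m \<le> SD y + int (b y) * (int m - 1) + G y" if y: "y \<in> Ys c" for y
  proof -
    have "(\<Sum>x\<in>Xs c. int ((\<beta> y + 1) * a x)) \<le>
          (\<Sum>x\<in>Xs c. int (D x y + \<alpha> x * b y + gcd (a x) (b y)))"
      using D_ge1[OF c _ y] by (intro sum_mono) (simp only: of_nat_le_iff)
    also have "\<dots> = SD y + A c * int (b y) + G y"
      by (simp add: sum.distrib A_def SD_def G_def sum_distrib_right)
    also have "A c * int (b y) \<le> (int m - 1) * int (b y)" using A_le by (intro mult_right_mono) auto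
    also have "(\<Sum>x\<in>Xs c. int ((\<beta> y + 1) * a x)) = (int (\<beta> y) + 1) * int m"
      using sum_a_int[OF c] by (simp add: sum.distrib algebra_simps flip: sum_distrib_left)
    finally show ?thesis by (simp add: mult.commute)
  qed
  have G_le: "G y \<le> int m" for y
    unfolding G_def sum_a_int[OF c, symmetric] using g_le_a by (intro sum_mono) auto
  have SD_nonneg: "0 \<le> SD y" for y unfolding SD_def by (intro sum_nonneg) auto
  have sum_SD: "(\<Sum>y\<in>Ys c. SD y) \<le> int l - 1"
  proof -
    have "(\<Sum>y\<in>Ys c. SD y) = (\<Sum>x\<in>Xs c. E c x)" unfolding SD_def E_def by (rule sum.swap)
    moreover have "0 \<le> (\<Sum>c'\<in>C - {c}. U c' * B c' + R c')"
      using U_nonneg B_nonneg R_nonneg by (intro sum_nonneg add_nonneg_nonneg mult_nonneg_nonneg) auto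
    ultimately show ?thesis using sum_E_except[OF c] by linarith
  qed
  have \<beta>_le: "\<beta> y \<le> b y" if y: "y \<in> Ys c" for y
  proof (rule ccontr)
    assume "\<not> ?thesis"
    hence "(int (b y) + 2) * int m \<le> (int (\<beta> y) + 1) * int m" by (intro mult_right_mono) auto
    hence "int m + int (b y) \<le> SD y" using K[OF y] G_le[of y] by (simp add: algebra_simps)
    moreover have "SD y \<le> (\<Sum>y\<in>Ys c. SD y)" using y fY SD_nonneg by (intro member_le_sum) auto
    ultimately show False using sum_SD int_l_less by linarith
  qed
  have "(\<Sum>y\<in>Ys c. int (b y) - int (\<beta> y)) = 1"
    using Bc sum_b_int[OF c] by (simp add: sum_subtractf B_def)
  moreover have "(\<Sum>y\<in>Ys c. int (b y) - int (\<beta> y)) = (\<Sum>y\<in>Ys c. if \<beta> y = b y then 0 else 1)"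
  proof (rule sum.cong)
    fix y assume "y \<in> Ys c"
    thus "int (b y) - int (\<beta> y) = (if \<beta> y = b y then 0 else 1)"
      using \<beta>_le[of y] \<beta>_ge[of y] by auto
  qed simp
  moreover have "\<dots> = int (card {y \<in> Ys c. \<beta> y \<noteq> b y})"
    using fY by (simp add: sum.If_cases Int_def conj_commute)
  ultimately have "card {y \<in> Ys c. \<beta> y \<noteq> b y} = 1" by simp
  then obtain y1 where y1': "{y \<in> Ys c. \<beta> y \<noteq> b y} = {y1}" by (auto simp: card_1_singleton_iff)
  hence y1: "y1 \<in> Ys c" by blast
  define W where "W = Ys c - {y1}"
  have bW: "\<beta> y = b y" if "y \<in> W" for y using that y1' by (auto simp: W_def)
  have WY: "y \<in> Ys c" if "y \<in> W" for y using that by (simp add: W_def)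
  have finW: "finite W" using fY by (simp add: W_def)
  have pW: "p dvd b y" if "y \<in> W" for y using wild[OF WY[OF that]] bW[OF that] by simp
  have Wne: "W \<noteq> {}"
  proof -
    obtain y where "y \<in> Ys c" "b y \<le> \<beta> y" using ex_wild by blast
    moreover have "b y1 \<noteq> \<beta> y1" "\<beta> y1 \<le> b y1" using y1' \<beta>_le[OF y1] by auto
    ultimately show ?thesis by (auto simp: W_def)
  qed
  have sum_bW: "int l = (\<Sum>y\<in>W. int (b y)) + int (b y1)"
    using sum_b_int[OF c] y1 fY by (simp add: W_def sum.remove)
  define V where "V y = (\<Sum>x\<in>Xs c. int (a x) - int (gcd (a x) (b y)))" for y
  define T where "T = (\<Sum>x\<in>Xs c. int (b y1) - int (gcd (a x) (b y1)))"
  have SD_W: "int (b y) + V y \<le> SD y" if "y \<in> W" for y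
  proof -
    have "V y = int m - G y" using sum_a_int[OF c] by (simp add: V_def G_def sum_subtractf)
    thus ?thesis using K[OF WY[OF that]] bW[OF that] by (simp add: algebra_simps)
  qed
  have SD_1: "T \<le> SD y1"
    unfolding T_def SD_def using D_ge2[OF c _ y1] by (intro sum_mono) force
  have sum_split: "(\<Sum>y\<in>Ys c. SD y) = (\<Sum>y\<in>W. SD y) + SD y1"
    using y1 fY by (simp add: W_def sum.remove)
  have "(\<Sum>y\<in>W. int (b y) + V y) \<le> (\<Sum>y\<in>W. SD y)" using SD_W by (intro sum_mono) auto
  hence TV: "(\<Sum>y\<in>W. V y) + T \<le> int (b y1) - 1"
    using sum_SD sum_bW SD_1 sum_split by (simp add: sum.distrib)
  have V_nonneg: "0 \<le> V y" for y unfolding V_def using g_le_a by (intro sum_nonneg) auto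
  have V_le: "V y + T \<le> int (b y1) - 1" if "y \<in> W" for y
    using member_le_sum[of y W V] that finW V_nonneg TV by simp
  have T_nonneg: "0 \<le> T" unfolding T_def using g_le_b[OF y1] by (intro sum_nonneg) auto
  have T_ge: "int (b y1) - int (gcd (a x) (b y1)) \<le> T" if "x \<in> Xs c" for x
    unfolding T_def using that fX g_le_b[OF y1]
    by (intro member_le_sum[where f = "\<lambda>x. int (b y1) - int (gcd (a x) (b y1))"]) auto
  have V_ge: "int (a x) - int (gcd (a x) (b y)) \<le> V y" if "x \<in> Xs c" for x y
    unfolding V_def using that fX g_le_a
    by (intro member_le_sum[where f = "\<lambda>x. int (a x) - int (gcd (a x) (b y))"]) auto
  have b1l: "int (b y1) \<le> int l" using b_le_l[OF y1] by simp
  have unit: False if "d dvd l" "d dvd m" "2 \<le> d" for d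
    using coprime_common_divisor[OF cop that(1,2)] that(3) by simp
  \<comment> \<open>For b y1 > 1: some a x is not divisible by b y1, since otherwise V would be
    small enough for b y1 to divide both m and l. Two exceptions would push T up to b y1. For the
    only exception x0 the gcd of b y1 and a x0 divides all indices on both sides, so it is 1, and x0
    alone contributes b y1 - 1 to T.\<close>
  have tight: "T = int (b y1) - 1 \<and> (\<forall>y\<in>W. b y1 dvd b y)"
  proof (cases "b y1 = 1")
    case True
    obtain y where "y \<in> W" using Wne by blast
    thus ?thesis using V_le[of y] V_nonneg[of y] T_nonneg True by auto
  next
    case False
    hence b12: "2 \<le> b y1" using b_pos[OF c y1] by simp
    have dvd_l: "b y1 dvd l" if "\<forall>y\<in>W. b y1 dvd b y"
      unfolding sum_b[OF c, symmetric] using that by (intro dvd_sum) (auto simp: W_def)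
    have "\<exists>x0. x0 \<in> Xs c \<and> \<not> b y1 dvd a x0"
    proof (rule ccontr)
      assume no_x0: "\<nexists>x0. x0 \<in> Xs c \<and> \<not> b y1 dvd a x0"
      hence all: "b y1 dvd a x" if "x \<in> Xs c" for x using no_x0 that by blast
      hence dm: "b y1 dvd m" unfolding sum_a[OF c, symmetric] by (intro dvd_sum) auto
      have "b y1 dvd b y" if y: "y \<in> W" for y
      proof (rule ccontr)
        assume nd: "\<not> b y1 dvd b y"
        have "(\<Sum>x\<in>Xs c. int (a x)) \<le> (\<Sum>x\<in>Xs c. 2 * (int (a x) - int (gcd (a x) (b y))))"
        proof (rule sum_mono)
          fix x assume x: "x \<in> Xs c"
          have "\<not> a x dvd b y" using nd all[OF x] dvd_trans by blast
          thus "int (a x) \<le> 2 * (int (a x) - int (gcd (a x) (b y)))"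
            using half_gcd[of "a x" "b y"] a_pos[OF c x] by simp
        qed
        hence "int m \<le> 2 * V y" unfolding V_def sum_a_int[OF c] sum_distrib_left .
        hence "int m < 2 * int (b y1)" using V_le[OF y] T_nonneg by linarith
        moreover obtain k where k: "m = b y1 * k" using dm by blast
        ultimately have "int (b y1 * k) < int (b y1 * 2)" by simp
        hence "b y1 * k < b y1 * 2" by (simp only: of_nat_less_iff)
        hence "k < 2" by simp
        hence "m \<le> b y1" using k by (cases "k = 0"; cases "k = 1") auto
        thus False using b1l l_less by simp
      qed
      thus False using unit[OF dvd_l dm b12] by blast
    qed
    then obtain x0 where x0: "x0 \<in> Xs c" "\<not> b y1 dvd a x0" by blast
    define g0 where "g0 = gcd (b y1) (a x0)"
    have g0: "2 * int g0 \<le> int (b y1)" using half_gcd[OF _ x0(2)] b12 by (simp add: g0_def)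
    have T0: "int (b y1) - int g0 \<le> T" using T_ge[OF x0(1)] by (simp add: g0_def gcd.commute)
    have others: "b y1 dvd a x" if x: "x \<in> Xs c" "x \<noteq> x0" for x
    proof (rule ccontr)
      assume nd: "\<not> ?thesis"
      have "(\<Sum>x\<in>{x0, x}. int (b y1) - int (gcd (a x) (b y1))) \<le> T"
        unfolding T_def using x x0 fX g_le_b[OF y1] by (intro sum_mono2) auto
      hence "2 * int (b y1) - int g0 - int (gcd (a x) (b y1)) \<le> T"
        using x by (simp add: g0_def gcd.commute)
      moreover have "2 * int (gcd (b y1) (a x)) \<le> int (b y1)" using half_gcd[OF _ nd] b12 by simp
      moreover obtain y where "y \<in> W" using Wne by blast
      ultimately show False using g0 V_le[of y] V_nonneg[of y] by (simp add: gcd.commute)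
    qed
    have Vb: "V y \<le> int g0 - 1" if "y \<in> W" for y using V_le[OF that] T0 by linarith
    have ex_other: "\<exists>x\<in>Xs c. x \<noteq> x0"
    proof (rule ccontr)
      assume "\<not> ?thesis"
      hence X: "Xs c = {x0}" using x0 by blast
      hence am: "a x0 = m" using sum_a[OF c] by simp
      obtain y where y: "y \<in> W" using Wne by blast
      have "\<not> m dvd b y"
        using b_le_l[OF WY[OF y]] b_pos[OF c WY[OF y]] l_less by (auto dest: dvd_imp_le)
      hence "2 * int (gcd m (b y)) \<le> int m" using half_gcd[of m "b y"] l_less by simp
      moreover have "int m - int (gcd m (b y)) \<le> V y" using V_ge[OF x0(1), of y] am by simp
      ultimately show False using Vb[OF y] g0 b1l int_l_less by linarith
    qed
    have adb: "a x dvd b y" if "x \<in> Xs c" "x \<noteq> x0" "y \<in> W" for x y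
    proof (rule ccontr)
      assume "\<not> ?thesis"
      hence "2 * int (gcd (a x) (b y)) \<le> int (a x)" using half_gcd[of "a x"] a_pos[OF c that(1)] by simp
      moreover have "b y1 \<le> a x" using others[OF that(1,2)] a_pos[OF c that(1)] by (intro dvd_imp_le) auto
      ultimately show False using V_ge[OF that(1), of y] Vb[OF that(3)] g0 by linarith
    qed
    have b1dvd: "\<forall>y\<in>W. b y1 dvd b y" using ex_other adb others dvd_trans by blast
    have "g0 dvd l" using dvd_l[OF b1dvd] unfolding g0_def by (meson dvd_trans gcd_dvd1)
    moreover have "g0 dvd m"
      unfolding sum_a[OF c, symmetric]
    proof (rule dvd_sum)
      fix x assume "x \<in> Xs c"
      thus "g0 dvd a x" using others[of x] unfolding g0_def
        by (cases "x = x0") (auto intro: dvd_trans[OF gcd_dvd1])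
    qed
    moreover have "g0 \<noteq> 0" using b12 by (simp add: g0_def)
    ultimately have "g0 = 1" using unit[of g0] by force
    moreover obtain y where "y \<in> W" using Wne by blast
    ultimately show ?thesis using T0 V_le[of y] V_nonneg[of y] b1dvd by auto
  qed
  have V0: "V y = 0" if "y \<in> W" for y using V_le[OF that] V_nonneg[of y] tight by simp
  have adb: "a x dvd b y" if "x \<in> Xs c" "y \<in> W" for x y
  proof -
    have "int (gcd (a x) (b y)) = int (a x)"
      using V_ge[OF that(1), of y] V0[OF that(2)] g_le_a[OF that(1), of y] by linarith
    thus ?thesis by (metis gcd_dvd2 of_nat_eq_iff)
  qed
  have SDb: "SD y = int (b y)" if y: "y \<in> W" for y
  proof (rule antisym)
    have "(\<Sum>y\<in>W. SD y - int (b y)) \<le> 0"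
      using sum_SD sum_bW SD_1 sum_split tight by (simp add: sum_subtractf)
    moreover have "SD y - int (b y) \<le> (\<Sum>y\<in>W. SD y - int (b y))"
      using y finW SD_W V_nonneg
      by (intro member_le_sum[where f = "\<lambda>y. SD y - int (b y)"]) (auto, smt (verit))
    ultimately show "SD y \<le> int (b y)" by linarith
    show "int (b y) \<le> SD y" using SD_W[OF y] V_nonneg[of y] by linarith
  qed
  have SD1: "SD y1 \<le> T"
    using sum_SD sum_bW SDb sum_split tight by (simp add: sum_subtractf)
  obtain x1 where x1: "x1 \<in> Xs c" "\<not> p dvd a x1" using ex_tame by blast
  \<comment> \<open>At x1, whose index is prime to p, \<open>Dp\<close> already uses up all of SD y
    = b y, so nothing remains above the other points.\<close>
  have D0: "D x y = 0" if "x \<in> Xs c - {x1}" "y \<in> W" for x y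
  proof -
    have "(\<Sum>x\<in>{x1, x}. int (D x y)) \<le> SD y"
      unfolding SD_def using that x1 fX by (intro sum_mono2) auto
    moreover have "x1 \<noteq> x" using that by auto
    ultimately have "int (D x1 y) + int (D x y) \<le> SD y" by simp
    thus ?thesis using Dp[OF x1(1) WY[OF that(2)] pW[OF that(2)] x1(2)] SDb[OF that(2)] by simp
  qed
  have eq: "a x = b y" if "x \<in> Xs c - {x1}" "y \<in> W" for x y
  proof -
    have "b y \<le> gcd (a x) (b y)" using D_ge2[OF c _ WY[OF that(2)], of x] D0[OF that] that by simp
    hence "b y = gcd (a x) (b y)"
      using g_le_b[OF WY[OF that(2)], of x] by simp
    hence "b y dvd a x" by (metis gcd_dvd1)
    thus ?thesis using adb[OF _ that(2), of x] that by (simp add: dvd_antisym)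
  qed
  obtain y0 where y0: "y0 \<in> W" using Wne by blast
  have ne: "Xs c - {x1} \<noteq> {}"
  proof
    assume "Xs c - {x1} = {}"
    hence "Xs c = {x1}" using x1 by blast
    hence "m dvd b y0" using adb[OF x1(1) y0] sum_a[OF c] by simp
    thus False using b_le_l[OF WY[OF y0]] b_pos[OF c WY[OF y0]] l_less by (auto dest: dvd_imp_le)
  qed
  then obtain x2 where x2: "x2 \<in> Xs c - {x1}" by blast
  show thesis
  proof (rule that[of x1 y1 "b y0"])
    show "\<forall>x\<in>Xs c - {x1}. a x = b y0" using eq y0 by blast
    show "\<forall>y\<in>Ys c - {y1}. b y = b y0" using eq x2 y0 by (metis W_def)
    thus "\<forall>y\<in>Ys c - {y1}. \<beta> y = b y0" using bW by (auto simp: W_def)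
    show "a x1 dvd b y0" using adb x1 y0 by blast
    show "b y1 dvd b y0" using tight y0 by blast
    show "p dvd b y0" using pW y0 by blast
    show "\<forall>x\<in>Xs c - {x1}. \<forall>y\<in>Ys c. D x y = 0"
    proof (intro ballI)
      fix x y assume x: "x \<in> Xs c - {x1}" and y: "y \<in> Ys c"
      show "D x y = 0"
      proof (cases "y = y1")
        case False
        thus ?thesis using D0[OF x] y by (simp add: W_def)
      next
        \<comment> \<open>Here the lower bounds b - gcd for D x y1 are attained at every x, because
          their sum T is also an upper bound for SD y1; and b y1 divides a x, so the bound is
          0.\<close>
        case True
        have "b y1 dvd a x" using eq[OF x y0] tight y0 by simp
        hence "gcd (a x) (b y1) = b y1" by (simp add: gcd_nat.absorb2)
        moreover have "int (D x y1) - (int (b y1) - int (gcd (a x) (b y1))) \<le>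
            (\<Sum>x\<in>Xs c. int (D x y1) - (int (b y1) - int (gcd (a x) (b y1))))"
          using x fX D_ge2[OF c _ y1]
          by (intro member_le_sum[where f = "\<lambda>x. int (D x y1) - (int (b y1) - int (gcd (a x) (b y1)))"])
             (auto, force)
        moreover have "\<dots> = SD y1 - T" by (simp add: SD_def T_def sum_subtractf)
        ultimately show ?thesis using True SD1 by simp
      qed
    qed
  qed (use x1 y1 ne Wne in \<open>auto simp: W_def\<close>)
qed

end

section \<open>Critical values of a double decomposition\<close>

lemma finite_fibre: "0 < degree f \<Longrightarrow> finite {x. poly f x = (c::'a::field)}"
  using poly_roots_finite[OF diff_const_nz[of f c]] by simp

lemma finite_preimage: "0 < degree f \<Longrightarrow> finite C \<Longrightarrow> finite {x. poly f x \<in> (C::'a::field set)}"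
proof -
  assume "0 < degree f" "finite C"
  hence "finite (\<Union>c\<in>C. {x. poly f x = c})" using finite_fibre by blast
  moreover have "{x. poly f x \<in> C} = (\<Union>c\<in>C. {x. poly f x = c})" by auto
  ultimately show ?thesis by simp
qed

lemma sum_fibres:
  fixes f :: "'a::field poly"
  assumes "0 < degree f" "finite C"
  shows "(\<Sum>c\<in>C. \<Sum>x | poly f x = c. \<phi> x) = (\<Sum>x | poly f x \<in> C. \<phi> x)"
proof -
  have "(\<Sum>c\<in>C. \<Sum>x | poly f x = c. \<phi> x) = (\<Sum>c\<in>C. \<Sum>x\<in>{x \<in> {x. poly f x \<in> C}. poly f x = c}. \<phi> x)"
    by (intro sum.cong) auto
  also have "\<dots> = (\<Sum>x | poly f x \<in> C. \<phi> x)"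
    using assms finite_preimage by (intro sum.group) auto
  finally show ?thesis .
qed

lemma degree_lead_pderiv:
  fixes f :: "'a::field poly"
  assumes "lead_coeff f = 1" "of_nat (degree f) \<noteq> (0::'a)"
  shows "degree (pderiv f) = degree f - 1" "lead_coeff (pderiv f) = of_nat (degree f)"
proof -
  have "degree f \<noteq> 0" using assms(2) by (metis of_nat_0)
  hence c: "coeff (pderiv f) (degree f - 1) = of_nat (degree f)"
    using assms(1) by (simp add: coeff_pderiv)
  have "degree f - 1 \<le> degree (pderiv f)" using c assms(2) by (intro le_degree) simp
  moreover have "degree (pderiv f) \<le> degree f - 1"
    by (rule degree_le) (auto simp: coeff_pderiv coeff_eq_0)
  ultimately show "degree (pderiv f) = degree f - 1" by simp
  thus "lead_coeff (pderiv f) = of_nat (degree f)" using c by simp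
qed

lemma degree_pderiv_le: "degree (pderiv f) \<le> degree f - 1" for f :: "'a::field poly"
  by (rule degree_le) (auto simp: coeff_pderiv coeff_eq_0)

text \<open>With k = b / gcd a b the relation a e = b e' makes each e t a positive multiple of k,
  and they add up to b = k gcd a b. Applied to the points above a pair (x, y), it bounds their
  number by the gcd of the two indices, as in the tame formula of Abhyankar but without a tameness
  assumption.\<close>

lemma sum_ge_multiples:
  fixes e :: "'b \<Rightarrow> nat"
  assumes "finite T" "\<And>t. t \<in> T \<Longrightarrow> 0 < e t" "\<And>t. t \<in> T \<Longrightarrow> a * e t = b * e' t"
    and "(\<Sum>t\<in>T. e t) = b" "0 < a" "0 < b"
  shows "card T \<le> gcd a b"
proof -
  define k where "k = b div gcd a b"
  have k: "b = gcd a b * k" by (simp add: k_def)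
  have "k \<le> e t" if t: "t \<in> T" for t
  proof -
    obtain a' where a': "a = gcd a b * a'" by (meson dvdE gcd_dvd1)
    have g0: "gcd a b \<noteq> 0" using assms(5) by (metis gcd_eq_0_iff less_irrefl)
    have "gcd a b * (a' * e t) = gcd a b * (k * e' t)"
      using assms(3)[OF t] a' k by (metis mult.assoc)
    hence "a' * e t = k * e' t" using g0 by (simp only: mult_cancel1) simp
    moreover have "coprime a' k"
    proof -
      have "gcd a b = gcd (gcd a b * a') (gcd a b * k)" using a' k by simp
      also have "\<dots> = gcd a b * gcd a' k" by (simp add: gcd_mult_distrib_nat)
      finally have "gcd a b * 1 = gcd a b * gcd a' k" by simp
      hence "gcd a' k = 1" using g0 by (metis mult_cancel1)
      thus ?thesis by (simp only: coprime_iff_gcd_eq_1)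
    qed
    ultimately have "k dvd e t" by (metis coprime_commute coprime_dvd_mult_right_iff dvd_triv_left)
    thus ?thesis using assms(2)[OF t] by (intro dvd_imp_le)
  qed
  hence "card T * k \<le> (\<Sum>t\<in>T. e t)" using sum_bounded_below[of T k e] by simp
  hence "card T * k \<le> gcd a b * k" using assms(4) k by simp
  moreover have "0 < k" using k assms(6) by (metis gr0I mult_0_right)
  ultimately show ?thesis by simp
qed

section \<open>The ramification data of two decompositions of one polynomial\<close>

locale bidecomp =
  fixes g h gs hs :: "'a::alg_closed_field poly" and l m :: nat
  assumes lc: "lead_coeff g = 1" "lead_coeff h = 1" "lead_coeff gs = 1" "lead_coeff hs = 1"
    and deg: "degree g = m" "degree h = l" "degree gs = l" "degree hs = m"
    and l_ge: "2 \<le> l" and l_less: "l < m" and cop: "coprime l m"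
    and g': "pderiv g \<noteq> 0" and gs': "pderiv gs \<noteq> 0"
    and comp_eq: "pcompose g h = pcompose gs hs"
begin

lemma deg_pos: "0 < degree g" "0 < degree h" "0 < degree gs" "0 < degree hs"
  using deg l_ge l_less by auto

lemma chain: "pcompose (pderiv g) h * pderiv h = pcompose (pderiv gs) hs * pderiv hs"
  using arg_cong[OF comp_eq, of pderiv] by (simp add: pderiv_pcompose)

lemma of_nat_coprime: "of_nat l \<noteq> (0::'a) \<or> of_nat m \<noteq> (0::'a)"
  using cop CHAR_not_1'[where 'a = 'a] unfolding of_nat_eq_0_iff_char_dvd
  by (metis One_nat_def coprime_common_divisor_nat nat_dvd_1_iff_1)

text \<open>One of l and m is nonzero in the field, so h or hs has a nonzero derivative; the chain
  rule transfers this to the other one.\<close>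

lemma h': "pderiv h \<noteq> 0" and hs': "pderiv hs \<noteq> 0"
proof -
  have "pcompose (pderiv g) h \<noteq> 0" "pcompose (pderiv gs) hs \<noteq> 0"
    using g' gs' deg_pos by (auto simp: pcompose_eq_0_iff)
  hence iff: "pderiv h = 0 \<longleftrightarrow> pderiv hs = 0" using chain by (metis mult_eq_0_iff)
  have "pderiv h \<noteq> 0 \<or> pderiv hs \<noteq> 0"
    using of_nat_coprime degree_lead_pderiv(2)[of h] degree_lead_pderiv(2)[of hs] lc deg by auto
  thus "pderiv h \<noteq> 0" "pderiv hs \<noteq> 0" using iff by auto
qed

text \<open>If l vanished in the field, m would not, so g and hs would have derivatives of full
  degree m - 1, while that of gs would have degree at most l - 2. The degrees in
  \<open>chain\<close> then give m + 1 \<le> l. So the derivatives of gs and h have exactly l - 1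
  zeros, on which the count rests.\<close>

lemma l_nz: "of_nat l \<noteq> (0::'a)"
proof
  assume l0: "of_nat l = (0::'a)"
  hence m0: "of_nat m \<noteq> (0::'a)" using of_nat_coprime by blast
  have "coeff (pderiv gs) (l - 1) = 0" using l0 l_ge by (simp add: coeff_pderiv flip: of_nat_Suc)
  hence "degree (pderiv gs) \<noteq> l - 1" using gs' by (metis leading_coeff_0_iff)
  hence d1: "degree (pderiv gs) \<le> l - 2" using degree_pderiv_le[of gs] deg by simp
  have "degree (pcompose (pderiv g) h * pderiv h) = degree (pcompose (pderiv gs) hs * pderiv hs)"
    using chain by simp
  hence "degree (pderiv g) * l + degree (pderiv h) = degree (pderiv gs) * m + degree (pderiv hs)"
    using g' gs' h' hs' deg_pos deg by (simp add: degree_mult_eq pcompose_eq_0_iff degree_pcompose)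
  moreover have "degree (pderiv g) = m - 1" "degree (pderiv hs) = m - 1"
    using degree_lead_pderiv(1)[OF lc(1)] degree_lead_pderiv(1)[OF lc(4)] deg m0 by auto
  ultimately have "(m - 1) * l + degree (pderiv h) = degree (pderiv gs) * m + (m - 1)" by (simp only:)
  also have "\<dots> \<le> (l - 2) * m + (m - 1)" using d1 by (intro add_mono mult_right_mono) auto
  finally have "(m - 1) * l \<le> (l - 2) * m + (m - 1)" by (rule add_leD1)
  moreover obtain l' where "l = l' + 2" using l_ge by (metis le_add_diff_inverse2)
  moreover obtain m' where "m = m' + 1" using l_less by (metis less_imp_add_positive add.commute Suc_eq_plus1 Suc_pred add_is_0 gr0I)
  ultimately show False using l_less by (simp add: algebra_simps)
qed

lemma degree_gs': "degree (pderiv gs) = l - 1" and degree_h': "degree (pderiv h) = l - 1"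
  and lead_h': "lead_coeff (pderiv h) = of_nat l"
  using degree_lead_pderiv[OF lc(3)] degree_lead_pderiv[OF lc(2)] deg l_nz by auto

abbreviation "f \<equiv> pcompose g h"

lemma ff_eq: "poly g (poly h t) = poly gs (poly hs t)"
  using comp_eq by (metis poly_pcompose)

text \<open>Images of the zeros of all three derivatives, so that summing orders over the fibres
  above \<open>C\<close> gives the full degree of each derivative.\<close>

definition C :: "'a set" where
  "C = poly g ` {x. poly (pderiv g) x = 0} \<union> poly gs ` {y. poly (pderiv gs) y = 0} \<union>
       poly f ` {t. poly (pderiv h) t = 0}"

definition Xs :: "'a \<Rightarrow> 'a set" where "Xs c = {x. poly g x = c}"
definition Ys :: "'a \<Rightarrow> 'a set" where "Ys c = {y. poly gs y = c}"
definition Ts :: "'a \<Rightarrow> 'a \<Rightarrow> 'a set" where "Ts x y = {t. poly h t = x \<and> poly hs t = y}"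
definition D :: "'a \<Rightarrow> 'a \<Rightarrow> nat" where "D x y = (\<Sum>t\<in>Ts x y. Polynomial.order t (pderiv h))"

lemma finC: "finite C"
  unfolding C_def using g' gs' h' by (intro finite_UnI finite_imageI poly_roots_finite)

lemma finTs: "finite (Ts x y)"
  unfolding Ts_def using finite_fibre[OF deg_pos(2), of x] by (rule finite_subset[rotated]) auto

lemma sum_ram:
  assumes "0 < degree p" "lead_coeff p = 1"
  shows "(\<Sum>x | poly p x = c. ram p x) = degree (p :: 'a poly)"
proof -
  have "(\<Sum>x | poly p x = c. ram p x) = (\<Sum>x | poly p x = c. Polynomial.order x (p - [:c:]))"
    by (intro sum.cong) (auto simp: ram_def)
  also have "\<dots> = degree (p - [:c:])"
    using assms diff_const_nz finite_fibre by (intro sum_order_eq_degree) auto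
  finally show ?thesis using assms by (simp add: degree_diff_const)
qed

lemma sum_e: "poly g x = poly gs y \<Longrightarrow> (\<Sum>t\<in>Ts x y. ram h t) = ram gs y"
  unfolding Ts_def
  using sum_ram_fibre[of h hs gs l m g x y] lc deg cop l_ge l_less comp_eq h' by auto

lemma sum_es: "poly g x = poly gs y \<Longrightarrow> (\<Sum>t\<in>Ts x y. ram hs t) = ram g x"
  unfolding Ts_def
  using sum_ram_fibre[of hs h g m l gs y x] lc deg cop l_ge l_less comp_eq hs'
  by (simp add: coprime_commute conj_commute)

lemma ram_rel: "ram g (poly h t) * ram h t = ram gs (poly hs t) * ram hs t"
  using ram_pcompose[OF deg_pos(1,2), of t] ram_pcompose[OF deg_pos(3,4), of t] comp_eq by simp

lemma order_rel: "Polynomial.order (poly h t) (pderiv g) * ram h t + Polynomial.order t (pderiv h) =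
    Polynomial.order (poly hs t) (pderiv gs) * ram hs t + Polynomial.order t (pderiv hs)"
  using order_pderiv_pcompose[OF deg_pos(2) g' h', of t] order_pderiv_pcompose[OF deg_pos(4) gs' hs', of t]
    comp_eq by simp

lemma order_pderiv_ge: "pderiv p \<noteq> 0 \<Longrightarrow> ram p t \<le> Polynomial.order t (pderiv p) + 1" for p :: "'a poly"
  using order_pderiv_eq by blast

text \<open>Each t above x and y has e - 1 \<le> order of the derivative of h. The e add up to the
  index of gs at y, and there are at most gcd many points by
  \<open>sum_ge_multiples\<close>.\<close>

lemma D_ge2: assumes "poly g x = poly gs y" shows "ram gs y \<le> D x y + gcd (ram g x) (ram gs y)"
proof -
  have "ram gs y = (\<Sum>t\<in>Ts x y. ram h t)" using sum_e[OF assms] by simp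
  also have "\<dots> \<le> (\<Sum>t\<in>Ts x y. Polynomial.order t (pderiv h) + 1)"
    using order_pderiv_ge[OF h'] by (intro sum_mono) auto
  also have "\<dots> = D x y + card (Ts x y)" by (simp only: sum.distrib D_def card_eq_sum)
  also have "card (Ts x y) \<le> gcd (ram g x) (ram gs y)"
    using finTs ram_rel sum_e[OF assms] ram_pos deg_pos
    by (intro sum_ge_multiples[where e = "ram h" and e' = "ram hs"]) (auto simp: Ts_def)
  finally show ?thesis by simp
qed

text \<open>The same estimate for hs, followed by an exchange: adding up \<open>order_rel\<close>
  over the points above x and y gives \<alpha> b + D = \<beta> a + D', which trades the derivative
  of hs for that of h.\<close>

lemma D_ge1:
  assumes "poly g x = poly gs y"
  shows "(Polynomial.order y (pderiv gs) + 1) * ram g x \<le>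
         D x y + Polynomial.order x (pderiv g) * ram gs y + gcd (ram g x) (ram gs y)"
proof -
  define D' where "D' = (\<Sum>t\<in>Ts x y. Polynomial.order t (pderiv hs))"
  have "ram g x = (\<Sum>t\<in>Ts x y. ram hs t)" using sum_es[OF assms] by simp
  also have "\<dots> \<le> (\<Sum>t\<in>Ts x y. Polynomial.order t (pderiv hs) + 1)"
    using order_pderiv_ge[OF hs'] by (intro sum_mono) auto
  also have "\<dots> = D' + card (Ts x y)" by (simp only: sum.distrib D'_def card_eq_sum)
  also have "card (Ts x y) \<le> gcd (ram g x) (ram gs y)"
    using finTs ram_rel sum_e[OF assms] ram_pos deg_pos
    by (intro sum_ge_multiples[where e = "ram h" and e' = "ram hs"]) (auto simp: Ts_def)
  finally have 1: "ram g x \<le> D' + gcd (ram g x) (ram gs y)" by simp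
  have "(\<Sum>t\<in>Ts x y. Polynomial.order x (pderiv g) * ram h t + Polynomial.order t (pderiv h)) =
        (\<Sum>t\<in>Ts x y. Polynomial.order y (pderiv gs) * ram hs t + Polynomial.order t (pderiv hs))"
    using order_rel by (intro sum.cong) (auto simp: Ts_def)
  hence "Polynomial.order x (pderiv g) * ram gs y + D x y = Polynomial.order y (pderiv gs) * ram g x + D'"
    by (simp add: sum.distrib D_def D'_def sum_e[OF assms] sum_es[OF assms] flip: sum_distrib_left)
  thus ?thesis using 1 by (simp add: algebra_simps)
qed

text \<open>In a e = b e' the characteristic divides b but not a, so it divides e. Hence h is wild
  at every such point, and its derivative has order at least e rather than e - 1.\<close>

lemma D_wild:
  assumes "poly g x = poly gs y" "of_nat (ram gs y) = (0::'a)" "of_nat (ram g x) \<noteq> (0::'a)"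
  shows "ram gs y \<le> D x y"
proof -
  have "ram gs y = (\<Sum>t\<in>Ts x y. ram h t)" using sum_e[OF assms(1)] by simp
  also have "\<dots> \<le> (\<Sum>t\<in>Ts x y. Polynomial.order t (pderiv h))"
  proof (rule sum_mono)
    fix t assume t: "t \<in> Ts x y"
    have "of_nat (ram g x * ram h t) = (of_nat (ram gs y * ram hs t) :: 'a)"
      using ram_rel[of t] t by (simp add: Ts_def)
    hence "of_nat (ram h t) = (0::'a)" using assms by simp
    thus "ram h t \<le> Polynomial.order t (pderiv h)" using order_pderiv_eq[OF h'] by blast
  qed
  finally show ?thesis by (simp add: D_def)
qed

lemma sum_D_fibre: "(\<Sum>x\<in>Xs c. \<Sum>y\<in>Ys c. D x y) = (\<Sum>t | poly f t = c. Polynomial.order t (pderiv h))"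
proof -
  have fin: "finite {t. poly f t = c}"
    using finite_fibre[of f c] deg_pos by (simp add: degree_pcompose)
  have "(\<Sum>x\<in>Xs c. \<Sum>y\<in>Ys c. D x y) = (\<Sum>z\<in>Xs c \<times> Ys c. D (fst z) (snd z))"
    by (simp add: sum.cartesian_product case_prod_beta)
  also have "\<dots> = (\<Sum>z\<in>Xs c \<times> Ys c. \<Sum>t\<in>{t \<in> {t. poly f t = c}. (poly h t, poly hs t) = z}. Polynomial.order t (pderiv h))"
    unfolding D_def
    by (intro sum.cong refl) (auto simp: Ts_def Xs_def Ys_def poly_pcompose)
  also have "\<dots> = (\<Sum>t | poly f t = c. Polynomial.order t (pderiv h))"
    using fin finite_fibre deg_pos
    by (intro sum.group) (auto simp: Xs_def Ys_def poly_pcompose ff_eq)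
  finally show ?thesis .
qed

lemma degree_g'_le: "degree (pderiv g) \<le> m - 1" using degree_pderiv_le[of g] deg by simp

lemma sum_\<alpha>: "(\<Sum>c\<in>C. \<Sum>x\<in>Xs c. Polynomial.order x (pderiv g)) = degree (pderiv g)"
  unfolding Xs_def using finC finite_preimage deg_pos g'
  by (subst sum_fibres) (auto intro!: sum_order_eq_degree simp: C_def)

lemma sum_\<beta>: "(\<Sum>c\<in>C. \<Sum>y\<in>Ys c. Polynomial.order y (pderiv gs)) = l - 1"
  unfolding Ys_def degree_gs'[symmetric] using finC finite_preimage deg_pos gs'
  by (subst sum_fibres) (auto intro!: sum_order_eq_degree simp: C_def)

lemma sum_D: "(\<Sum>c\<in>C. \<Sum>x\<in>Xs c. \<Sum>y\<in>Ys c. D x y) = l - 1"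
  unfolding sum_D_fibre degree_h'[symmetric] using finC finite_preimage[of f C] deg_pos h'
  by (subst sum_fibres) (auto intro!: sum_order_eq_degree simp: C_def degree_pcompose)

sublocale rc: ramification_count C Xs Ys "ram g" "\<lambda>x. Polynomial.order x (pderiv g)" "ram gs"
  "\<lambda>y. Polynomial.order y (pderiv gs)" D l m
proof unfold_locales
  show "(\<Sum>x\<in>Xs c. ram g x) = m" for c unfolding Xs_def using sum_ram[of g c] deg_pos lc deg by simp
  show "(\<Sum>y\<in>Ys c. ram gs y) = l" for c unfolding Ys_def using sum_ram[of gs c] deg_pos lc deg by simp
  show "ram g x = 1 \<Longrightarrow> Polynomial.order x (pderiv g) = 0" for x
    using order_pderiv_eq[OF g', of x] by simp
  show "ram gs x = 1 \<Longrightarrow> Polynomial.order x (pderiv gs) = 0" for x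
    using order_pderiv_eq[OF gs', of x] by simp
  show "1 \<le> ram g x" "1 \<le> ram gs x" for x using ram_pos[OF deg_pos(1), of x] ram_pos[OF deg_pos(3), of x] by auto
  show "(\<Sum>c\<in>C. \<Sum>x\<in>Xs c. Polynomial.order x (pderiv g)) \<le> m - 1" using sum_\<alpha> degree_g'_le by simp
qed (use finC finite_fibre deg_pos l_ge l_less cop order_pderiv_ge g' gs' sum_\<beta> sum_D D_ge1 D_ge2
      in \<open>auto simp: Xs_def Ys_def\<close>)

lemma wild_imp: "ram gs y \<le> Polynomial.order y (pderiv gs) \<Longrightarrow> of_nat (ram gs y) = (0::'a)"
  using order_pderiv_eq[OF gs', of y] ram_pos[OF deg_pos(3), of y] by (cases "of_nat (ram gs y) = (0::'a)") auto

text \<open>If every point over c were wild, the derivative of g would have at least m zeros over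
  c.\<close>

lemma ex_tame: assumes "c \<in> C" shows "\<exists>x\<in>Xs c. of_nat (ram g x) \<noteq> (0::'a)"
proof (rule ccontr)
  assume "\<not> ?thesis"
  hence "ram g x \<le> Polynomial.order x (pderiv g)" if "x \<in> Xs c" for x
    using order_pderiv_eq[OF g', of x] that by blast
  hence "m \<le> (\<Sum>x\<in>Xs c. Polynomial.order x (pderiv g))"
    using rc.sum_a[OF assms] sum_mono[of "Xs c" "ram g"] by metis
  also have "\<dots> \<le> (\<Sum>c\<in>C. \<Sum>x\<in>Xs c. Polynomial.order x (pderiv g))"
    using assms finC by (intro member_le_sum) auto
  finally show False using sum_\<alpha> degree_g'_le l_less by simp
qed

text \<open>A single point over c means that gs has index l at y. As l does not divide m, some index
  of g over c is not divisible by l; each such point needs D x y \<ge> l / 2, so within l - 1 there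
  is only one, x0. The gcd of l and its index divides m, so it is 1, and a e = l e' forces e = l: h
  is totally ramified above x0.\<close>

lemma power_caseE:
  assumes c: "c \<in> C" and Y: "Ys c = {y}"
  obtains x1 \<tau> where "gs = [:- y, 1:] ^ l + [:c:]" "h = [:- \<tau>, 1:] ^ l + [:x1:]"
proof -
  have bl: "ram gs y = l" using rc.sum_b[OF c] Y by simp
  have gy: "poly gs y = c" using Y by (auto simp: Ys_def)
  have full: "p = [:- t, 1:] ^ l + [:poly p t:]" if "ram p t = l" "degree p = l" "lead_coeff p = 1" for p :: "'a poly" and t
  proof -
    have dp: "0 < degree p" using that l_ge by simp
    have "[:- t, 1:] ^ l dvd p - [:poly p t:]"
      using order_1[of t "p - [:poly p t:]"] that(1) unfolding ram_def by simp
    then obtain q where q: "p - [:poly p t:] = [:- t, 1:] ^ l * q" by (rule dvdE)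
    have lc1: "lead_coeff (p - [:poly p t:]) = 1" using lead_coeff_diff_const[OF dp] that by simp
    have qnz: "q \<noteq> 0" using q diff_const_nz[OF dp] by auto
    have "degree (p - [:poly p t:]) = l + degree q"
      unfolding q using qnz by (subst degree_mult_eq) (auto simp: degree_linear_power)
    hence "degree q = 0" using degree_diff_const[OF dp] that by simp
    then obtain d where d: "q = [:d:]" by (rule degree_eq_zeroE)
    have "lead_coeff ([:- t, 1:] ^ l * q) = d"
      unfolding lead_coeff_mult lead_coeff_power d by simp
    hence "d = 1" using lc1 q by simp
    thus ?thesis using q d by (simp add: diff_eq_eq)
  qed
  obtain x0 where x0: "x0 \<in> Xs c" "\<not> l dvd ram g x0"
  proof (rule ccontr)
    assume "\<not> thesis"
    hence "\<forall>x\<in>Xs c. l dvd ram g x" using that by blast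
    hence "l dvd m" unfolding rc.sum_a[OF c, symmetric] by (intro dvd_sum) auto
    hence "is_unit l" using cop coprime_absorb_left by blast
    thus False using l_ge by simp
  qed
  have half: "l \<le> 2 * D x y" if "x \<in> Xs c" "\<not> l dvd ram g x" for x
  proof -
    have "2 * int (gcd l (ram g x)) \<le> int l" using half_gcd[OF _ that(2)] l_ge by simp
    moreover have "l \<le> D x y + gcd l (ram g x)"
      using D_ge2[of x y] that gy bl by (simp add: Xs_def gcd.commute)
    ultimately show ?thesis by linarith
  qed
  have sumD: "(\<Sum>x\<in>Xs c. D x y) \<le> l - 1"
  proof -
    have "(\<Sum>x\<in>Xs c. D x y) = (\<Sum>x\<in>Xs c. \<Sum>y\<in>Ys c. D x y)" by (simp add: Y)
    also have "\<dots> \<le> (\<Sum>c\<in>C. \<Sum>x\<in>Xs c. \<Sum>y\<in>Ys c. D x y)"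
      using c finC by (intro member_le_sum[of c C "\<lambda>c. \<Sum>x\<in>Xs c. \<Sum>y\<in>Ys c. D x y"]) auto
    finally show ?thesis using sum_D by simp
  qed
  have others: "l dvd ram g x" if "x \<in> Xs c" "x \<noteq> x0" for x
  proof (rule ccontr)
    assume nd: "\<not> ?thesis"
    have "(\<Sum>x\<in>{x0, x}. D x y) \<le> (\<Sum>x\<in>Xs c. D x y)"
      using that x0 rc.finX[OF c] by (intro sum_mono2) auto
    hence "D x0 y + D x y \<le> l - 1" using that sumD by simp
    thus False using half[OF x0] half[OF that(1) nd] l_ge by linarith
  qed
  have copx: "coprime l (ram g x0)"
  proof (rule coprimeI)
    fix d assume d: "d dvd l" "d dvd ram g x0"
    have "d dvd m"
      unfolding rc.sum_a[OF c, symmetric]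
    proof (rule dvd_sum)
      fix x assume "x \<in> Xs c" thus "d dvd ram g x" using d others[of x] by (cases "x = x0") (auto intro: dvd_trans)
    qed
    thus "is_unit d" using d cop coprime_common_divisor by blast
  qed
  have gx: "poly g x0 = poly gs y" using x0 gy by (simp add: Xs_def)
  have s: "(\<Sum>t\<in>Ts x0 y. ram h t) = l" using sum_e[OF gx] bl by simp
  then obtain \<tau> where \<tau>: "\<tau> \<in> Ts x0 y" using l_ge by (cases "Ts x0 y = {}") auto
  have "ram g x0 * ram h \<tau> = l * ram hs \<tau>" using ram_rel[of \<tau>] \<tau> bl by (simp add: Ts_def)
  hence "l dvd ram h \<tau>" using copx by (metis coprime_dvd_mult_right_iff dvd_triv_left)
  hence "l \<le> ram h \<tau>" using ram_pos[OF deg_pos(2)] by (intro dvd_imp_le)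
  moreover have "ram h \<tau> \<le> l" using s member_le_sum[of \<tau> "Ts x0 y" "ram h"] \<tau> finTs by simp
  ultimately have "ram h \<tau> = l" by simp
  have "h = [:- \<tau>, 1:] ^ l + [:poly h \<tau>:]" using full[OF \<open>ram h \<tau> = l\<close>] lc(2) deg(2) by blast
  moreover have "gs = [:- y, 1:] ^ l + [:c:]" using full[OF bl] lc(3) deg(3) gy by blast
  ultimately show ?thesis using that by blast
qed

text \<open>Where g is unramified it is locally invertible, so h is locally gs after hs with hs of
  index 1 and inherits both the index and the derivative order of gs. The singleton claim says that
  such a point x and a point y have exactly one common preimage.\<close>

lemma unramified_point:
  assumes "ram g (poly h t) = 1"
  shows "ram hs t = 1" "ram h t = ram gs (poly hs t)"
    "Polynomial.order t (pderiv h) = Polynomial.order (poly hs t) (pderiv gs)"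
    "Ts (poly h t) (poly hs t) = {t}"
proof -
  define x where "x = poly h t"
  define y where "y = poly hs t"
  have t: "t \<in> Ts x y" by (simp add: Ts_def x_def y_def)
  have xy: "poly g x = poly gs y" by (simp add: x_def y_def ff_eq)
  have s: "(\<Sum>t\<in>Ts x y. ram hs t) = 1" using sum_es[OF xy] assms by (simp add: x_def)
  have "ram hs t \<le> 1" using member_le_sum[of t "Ts x y" "ram hs"] t finTs s by simp
  thus e': "ram hs t = 1" using ram_pos[OF deg_pos(4), of t] by simp
  thus "ram h t = ram gs (poly hs t)" using ram_rel[of t] assms by simp
  have "Polynomial.order x (pderiv g) = 0" using rc.\<alpha>_1[of x] assms by (simp add: x_def)
  moreover have "Polynomial.order t (pderiv hs) = 0" using order_pderiv_eq[OF hs', of t] e' by simp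
  ultimately show "Polynomial.order t (pderiv h) = Polynomial.order (poly hs t) (pderiv gs)"
    using order_rel[of t] e' by (simp add: x_def)
  show "Ts (poly h t) (poly hs t) = {t}"
  proof (rule ccontr)
    assume "Ts (poly h t) (poly hs t) \<noteq> {t}"
    then obtain t' where t': "t' \<in> Ts x y" "t' \<noteq> t" using t by (auto simp: x_def y_def)
    have "(\<Sum>t\<in>{t, t'}. ram hs t) \<le> 1" unfolding s[symmetric] using t t' finTs by (intro sum_mono2) auto
    thus False using t' e' ram_pos[OF deg_pos(4), of t'] by simp
  qed
qed

text \<open>Both identities are checked order by order. Since the indices over c0 and c1 are 1 or 2,
  the product (g - c0) (g - c1) is the square of the derivative times one linear factor for each
  point of index 1, and the degrees 2 m and 2 (m - 1) leave exactly two such points. These two take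
  over the role of c0 and c1 in the identity for h.\<close>

lemma dickson_caseE:
  assumes "rc.dickson_type c0 c1"
  obtains x1 x2 t1 t2 where "(2::'a) \<noteq> 0" "of_nat m \<noteq> (0::'a)" "x1 \<noteq> x2" "t1 \<noteq> t2"
    "smult ((of_nat m)^2) ((g - [:c0:]) * (g - [:c1:])) = [:-x1, 1:] * [:-x2, 1:] * pderiv g ^ 2"
    "smult ((of_nat l)^2) ((h - [:x1:]) * (h - [:x2:])) = [:-t1, 1:] * [:-t2, 1:] * pderiv h ^ 2"
proof -
  note dt = assms[unfolded rc.dickson_type_def]
  have c: "c0 \<in> C" "c1 \<in> C" "c0 \<noteq> c1" using dt by auto
  have rest: "Polynomial.order x (pderiv g) = 0" if "poly g x \<in> C - {c0, c1}" for x
    using dt that by (auto simp: Xs_def)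
  have rest': "Polynomial.order y (pderiv gs) = 0" if "poly gs y \<in> C - {c0, c1}" for y
    using dt that by (auto simp: Ys_def)
  have a12: "ram g x \<in> {1, 2} \<and> Polynomial.order x (pderiv g) = ram g x - 1" if "poly g x \<in> {c0, c1}" for x
    using dt that by (auto simp: Xs_def)
  have b12: "ram gs y \<in> {1, 2} \<and> Polynomial.order y (pderiv gs) = ram gs y - 1" if "poly gs y \<in> {c0, c1}" for y
    using dt that by (auto simp: Ys_def)
  have ex2: "\<exists>x. poly g x = c0 \<and> ram g x = 2" using dt by (auto simp: Xs_def)
  have D0: "D x y = 0" if "poly g x \<in> {c0, c1}" "poly gs y = poly g x" "ram g x = 2" for x y
    using dt that by (auto simp: Xs_def Ys_def)
  have dgm: "degree (pderiv g) = m - 1"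
  proof -
    have "(\<Sum>c\<in>C. \<Sum>x\<in>Xs c. Polynomial.order x (pderiv g)) =
          (\<Sum>c\<in>{c0, c1}. \<Sum>x\<in>Xs c. Polynomial.order x (pderiv g))"
      using c finC rest by (intro sum.mono_neutral_right) (auto simp: Xs_def)
    also have "\<dots> = (\<Sum>x\<in>Xs c0. Polynomial.order x (pderiv g)) + (\<Sum>x\<in>Xs c1. Polynomial.order x (pderiv g))"
      using c(3) by (subst sum.insert) auto
    also have "\<dots> = m - 1" using dt by blast
    finally show ?thesis using sum_\<alpha> by simp
  qed
  have m_nz: "of_nat m \<noteq> (0::'a)"
  proof
    assume "of_nat m = (0::'a)"
    hence "coeff (pderiv g) (m - 1) = 0" using l_less by (simp add: coeff_pderiv flip: of_nat_Suc)
    thus False using g' dgm by (metis leading_coeff_0_iff)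
  qed
  have lead_g': "lead_coeff (pderiv g) = of_nat m" using degree_lead_pderiv(2)[OF lc(1)] deg m_nz by auto
  \<comment> \<open>At a point of index 2 the derivative has order only 1, so the point is tame and
    2 is nonzero.\<close>
  have two: "(2::'a) \<noteq> 0"
  proof
    assume "(2::'a) = 0"
    moreover obtain x where x: "poly g x = c0" "ram g x = 2" using ex2 by blast
    ultimately show False using order_pderiv_eq[OF g', of x] a12[of x] by simp
  qed
  define X1 where "X1 = {x. poly g x \<in> {c0, c1} \<and> ram g x = 1}"
  define \<Theta> where "\<Theta> = {t. poly h t \<in> X1 \<and> ram gs (poly hs t) = 1}"
  have finX1: "finite X1" unfolding X1_def
    using finite_preimage[OF deg_pos(1), of "{c0, c1}"] by (rule finite_subset[rotated]) auto
  have fin\<Theta>: "finite \<Theta>" unfolding \<Theta>_def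
    using finite_preimage[OF deg_pos(2) finX1] by (rule finite_subset[rotated]) auto
  have ord_diff: "Polynomial.order x (p - [:c:]) = (if poly p x = c then ram p x else 0)"
    if "0 < degree p" for p :: "'a poly" and x c
    using that by (auto simp: ram_def intro: order_0I)
  have ord_lin: "Polynomial.order x (\<Prod>a\<in>A. [:- a, 1:]) = (if x \<in> A then 1 else 0)"
    if "finite A" for A and x :: 'a
    using that
  proof (induction A)
    case (insert a A)
    have "(\<Prod>a\<in>insert a A. [:- a, 1:]) \<noteq> 0"
      using insert(1) by (simp add: prod_zero_iff del: prod.insert)
    moreover have "Polynomial.order x [:- a, 1:] = (if x = a then 1 else 0)"
      using order_power_n_n[of a 1] by (auto intro: order_0I)
    ultimately show ?case using insert by (auto simp: order_mult simp del: mult_pCons_left)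
  qed simp
  have lead_lin: "lead_coeff (\<Prod>a\<in>A. [:- a, 1:]) = 1" for A :: "'a set"
    by (simp add: lead_coeff_prod del: coeff_mult_degree_sum)
  have nzg: "g - [:c0:] \<noteq> 0" "g - [:c1:] \<noteq> 0" using diff_const_nz deg_pos by auto
  have nzh: "h - [:x:] \<noteq> 0" for x using diff_const_nz deg_pos by auto
  have nzl: "(\<Prod>a\<in>A. [:- a, 1:]) \<noteq> 0" for A :: "'a set"
    by (metis lead_lin leading_coeff_0_iff zero_neq_one)
  have \<alpha>0: "Polynomial.order x (pderiv g) = 0" if "poly g x \<notin> {c0, c1}" for x
  proof (cases "poly g x \<in> C")
    case True thus ?thesis using rest that by blast
  next
    case False
    hence "poly (pderiv g) x \<noteq> 0" by (auto simp: C_def)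
    thus ?thesis by (rule order_0I)
  qed
  have geq: "smult ((of_nat m)^2) ((g - [:c0:]) * (g - [:c1:])) = (\<Prod>a\<in>X1. [:- a, 1:]) * pderiv g ^ 2"
  proof (rule poly_eqI_order)
    show "smult ((of_nat m)^2) ((g - [:c0:]) * (g - [:c1:])) \<noteq> 0" using nzg m_nz by simp
    show "(\<Prod>a\<in>X1. [:- a, 1:]) * pderiv g ^ 2 \<noteq> 0" using nzl g' by simp
    show "lead_coeff (smult ((of_nat m)^2) ((g - [:c0:]) * (g - [:c1:]))) =
          lead_coeff ((\<Prod>a\<in>X1. [:- a, 1:]) * pderiv g ^ 2)"
      unfolding lead_coeff_smult lead_coeff_mult lead_coeff_power lead_lin lead_g'
      using lead_coeff_diff_const[OF deg_pos(1)] lc by simp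
    fix x
    have "Polynomial.order x (smult ((of_nat m)^2) ((g - [:c0:]) * (g - [:c1:]))) =
          (if poly g x \<in> {c0, c1} then ram g x else 0)"
      using nzg m_nz c(3) deg_pos by (simp add: order_smult order_mult ord_diff)
    also have "\<dots> = (if x \<in> X1 then 1 else 0) + 2 * Polynomial.order x (pderiv g)"
      using a12[of x] \<alpha>0[of x] by (auto simp: X1_def)
    also have "\<dots> = Polynomial.order x ((\<Prod>a\<in>X1. [:- a, 1:]) * pderiv g ^ 2)"
      using nzl g' ord_lin[OF finX1, of x] by (simp add: order_mult order_power)
    finally show "Polynomial.order x (smult ((of_nat m)^2) ((g - [:c0:]) * (g - [:c1:]))) =
       Polynomial.order x ((\<Prod>a\<in>X1. [:- a, 1:]) * pderiv g ^ 2)" .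
  qed
  have deg_lin: "degree (\<Prod>a\<in>A. [:- a, 1:]) = card A" for A :: "'a set"
    by (subst degree_prod_eq_sum_degree) auto
  have "2 * m = card X1 + 2 * (m - 1)"
    using arg_cong[OF geq, of degree] nzg nzl[of X1] g' m_nz deg_pos deg dgm
    by (simp add: degree_mult_eq degree_diff_const degree_power_eq deg_lin)
  hence cardX1: "card X1 = 2" using l_less by simp
  then obtain x1 x2 where x12: "X1 = {x1, x2}" "x1 \<noteq> x2" by (auto simp: card_2_iff)
  \<comment> \<open>Outside \<open>X1\<close> there are two kinds of points. Above index 2 the
    derivative of h has no zero because D = 0. Over values other than c0 and c1 both g and gs are
    unramified, and h inherits this from gs.\<close>
  have d0: "Polynomial.order t (pderiv h) = 0" if t: "poly h t \<notin> X1" for t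
  proof (cases "poly f t \<in> {c0, c1}")
    case True
    hence ft: "poly g (poly h t) \<in> {c0, c1}" by (simp only: poly_pcompose)
    hence "ram g (poly h t) \<noteq> 1" using t unfolding X1_def by blast
    hence "ram g (poly h t) = 2" using a12[OF ft] by blast
    hence "D (poly h t) (poly hs t) = 0" by (rule D0[OF ft ff_eq[symmetric]])
    moreover have "t \<in> Ts (poly h t) (poly hs t)" by (simp add: Ts_def)
    ultimately show ?thesis using finTs by (simp add: D_def)
  next
    case False
    show ?thesis
    proof (cases "poly f t \<in> C")
      case True
      hence "Polynomial.order (poly h t) (pderiv g) = 0" using False by (intro rest) (auto simp: poly_pcompose)
      hence "ram g (poly h t) = 1" using rc.\<alpha>_ge[of "poly h t"] ram_pos[OF deg_pos(1), of "poly h t"] by simp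
      moreover have "Polynomial.order (poly hs t) (pderiv gs) = 0"
        using False True by (intro rest') (auto simp: poly_pcompose ff_eq)
      ultimately show ?thesis using unramified_point(3)[of t] by simp
    next
      case False
      hence "poly (pderiv h) t \<noteq> 0" by (auto simp: C_def)
      thus ?thesis by (rule order_0I)
    qed
  qed
  have heq: "smult ((of_nat l)^2) ((h - [:x1:]) * (h - [:x2:])) = (\<Prod>a\<in>\<Theta>. [:- a, 1:]) * pderiv h ^ 2"
  proof (rule poly_eqI_order)
    show "smult ((of_nat l)^2) ((h - [:x1:]) * (h - [:x2:])) \<noteq> 0" using nzh l_nz by simp
    show "(\<Prod>a\<in>\<Theta>. [:- a, 1:]) * pderiv h ^ 2 \<noteq> 0" using nzl h' by simp
    show "lead_coeff (smult ((of_nat l)^2) ((h - [:x1:]) * (h - [:x2:]))) =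
          lead_coeff ((\<Prod>a\<in>\<Theta>. [:- a, 1:]) * pderiv h ^ 2)"
      unfolding lead_coeff_smult lead_coeff_mult lead_coeff_power lead_lin lead_h'
      using lead_coeff_diff_const[OF deg_pos(2)] lc by simp
    fix t
    have "Polynomial.order t (smult ((of_nat l)^2) ((h - [:x1:]) * (h - [:x2:]))) =
          (if poly h t \<in> X1 then ram h t else 0)"
      using nzh l_nz x12(2) deg_pos(2) unfolding x12(1) by (simp add: order_smult order_mult ord_diff)
    also have "\<dots> = (if t \<in> \<Theta> then 1 else 0) + 2 * Polynomial.order t (pderiv h)"
    proof (cases "poly h t \<in> X1")
      case True
      hence "ram g (poly h t) = 1" by (simp add: X1_def)
      note u = unramified_point[OF this]
      have "poly gs (poly hs t) \<in> {c0, c1}" using True by (simp add: X1_def flip: ff_eq)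
      thus ?thesis using True u b12[of "poly hs t"] by (auto simp: \<Theta>_def)
    next
      case False
      thus ?thesis using d0 by (simp add: \<Theta>_def)
    qed
    also have "\<dots> = Polynomial.order t ((\<Prod>a\<in>\<Theta>. [:- a, 1:]) * pderiv h ^ 2)"
      using nzl h' ord_lin[OF fin\<Theta>, of t] by (simp add: order_mult order_power)
    finally show "Polynomial.order t (smult ((of_nat l)^2) ((h - [:x1:]) * (h - [:x2:]))) =
       Polynomial.order t ((\<Prod>a\<in>\<Theta>. [:- a, 1:]) * pderiv h ^ 2)" .
  qed
  have "2 * l = card \<Theta> + 2 * (l - 1)"
    using arg_cong[OF heq, of degree] nzh nzl[of \<Theta>] h' l_nz deg_pos deg degree_h'
    by (simp add: degree_mult_eq degree_diff_const degree_power_eq deg_lin)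
  hence "card \<Theta> = 2" using l_ge by simp
  then obtain t1 t2 where t12: "\<Theta> = {t1, t2}" "t1 \<noteq> t2" by (auto simp: card_2_iff)
  show thesis
    by (rule that[of x1 x2 t1 t2]) (use two m_nz x12 t12 geq heq in auto)
qed

end

section \<open>Pell equations and Dickson polynomials\<close>

lemma diff_times_sum: "(a - b) * (a + b) = a ^ 2 - b ^ 2" for a b :: "'a::comm_ring_1"
  by (simp add: power2_eq_square algebra_simps)

lemma dickson_Suc_Suc: "dickson z (n + 2) = [:0, 1:] * dickson z (n + 1) - smult z (dickson z n)"
  by simp

text \<open>Dickson polynomials E_n of the second kind. They supply the second component in the Pell
  equation T_(n+1)^2 - (x^2 - 4 z) E_n^2 = 4 z^(n+1).\<close>

fun dickson2 :: "'a::comm_ring_1 \<Rightarrow> nat \<Rightarrow> 'a poly" where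
  "dickson2 z 0 = 1"
| "dickson2 z (Suc 0) = [:0, 1:]"
| "dickson2 z (Suc (Suc m)) = [:0, 1:] * dickson2 z (Suc m) - smult z (dickson2 z m)"

lemma dickson2_Suc_Suc: "dickson2 z (n + 2) = [:0, 1:] * dickson2 z (n + 1) - smult z (dickson2 z n)"
  by simp

lemma double_recurrence:
  "2 * (x * p - smult z q) = x * (2 * p) - smult z (2 * q)" for x :: "'a::comm_ring_1 poly"
  by (simp only: right_diff_distrib mult_smult_right mult.left_commute)

lemma recurrence_combine:
  "x * (y * a + u * b) - smult z (y * a' + u * b') = y * (x * a - smult z a') + u * (x * b - smult z b')"
  for x :: "'a::comm_ring_1 poly"
  by (simp add: algebra_simps smult_add_right)

text \<open>Together with \<open>two_dickson\<close> this is multiplication of T + E sqrt d by (x +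
  sqrt d) / 2, where d = x^2 - 4 z, written in components and doubled so as to avoid the
  denominator.\<close>

lemma two_dickson2: "2 * dickson2 z (n + 1) = [:0, 1:] * dickson2 z n + dickson z (n + 1)"
proof (induction n rule: induct_nat_012)
  case (ge2 n)
  have "2 * dickson2 z (n + 1 + 2) = [:0, 1:] * (2 * dickson2 z (Suc n + 1)) - smult z (2 * dickson2 z (n + 1))"
    unfolding dickson2_Suc_Suc[of z "n + 1"] double_recurrence by simp
  also have "\<dots> = [:0, 1:] * dickson2 z (n + 2) + 1 * dickson z (n + 1 + 2)"
    unfolding ge2 dickson2_Suc_Suc dickson_Suc_Suc[of z "n + 1"]
    using recurrence_combine[of "[:0, 1:]" "[:0, 1:]" _ 1] by (simp del: mult_pCons_left)
  finally show ?case by simp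
qed (simp_all add: numeral_poly)

lemma two_dickson: "2 * dickson z (n + 2) = [:0, 1:] * dickson z (n + 1) + [:- 4 * z, 0, 1:] * dickson2 z n"
proof (induction n rule: induct_nat_012)
  case (ge2 n)
  have "2 * dickson z (n + 2 + 2) = [:0, 1:] * (2 * dickson z (Suc n + 2)) - smult z (2 * dickson z (n + 2))"
    unfolding dickson_Suc_Suc[of z "n + 2"] double_recurrence by simp
  also have "\<dots> = [:0, 1:] * dickson z (n + 1 + 2) + [:- 4 * z, 0, 1:] * dickson2 z (n + 2)"
    unfolding ge2 dickson2_Suc_Suc dickson_Suc_Suc[of z "n + 1"]
    using recurrence_combine[of "[:0, 1:]" "[:0, 1:]" _ "[:- 4 * z, 0, 1:]"] by (simp del: mult_pCons_left)
  finally show ?case by simp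
qed (simp_all add: numeral_poly)

text \<open>Descent along the fundamental unit (x - sqrt (x^2 - 4 z)) / 2 of the Pell equation.\<close>

lemma pell_dickson:
  fixes H Q :: "'a::field poly"
  assumes two: "(2::'a) \<noteq> 0" and z: "z \<noteq> 0"
    and eq: "[:- 4 * z, 0, 1:] * Q ^ 2 = H ^ 2 - [:4 * \<zeta>:]"
    and H: "degree H = n + 1" "lead_coeff H = 1" and Q: "degree Q = n" "lead_coeff Q = 1"
  shows "H = dickson z (n + 1) \<and> Q = dickson2 z n \<and> \<zeta> = z ^ (n + 1)"
  using eq H Q
proof (induction n arbitrary: H Q \<zeta>)
  case 0
  obtain d where "Q = [:d:]" using 0(4) by (rule degree_eq_zeroE)
  hence Q1: "Q = 1" using 0(5) by (simp add: one_pCons)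
  define M where "M = H - [:0, 1:]"
  have MM: "M * (H + [:0, 1:]) = [:4 * \<zeta> - 4 * z:]"
  proof -
    have "M * (H + [:0, 1:]) = H ^ 2 - [:0, 1:] ^ 2" unfolding M_def by (rule diff_times_sum)
    also have "H ^ 2 = [:- 4 * z, 0, 1:] + [:4 * \<zeta>:]" using 0(1) unfolding Q1 by (simp add: eq_diff_eq)
    finally show ?thesis by (simp add: power2_eq_square)
  qed
  have c2: "coeff (H + [:0, 1:]) 1 = 2" using 0(2,3) by simp
  have "1 \<le> degree (H + [:0, 1:])" by (rule le_degree) (unfold c2, rule two)
  moreover from this have "H + [:0, 1:] \<noteq> 0" by (metis degree_0 not_one_le_zero)
  ultimately have nz: "1 \<le> degree (H + [:0, 1:])" "H + [:0, 1:] \<noteq> 0" by blast+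
  have "M = 0"
  proof (rule ccontr)
    assume "M \<noteq> 0"
    hence "degree (M * (H + [:0, 1:])) \<ge> 1" using nz by (subst degree_mult_eq) auto
    thus False unfolding MM by simp
  qed
  hence "4 * \<zeta> = 4 * z" using MM by simp
  moreover have "(4::'a) = 2 * 2" by simp
  hence "(4::'a) \<noteq> 0" using two by (metis mult_eq_0_iff)
  ultimately have "\<zeta> = z" by simp
  thus ?case using \<open>M = 0\<close> Q1 by (simp add: M_def)
next
  case (Suc n)
  \<comment> \<open>M (H + x Q) = 4 \<zeta> - 4 z Q^2 has degree 2 n + 2, and H + x Q has degree n +
    2 because 2 is nonzero. So M has degree n with leading coefficient - 2 z: up to a scalar it is
    the next, smaller Q.\<close>
  define M where "M = H - [:0, 1:] * Q"
  have four: "(4::'a) \<noteq> 0"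
  proof -
    have "(4::'a) = 2 * 2" by simp
    thus ?thesis using two by (metis mult_eq_0_iff)
  qed
  have Qnz: "Q \<noteq> 0" using Suc.prems by auto
  have XQ: "degree ([:0, 1:] * Q) = n + 2"
    using Suc.prems Qnz by (auto simp: degree_mult_eq simp del: mult_pCons_left)
  have cS: "coeff (H + [:0, 1:] * Q) (n + 2) = 2"
    using Suc.prems by simp
  have dS: "degree (H + [:0, 1:] * Q) = n + 2"
  proof (rule antisym)
    show "degree (H + [:0, 1:] * Q) \<le> n + 2"
      using Suc.prems XQ by (intro degree_add_le) auto
    show "n + 2 \<le> degree (H + [:0, 1:] * Q)" by (rule le_degree) (unfold cS, rule two)
  qed
  have MM: "M * (H + [:0, 1:] * Q) = [:4 * \<zeta>:] - smult (4 * z) (Q ^ 2)"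
  proof -
    have "[:- 4 * z, 0, 1:] * Q ^ 2 = ([:0, 1:] * Q) ^ 2 - smult (4 * z) (Q ^ 2)"
      by (simp add: power2_eq_square algebra_simps)
    hence "H ^ 2 - ([:0, 1:] * Q) ^ 2 = [:4 * \<zeta>:] - smult (4 * z) (Q ^ 2)"
      using Suc.prems(1) by (simp only:) (simp add: algebra_simps)
    moreover have "M * (H + [:0, 1:] * Q) = H ^ 2 - ([:0, 1:] * Q) ^ 2"
      unfolding M_def by (rule diff_times_sum)
    ultimately show ?thesis by simp
  qed
  have dQ2: "degree (Q ^ 2) = 2 * n + 2" using Suc.prems Qnz by (simp add: degree_power_eq)
  have lQ2: "coeff (Q ^ 2) (2 * n + 2) = 1"
    unfolding dQ2[symmetric] lead_coeff_power using Suc.prems(5) by simp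
  have dR: "degree ([:4 * \<zeta>:] - smult (4 * z) (Q ^ 2)) = 2 * n + 2"
    "lead_coeff ([:4 * \<zeta>:] - smult (4 * z) (Q ^ 2)) = - 4 * z"
  proof -
    have d: "degree (smult (4 * z) (Q ^ 2)) = 2 * n + 2" using dQ2 four z by simp
    have "degree ([:4 * \<zeta>:] - smult (4 * z) (Q ^ 2)) = degree (- smult (4 * z) (Q ^ 2) + [:4 * \<zeta>:])"
      by simp
    also have "\<dots> = 2 * n + 2" using d by (subst degree_add_eq_left) auto
    finally show d': "degree ([:4 * \<zeta>:] - smult (4 * z) (Q ^ 2)) = 2 * n + 2" .
    show "lead_coeff ([:4 * \<zeta>:] - smult (4 * z) (Q ^ 2)) = - 4 * z"
      unfolding d' using lQ2 by simp
  qed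
  have RQnz: "M \<noteq> 0" "H + [:0, 1:] * Q \<noteq> 0"
    using MM dR four z by (metis degree_0 leading_coeff_0_iff mult_eq_0_iff neg_equal_0_iff_equal mult_zero_left mult_minus_left)+
  have "degree M + (n + 2) = 2 * n + 2"
    using arg_cong[OF MM, of degree] unfolding degree_mult_eq[OF RQnz] dR(1) dS .
  hence dM: "degree M = n" by simp
  have "lead_coeff M * 2 = - 4 * z"
    using arg_cong[OF MM, of lead_coeff] unfolding lead_coeff_mult dR(2) dS cS .
  hence "2 * (lead_coeff M + 2 * z) = 0" by (simp add: algebra_simps)
  hence "lead_coeff M + 2 * z = 0" using two by (metis mult_eq_0_iff)
  hence lM: "lead_coeff M = - 2 * z" by (simp add: eq_neg_iff_add_eq_0)
  \<comment> \<open>Components of (H + Q sqrt d) (x - sqrt d) / (2 z) with d = x^2 - 4 z. The factor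
    (x - sqrt d) / 2 has norm z, and dividing by z again restores monic components, so \<zeta> turns
    into \<zeta> / z.\<close>
  define H1 where "H1 = smult (1 / (2 * z)) ([:0, 1:] * M + smult (4 * z) Q)"
  define Q1 where "Q1 = smult (- 1 / (2 * z)) M"
  have tz: "2 * z \<noteq> 0" using two z by simp
  have Meq: "M = smult (- (2 * z)) Q1" using tz by (simp add: Q1_def)
  have Heq: "[:0, 1:] * M + smult (4 * z) Q = smult (2 * z) H1" using tz by (simp add: H1_def)
  have Q1: "degree Q1 = n" "lead_coeff Q1 = 1"
    using dM lM tz by (simp_all add: Q1_def)
  have H1c: "coeff H1 (n + 1) = 1"
  proof -
    have "coeff ([:0, 1:] * M + smult (4 * z) Q) (n + 1) = 2 * z"
      using lM dM Suc.prems by (simp add: algebra_simps)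
    thus ?thesis using tz by (simp add: H1_def)
  qed
  have H1: "degree H1 = n + 1" "lead_coeff H1 = 1"
  proof -
    have "degree ([:0, 1:] * M + smult (4 * z) Q) \<le> n + 1"
      using dM Suc.prems by (intro degree_add_le order_trans[OF degree_mult_le] order_trans[OF degree_smult_le]) auto
    hence "degree H1 \<le> n + 1" unfolding H1_def using degree_smult_le le_trans by blast
    moreover have "n + 1 \<le> degree H1" using H1c by (intro le_degree) simp
    ultimately show "degree H1 = n + 1" by simp
    thus "lead_coeff H1 = 1" using H1c by simp
  qed
  have HM: "H = M + [:0, 1:] * Q" by (simp add: M_def)
  have key: "smult (4 * z * z) ([:- 4 * z, 0, 1:] * Q1 ^ 2) = smult (4 * z * z) (H1 ^ 2 - [:4 * (\<zeta> / z):])"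
  proof -
    have a: "smult (4 * z * z) (Q1 ^ 2) = M ^ 2"
      unfolding Meq by (simp add: power2_eq_square mult_ac)
    have b: "smult (4 * z * z) (H1 ^ 2) = ([:0, 1:] * M + smult (4 * z) Q) ^ 2"
      unfolding Heq by (simp add: power2_eq_square mult_ac)
    have c: "smult (4 * z * z) [:4 * (\<zeta> / z):] = smult (4 * z) [:4 * \<zeta>:]" using z by simp
    have d: "smult (4 * z * z) ([:- 4 * z, 0, 1:] * Q1 ^ 2) = [:- 4 * z, 0, 1:] * M ^ 2"
      unfolding mult_smult_right[symmetric] a ..
    have e: "[:4 * \<zeta>:] = (M + [:0, 1:] * Q) ^ 2 - [:- 4 * z, 0, 1:] * Q ^ 2"
      using Suc.prems(1) unfolding HM by (simp only:) (simp add: algebra_simps)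
    define x where "x = [:0, 1 :: 'a:]"
    define y where "y = [:z:]"
    have xy: "[:- 4 * z, 0, 1:] = x ^ 2 - 4 * y" "smult (4 * z) p = 4 * y * p" for p
      by (simp_all add: x_def y_def numeral_poly power2_eq_square mult.commute)
    have "(x ^ 2 - 4 * y) * M ^ 2 =
        (x * M + 4 * y * Q) ^ 2 - (4 * y * (M + x * Q) ^ 2 - 4 * y * ((x ^ 2 - 4 * y) * Q ^ 2))"
      by (simp add: power2_eq_square algebra_simps)
    thus ?thesis unfolding smult_diff_right b c d e unfolding xy unfolding x_def .
  qed
  have "4 * z * z \<noteq> 0" using four z by simp
  hence eq1: "[:- 4 * z, 0, 1:] * Q1 ^ 2 = H1 ^ 2 - [:4 * (\<zeta> / z):]" using key by (metis smult_cancel)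
  note IH = Suc.IH[OF eq1 H1 Q1]
  have z1: "\<zeta> = z ^ (Suc n + 1)" using IH z by (simp add: field_simps)
  have two': "(2::'a poly) \<noteq> 0" using two by (metis of_nat_numeral of_nat_eq_0_iff_char_dvd semiring_char_poly)
  have "smult (2 * z) (2 * Q) = smult (2 * z) ([:0, 1:] * Q1 + H1)"
  proof -
    have "smult (2 * z) (2 * Q) = smult (4 * z) Q"
      unfolding numeral_mult_conv_smult[of _ Q] by (simp add: mult.commute)
    also have "\<dots> = smult (2 * z) H1 - [:0, 1:] * M" using Heq by (simp add: algebra_simps)
    finally show ?thesis unfolding Meq by (simp add: smult_add_right)
  qed
  hence Q2: "2 * Q = [:0, 1:] * Q1 + H1" using tz by (metis smult_cancel)
  hence "2 * Q = 2 * dickson2 z (n + 1)" using IH two_dickson2[of z n] by simp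
  hence Qfin: "Q = dickson2 z (Suc n)" using two' by simp
  have "2 * H = 2 * M + [:0, 1:] * (2 * Q)" unfolding HM by (simp only: algebra_simps)
  also have "\<dots> = [:0, 1:] * H1 + [:- 4 * z, 0, 1:] * Q1"
  proof -
    have "2 * M = smult (- (4 * z)) Q1"
      unfolding numeral_mult_conv_smult[of _ M] by (subst Meq) simp
    thus ?thesis unfolding Q2 by (simp add: algebra_simps)
  qed
  also have "\<dots> = 2 * dickson z (n + 2)" using IH two_dickson[of z n] by simp
  finally have "H = dickson z (n + 2)" using two' mult_left_cancel by blast
  hence "H = dickson z (Suc n + 1)" by (simp only: add_2_eq_Suc' Suc_eq_plus1[symmetric])
  thus ?case using Qfin z1 by blast
qed

lemma degree_pcompose_linear: "degree (pcompose p [:a, 1:]) = degree p" for p :: "'a::field poly"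
  by (simp add: degree_pcompose)

lemma lead_pcompose_linear: "lead_coeff (pcompose p [:a, 1:]) = lead_coeff p" for p :: "'a::field poly"
  using lead_coeff_comp[of "[:a, 1:]" p] by simp

lemma pcompose_shift_inverse: "pcompose (pcompose p [:a, 1:]) [:-a, 1:] = p" for p :: "'a::field poly"
  by (simp add: pcompose_assoc[symmetric] pcompose_pCons)

text \<open>Centring at the midpoint of t1 and t2, and subtracting the midpoint of x1 and x2, turns
  the hypothesis into a Pell equation for h with Q the derivative divided by the degree. The zeros
  of x^2 - 4 z then are (t1 - t2) / 2 and its negative, which explains the 4 in the definition of
  z.\<close>

lemma dickson_of_critical_values:
  fixes h :: "'a::field poly"
  assumes two: "(2::'a) \<noteq> 0" and l: "1 \<le> degree h" "of_nat (degree h) \<noteq> (0::'a)" and lc: "lead_coeff h = 1"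
    and t: "t1 \<noteq> t2"
    and eq: "smult ((of_nat (degree h))^2) ((h - [:x1:]) * (h - [:x2:])) = [:-t1, 1:] * [:-t2, 1:] * pderiv h ^ 2"
    and h'd: "degree (pderiv h) = degree h - 1" "lead_coeff (pderiv h) = of_nat (degree h)"
  defines "z \<equiv> ((t1 - t2) / 4)^2"
  shows "h = pcompose (dickson z (degree h)) [:- ((t1 + t2) / 2), 1:] + [:(x1 + x2) / 2:]"
    "((x1 - x2) / 4)^2 = z ^ degree h" "z \<noteq> 0"
proof -
  define l where "l = degree h"
  define s where "s = (t1 + t2) / 2"
  define x where "x = (x1 + x2) / 2"
  define \<zeta> where "\<zeta> = ((x1 - x2) / 4)^2"
  have four: "(4::'a) = 2 * 2" "(4::'a) \<noteq> 0" using two by (simp, metis mult_eq_0_iff numeral_Bit0_eq_double)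
  show z: "z \<noteq> 0" using t four by (simp add: z_def)
  define H where "H = pcompose h [:s, 1:] - [:x:]"
  define Q where "Q = smult (1 / of_nat l) (pcompose (pderiv h) [:s, 1:])"
  have ln: "of_nat l \<noteq> (0::'a)" using l by (simp add: l_def)
  have t12: "t1 = s + (t1 - t2) / 2" "t2 = s - (t1 - t2) / 2" and x12: "x1 = x + (x1 - x2) / 2" "x2 = x - (x1 - x2) / 2"
    using two four by (simp_all add: s_def x_def field_simps)
  have fz: "4 * z = ((t1 - t2) / 2)^2" "4 * \<zeta> = ((x1 - x2) / 2)^2"
  proof -
    have "(t1 - t2) / 2 = 2 * ((t1 - t2) / 4)" "(x1 - x2) / 2 = 2 * ((x1 - x2) / 4)"
      using two four(2) unfolding four(1) by simp_all
    thus "4 * z = ((t1 - t2) / 2)^2" "4 * \<zeta> = ((x1 - x2) / 2)^2"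
      by (simp_all only: z_def \<zeta>_def power_mult_distrib) simp_all
  qed
  have "pcompose ([:-t1, 1:] * [:-t2, 1:]) [:s, 1:] = [:s - t1, 1:] * [:s - t2, 1:]"
    by (simp add: pcompose_mult pcompose_pCons algebra_simps)
  also have "s - t1 = - ((t1 - t2) / 2)" using t12(1) by (metis add_diff_cancel_left' minus_diff_eq)
  also have "s - t2 = (t1 - t2) / 2" using t12(2) by (metis diff_diff_eq2 add_diff_cancel_left')
  also have "[:- ((t1 - t2) / 2), 1:] * [:(t1 - t2) / 2, 1:] = [:- (((t1 - t2) / 2)^2), 0, 1:]"
    by (simp add: power2_eq_square)
  also have "\<dots> = [:- 4 * z, 0, 1:]" using fz(1) by simp
  finally have lin: "pcompose ([:-t1, 1:] * [:-t2, 1:]) [:s, 1:] = [:- 4 * z, 0, 1:]" .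
  have "(pcompose h [:s, 1:] - [:x1:]) * (pcompose h [:s, 1:] - [:x2:]) = H^2 - [:4 * \<zeta>:]"
  proof -
    have 1: "pcompose h [:s, 1:] - [:x1:] = H - [:(x1 - x2) / 2:]"
      using x12(1) by (simp add: H_def algebra_simps)
    have 2: "pcompose h [:s, 1:] - [:x2:] = H + [:(x1 - x2) / 2:]"
      using x12(2) by (simp add: H_def algebra_simps)
    have "(H - [:(x1 - x2) / 2:]) * (H + [:(x1 - x2) / 2:]) = H^2 - [:(x1 - x2) / 2:]^2"
      by (rule diff_times_sum)
    also have "[:(x1 - x2) / 2:]^2 = [:4 * \<zeta>:]" unfolding fz(2) by (simp add: power2_eq_square)
    finally show ?thesis unfolding 1 2 .
  qed
  hence "smult ((of_nat l)^2) (H^2 - [:4 * \<zeta>:]) = pcompose (smult ((of_nat l)^2) ((h - [:x1:]) * (h - [:x2:]))) [:s, 1:]"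
    by (simp add: pcompose_smult pcompose_mult pcompose_diff)
  also have "\<dots> = [:- 4 * z, 0, 1:] * (pcompose (pderiv h) [:s, 1:])^2"
    unfolding eq[folded l_def] pcompose_mult[of _ _ "[:s, 1:]"] lin[unfolded pcompose_mult]
    by (simp add: power2_eq_square pcompose_mult)
  also have "\<dots> = smult ((of_nat l)^2) ([:- 4 * z, 0, 1:] * Q^2)"
    using ln by (simp add: Q_def power2_eq_square del: mult_pCons_left mult_pCons_right)
  finally have pe: "[:- 4 * z, 0, 1:] * Q^2 = H^2 - [:4 * \<zeta>:]" using ln by (metis power_eq_0_iff smult_cancel)
  have dl: "degree (pcompose h [:s, 1:]) = l" "lead_coeff (pcompose h [:s, 1:]) = 1"
    unfolding lead_pcompose_linear using lc by (simp_all only: degree_pcompose_linear l_def)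
  have H: "degree H = (l - 1) + 1" "lead_coeff H = 1"
    using degree_diff_const[of "pcompose h [:s, 1:]" x] lead_coeff_diff_const[of "pcompose h [:s, 1:]" x] dl l
    by (simp_all add: H_def l_def)
  have Q: "degree Q = l - 1" "lead_coeff Q = 1"
    unfolding Q_def lead_coeff_smult lead_pcompose_linear h'd(2)
    using ln h'd(1) by (simp_all add: degree_pcompose_linear l_def)
  have l1: "l - 1 + 1 = l" using l by (simp add: l_def)
  have res: "H = dickson z l" "\<zeta> = z ^ l" using pell_dickson[OF two z pe H Q] unfolding l1 by auto
  have "pcompose h [:s, 1:] = dickson z l + [:x:]" using res(1) by (simp add: H_def diff_eq_eq)
  hence "pcompose (pcompose h [:s, 1:]) [:-s, 1:] = pcompose (dickson z l) [:-s, 1:] + [:x:]"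
    by (simp add: pcompose_add)
  thus "h = pcompose (dickson z (degree h)) [:- ((t1 + t2) / 2), 1:] + [:(x1 + x2) / 2:]"
    unfolding pcompose_shift_inverse by (simp only: l_def s_def x_def)
  show "((x1 - x2) / 4)^2 = z ^ degree h" using res(2) by (simp add: \<zeta>_def l_def)
qed

section \<open>Dickson polynomials of odd index in characteristic 2\<close>

lemma char2_add_self: "(2::'a::field) = 0 \<Longrightarrow> (x::'a) + x = 0"
  by (metis mult_2 mult_zero_left)

lemma char2_minus: "(2::'a::field) = 0 \<Longrightarrow> - (x::'a) = x"
  by (metis add_eq_0_iff2 char2_add_self)

lemma char2_poly: "(2::'a::field) = 0 \<Longrightarrow> (2::'a poly) = 0"
  by (simp add: numeral_poly)

lemma char2_poly_add_self: "(2::'a::field) = 0 \<Longrightarrow> (p::'a poly) + p = 0"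
  by (metis mult_2 mult_zero_left char2_poly)

lemma char2_poly_minus: "(2::'a::field) = 0 \<Longrightarrow> - (p::'a poly) = p"
  by (metis add_eq_0_iff2 char2_poly_add_self)

lemma char2_power2_add: "(2::'a::comm_ring_1) = 0 \<Longrightarrow> ((x::'a) + y) ^ 2 = x ^ 2 + y ^ 2"
  by (simp add: power2_sum)

lemma char2_power2_inj:
  assumes "(2::'a::idom) = 0" "(x::'a) ^ 2 = y ^ 2" shows "x = y"
proof -
  have "(x + y) ^ 2 = x ^ 2 + x ^ 2" using char2_power2_add[OF assms(1), of x y] assms(2) by simp
  also have "\<dots> = 2 * x ^ 2" by (simp only: mult_2)
  finally have "x + y = 0" using assms(1) by simp
  moreover have "y + y = 2 * y" by (simp only: mult_2)
  ultimately show ?thesis using assms(1) by (metis add_right_cancel mult_zero_left)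
qed

lemma char2_coeff_square:
  assumes "(2::'a::field) = 0"
  shows "coeff (p ^ 2) n = (if even n then coeff (p :: 'a poly) (n div 2) ^ 2 else 0)"
proof (induction p arbitrary: n)
  case (pCons a p)
  have "pCons a p ^ 2 = ([:a:] + [:0, 1:] * p) ^ 2" by simp
  also have "\<dots> = [:a:] ^ 2 + ([:0, 1:] * p) ^ 2" by (rule char2_power2_add[OF char2_poly[OF assms]])
  also have "\<dots> = [:a ^ 2:] + [:0, 0, 1:] * p ^ 2" by (simp add: power2_eq_square)
  finally have "coeff (pCons a p ^ 2) n = coeff ([:a ^ 2:] + pCons 0 (pCons 0 (p ^ 2))) n" by simp
  also have "\<dots> = (if even n then coeff (pCons a p) (n div 2) ^ 2 else 0)"
  proof (cases n)
    case (Suc k)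
    thus ?thesis
    proof (cases k)
      case (Suc j)
      have "Suc (Suc j) div 2 = Suc (j div 2)" by simp
      thus ?thesis using \<open>n = Suc k\<close> Suc pCons.IH[of j] by simp
    qed simp
  qed simp
  finally show ?case .
qed simp

lemma coeff_mult_bounds:
  assumes "\<And>k. k > i \<Longrightarrow> coeff p k = 0" "\<And>k. k > j \<Longrightarrow> coeff q k = 0"
  shows "coeff (p * q) (i + j) = coeff p i * coeff q (j::nat)" "k > i + j \<Longrightarrow> coeff (p * q) k = 0"
proof -
  have "coeff (p * q) (i + j) = (\<Sum>k\<le>i + j. coeff p k * coeff q (i + j - k))" by (rule coeff_mult)
  also have "\<dots> = (\<Sum>k\<in>{i}. coeff p k * coeff q (i + j - k))"
  proof (rule sum.mono_neutral_right)
    show "\<forall>k\<in>{..i + j} - {i}. coeff p k * coeff q (i + j - k) = 0"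
    proof
      fix k assume "k \<in> {..i + j} - {i}"
      thus "coeff p k * coeff q (i + j - k) = 0"
        using assms(1)[of k] assms(2)[of "i + j - k"] by (cases "k < i") auto
    qed
  qed auto
  finally show "coeff (p * q) (i + j) = coeff p i * coeff q j" by simp
  assume k: "k > i + j"
  have "coeff p r * coeff q (k - r) = 0" if "r \<le> k" for r
    using assms(1)[of r] assms(2)[of "k - r"] k that by (cases "r > i") auto
  thus "coeff (p * q) k = 0" unfolding coeff_mult by (intro sum.neutral) auto
qed

text \<open>In characteristic 2 this is the square root of T_(2r+1)(x, z) / x for z = u^4. A fourth
  root of z is taken as parameter because the square root of T contains sqrt z, and splitting that
  root once more as A^2 + x B^2 requires the square root of sqrt z.\<close>

fun dickson_root :: "'a::comm_ring_1 \<Rightarrow> nat \<Rightarrow> 'a poly" where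
  "dickson_root u 0 = 1"
| "dickson_root u (Suc 0) = [:u ^ 2, 1:]"
| "dickson_root u (Suc (Suc n)) = [:0, 1:] * dickson_root u (Suc n) + smult (u ^ 4) (dickson_root u n)"

text \<open>The recurrence within one parity class of indices. Modulo 2 its coefficients are x^2 and
  z^2, so for z = u^4 it is the square of the recurrence that defines
  \<open>dickson_root\<close>.\<close>

lemma dickson_step2:
  "dickson z (n + 4) = [:- 2 * z, 0, 1:] * dickson z (n + 2) - smult (z ^ 2) (dickson z n)"
proof -
  define y where "y = [:z:]"
  define x where "x = [:0, 1 :: 'a:]"
  define p where "p = dickson z n"
  define q where "q = dickson z (n + 1)"
  have rec: "dickson z (k + 2) = x * dickson z (k + 1) - y * dickson z k" for k
    unfolding dickson_Suc_Suc by (simp add: x_def y_def)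
  have 2: "dickson z (n + 2) = x * q - y * p" unfolding rec p_def q_def ..
  have "dickson z (n + 1 + 2) = x * dickson z (n + 1 + 1) - y * q" unfolding rec q_def ..
  hence 3: "dickson z (n + 3) = x * (x * q - y * p) - y * q" using 2 by (simp add: numeral_eq_Suc del: dickson.simps)
  have "dickson z (n + 2 + 2) = x * dickson z (n + 2 + 1) - y * dickson z (n + 2)" by (rule rec)
  hence "dickson z (n + 4) = x * (x * (x * q - y * p) - y * q) - y * (x * q - y * p)"
    using 2 3 by (simp add: numeral_eq_Suc del: dickson.simps)
  also have "\<dots> = (x * x - 2 * y) * (x * q - y * p) - y ^ 2 * p"
    by (simp add: algebra_simps power2_eq_square)
  also have "x * x - 2 * y = [:- 2 * z, 0, 1:]" by (simp add: x_def y_def numeral_poly)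
  also have "y ^ 2 * p = smult (z ^ 2) p" by (simp add: y_def power2_eq_square)
  finally show ?thesis unfolding 2 p_def .
qed

lemma char2_dickson_odd:
  assumes two: "(2::'a::field) = 0"
  shows "dickson (u ^ 4) (2 * r + 1) = [:0, 1:] * dickson_root u r ^ 2"
    and "poly (dickson_root u r) 0 = (u::'a) ^ (2 * r)"
proof (induction r rule: induct_nat_012)
  case 1
  {
    case 1
    have "(3::'a) = 1" using two by (metis add.right_neutral numeral_plus_one semiring_norm(5) one_plus_numeral add.commute)
    thus ?case using char2_power2_add[OF char2_poly[OF two], of "[:u^2:]" "[:0, 1:]"] two
      by (simp add: numeral_eq_Suc char2_minus power2_eq_square algebra_simps)
  next
    case 2 show ?case by simp
  }
next
  case (ge2 r)
  {
    case 1
    have "dickson (u ^ 4) (2 * Suc (Suc r) + 1) = dickson (u ^ 4) (2 * r + 1 + 4)" by (simp add: numeral_eq_Suc)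
    also have "\<dots> = [:0, 0, 1:] * dickson (u ^ 4) (2 * Suc r + 1) + smult ((u ^ 4) ^ 2) (dickson (u ^ 4) (2 * r + 1))"
      unfolding dickson_step2[of _ "2 * r + 1"] using two char2_poly_minus[OF two]
      by (simp add: diff_conv_add_uminus del: add_uminus_conv_diff dickson.simps)
    also have "\<dots> = [:0, 1:] * (([:0, 1:] * dickson_root u (Suc r)) ^ 2 + (smult (u ^ 4) (dickson_root u r)) ^ 2)"
      unfolding ge2 by (simp add: power2_eq_square algebra_simps)
    also have "\<dots> = [:0, 1:] * dickson_root u (Suc (Suc r)) ^ 2"
      using char2_power2_add[OF char2_poly[OF two]] by simp
    finally show ?case .
  next
    case 2
    show ?case using ge2 by (simp add: power_add numeral_eq_Suc)
  }
qed simp_all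

lemma char2_coeff_form:
  assumes "(2::'a::field) = 0"
  shows "coeff (A ^ 2 + [:0, 1:] * B ^ 2) n =
         (if even n then coeff A (n div 2) ^ 2 else coeff (B :: 'a poly) (n div 2) ^ 2)"
  by (cases n) (auto simp: char2_coeff_square[OF assms])

lemma degree_lead_eqI:
  assumes "coeff p n = 1" "\<And>k. k > n \<Longrightarrow> coeff p k = 0"
  shows "degree p = n" "lead_coeff p = (1::'a::field)"
proof -
  show "degree p = n" using assms by (intro antisym degree_le le_degree) auto
  thus "lead_coeff p = 1" using assms by simp
qed

lemma char2_unscale:
  assumes "u \<noteq> 0" "smult (u ^ 2) q = [:k:]" shows "q = [:k / u ^ 2 :: 'a::field:]"
proof -
  have "smult (u ^ 2) q = smult (u ^ 2) [:k / u ^ 2:]" using assms by simp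
  thus ?thesis using assms(1) by (metis power_not_zero smult_cancel)
qed

text \<open>Both roots of the quadratic form u (A^2 + x B^2) + x A B in one of the variables are polynomials;
  replacing the larger root by the smaller one lowers the degree by one (Vieta descent).\<close>

lemma char2_descent_even:
  fixes A B :: "'a::field poly"
  assumes two: "(2::'a) = 0" and u: "u \<noteq> 0"
    and eq: "smult u (A ^ 2 + [:0, 1:] * B ^ 2) + [:0, 1:] * A * B = [:k:]"
    and deg: "degree (A ^ 2 + [:0, 1:] * B ^ 2) = 2 * q + 2" and lc: "lead_coeff (A ^ 2 + [:0, 1:] * B ^ 2) = 1"
  obtains A' B' where "A = smult u A' + [:0, 1:] * B'" "B = smult u B'"
    "smult u (A' ^ 2 + [:0, 1:] * B' ^ 2) + [:0, 1:] * A' * B' = [:k / u ^ 2:]"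
    "degree (A' ^ 2 + [:0, 1:] * B' ^ 2) = 2 * q + 1" "lead_coeff (A' ^ 2 + [:0, 1:] * B' ^ 2) = 1"
proof -
  note form = char2_coeff_form[OF two]
  have A0: "coeff A i = 0" if "i > q + 1" for i
  proof -
    have "coeff (A ^ 2 + [:0, 1:] * B ^ 2) (2 * i) = 0" using that deg by (intro coeff_eq_0) simp
    thus ?thesis unfolding form by simp
  qed
  have B0: "coeff B i = 0" if "i > q" for i
  proof -
    have "coeff (A ^ 2 + [:0, 1:] * B ^ 2) (2 * i + 1) = 0" using that deg by (intro coeff_eq_0) simp
    thus ?thesis unfolding form by simp
  qed
  have "coeff A (q + 1) ^ 2 = 1 ^ 2"
    using lc unfolding deg form by simp
  hence Aq: "coeff A (q + 1) = 1" by (rule char2_power2_inj[OF two])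
  have "coeff (smult u (A ^ 2 + [:0, 1:] * B ^ 2) + [:0, 1:] * A * B) (2 * q + 2) = 0" unfolding eq by simp
  hence "u * coeff (A ^ 2 + [:0, 1:] * B ^ 2) (2 * q + 2) + coeff (A * B) (2 * q + 1) = 0" by simp
  moreover have "coeff (A * B) (2 * q + 1) = coeff B q"
    using coeff_mult_bounds(1)[of "q + 1" A q B] A0 B0 Aq by (simp add: mult_2)
  ultimately have "u + coeff B q = 0" using lc unfolding deg by simp
  hence Bq: "coeff B q = u" using char2_minus[OF two] by (metis add_eq_0_iff)
  \<comment> \<open>As a quadratic equation in A, the hypothesis has the second root A + x B / u.
    Dividing both variables by u makes the new form monic and divides k by u^2.\<close>
  define A' where "A' = smult (1 / u) (A + smult (1 / u) ([:0, 1:] * B))"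
  define B' where "B' = smult (1 / u) B"
  have BB: "B = smult u B'" using u by (simp add: B'_def)
  have AA: "A = smult u A' + [:0, 1:] * B'"
    using u char2_poly_add_self[OF two, of "[:0, 1:] * B'"] by (simp add: A'_def B'_def add.assoc)
  have A'0: "coeff A' i = 0" if "i > q" for i
  proof (cases "i = q + 1")
    case True
    thus ?thesis using Aq Bq u char2_add_self[OF two, of 1] by (simp add: A'_def)
  next
    case False
    with that obtain j where "i = Suc j" "j > q" by (cases i) auto
    thus ?thesis using A0[of i] B0[of j] that False by (simp add: A'_def)
  qed
  have B'0: "coeff B' i = 0" if "i > q" for i using B0[OF that] by (simp add: B'_def)
  have B'q: "coeff B' q = 1" using Bq u by (simp add: B'_def)
  define x where "x = [:0, 1 :: 'a:]"
  define v where "v = [:u:]"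
  \<comment> \<open>The multiple of 2 is kept on the right, so that the identity holds in every
    commutative ring and is a matter of normalisation; only afterwards is the characteristic
    used.\<close>
  have ring: "v * ((v * a + x * b) ^ 2 + x * (v * b) ^ 2) + x * (v * a + x * b) * (v * b) =
       v ^ 2 * (v * (a ^ 2 + x * b ^ 2) + x * a * b) + 2 * (v ^ 2 * x * a * b + v * x ^ 2 * b ^ 2)"
    for a b by (simp add: power2_eq_square algebra_simps)
  have "smult (u ^ 2) (smult u (A' ^ 2 + [:0, 1:] * B' ^ 2) + [:0, 1:] * A' * B') = [:k:]"
    using eq ring[of A' B'] char2_poly[OF two] unfolding AA BB
    by (simp add: x_def v_def power2_eq_square)
  hence eq': "smult u (A' ^ 2 + [:0, 1:] * B' ^ 2) + [:0, 1:] * A' * B' = [:k / u ^ 2:]"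
    by (rule char2_unscale[OF u])
  have "coeff (A' ^ 2 + [:0, 1:] * B' ^ 2) (2 * q + 1) = 1" unfolding form using B'q by simp
  moreover have "coeff (A' ^ 2 + [:0, 1:] * B' ^ 2) j = 0" if "j > 2 * q + 1" for j
    unfolding form using A'0[of "j div 2"] B'0[of "j div 2"] that by (auto elim!: evenE oddE)
  ultimately show thesis using that[OF AA BB eq'] degree_lead_eqI by blast
qed

text \<open>The same exchange of roots, this time in B, whose second root is B + A / u. Each
  exchange changes the parity of the degree, so the two versions alternate.\<close>

lemma char2_descent_odd:
  fixes A B :: "'a::field poly"
  assumes two: "(2::'a) = 0" and u: "u \<noteq> 0"
    and eq: "smult u (A ^ 2 + [:0, 1:] * B ^ 2) + [:0, 1:] * A * B = [:k:]"
    and deg: "degree (A ^ 2 + [:0, 1:] * B ^ 2) = 2 * q + 1" and lc: "lead_coeff (A ^ 2 + [:0, 1:] * B ^ 2) = 1"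
  obtains A' B' where "A = smult u A'" "B = smult u B' + A'"
    "smult u (A' ^ 2 + [:0, 1:] * B' ^ 2) + [:0, 1:] * A' * B' = [:k / u ^ 2:]"
    "degree (A' ^ 2 + [:0, 1:] * B' ^ 2) = 2 * q" "lead_coeff (A' ^ 2 + [:0, 1:] * B' ^ 2) = 1"
proof -
  note form = char2_coeff_form[OF two]
  have A0: "coeff A i = 0" if "i > q" for i
  proof -
    have "coeff (A ^ 2 + [:0, 1:] * B ^ 2) (2 * i) = 0" using that deg by (intro coeff_eq_0) simp
    thus ?thesis unfolding form by simp
  qed
  have B0: "coeff B i = 0" if "i > q" for i
  proof -
    have "coeff (A ^ 2 + [:0, 1:] * B ^ 2) (2 * i + 1) = 0" using that deg by (intro coeff_eq_0) simp
    thus ?thesis unfolding form by simp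
  qed
  have "coeff B q ^ 2 = 1 ^ 2"
    using lc unfolding deg form by simp
  hence Bq: "coeff B q = 1" by (rule char2_power2_inj[OF two])
  have "coeff (smult u (A ^ 2 + [:0, 1:] * B ^ 2) + [:0, 1:] * A * B) (2 * q + 1) = 0" unfolding eq by simp
  hence "u * coeff (A ^ 2 + [:0, 1:] * B ^ 2) (2 * q + 1) + coeff (A * B) (2 * q) = 0" by simp
  moreover have "coeff (A * B) (2 * q) = coeff A q"
    using coeff_mult_bounds(1)[of q A q B] A0 B0 Bq by (simp add: mult_2)
  ultimately have "u + coeff A q = 0" using lc unfolding deg by simp
  hence Aq: "coeff A q = u" using char2_minus[OF two] by (metis add_eq_0_iff)
  define A' where "A' = smult (1 / u) A"
  define B' where "B' = smult (1 / u) (B + smult (1 / u) A)"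
  have AA: "A = smult u A'" using u by (simp add: A'_def)
  have BB: "B = smult u B' + A'"
    using u char2_poly_add_self[OF two, of "A'"] by (simp add: A'_def B'_def add.assoc)
  have B'0: "coeff B' i = 0" if "i \<ge> q" for i
    using A0[of i] B0[of i] Aq Bq u char2_add_self[OF two, of 1] that
    by (cases "i = q") (simp_all add: B'_def)
  have A'0: "coeff A' i = 0" if "i > q" for i using A0[OF that] by (simp add: A'_def)
  have A'q: "coeff A' q = 1" using Aq u by (simp add: A'_def)
  define x where "x = [:0, 1 :: 'a:]"
  define v where "v = [:u:]"
  have ring: "v * ((v * a) ^ 2 + x * (v * b + a) ^ 2) + x * (v * a) * (v * b + a) =
       v ^ 2 * (v * (a ^ 2 + x * b ^ 2) + x * a * b) + 2 * (v ^ 2 * x * a * b + v * x * a ^ 2)"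
    for a b by (simp add: power2_eq_square algebra_simps)
  have "smult (u ^ 2) (smult u (A' ^ 2 + [:0, 1:] * B' ^ 2) + [:0, 1:] * A' * B') = [:k:]"
    using eq ring[of A' B'] char2_poly[OF two] unfolding AA BB
    by (simp add: x_def v_def power2_eq_square)
  hence eq': "smult u (A' ^ 2 + [:0, 1:] * B' ^ 2) + [:0, 1:] * A' * B' = [:k / u ^ 2:]"
    by (rule char2_unscale[OF u])
  have "coeff (A' ^ 2 + [:0, 1:] * B' ^ 2) (2 * q) = 1" unfolding form using A'q by simp
  moreover have "coeff (A' ^ 2 + [:0, 1:] * B' ^ 2) j = 0" if "j > 2 * q" for j
    unfolding form using A'0[of "j div 2"] B'0[of "j div 2"] that by (auto elim!: evenE oddE)
  ultimately show thesis using that[OF AA BB eq'] degree_lead_eqI by blast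
qed

text \<open>Two consecutive descents connect the forms P = A^2 + x B^2 of degrees r, r - 1 and r -
  2. Expressed through the innermost A and B they satisfy P_r = x P_(r-1) + u^4 P_(r-2), the
  recurrence of \<open>dickson_root\<close>.\<close>

lemma char2_pell:
  fixes A B :: "'a::field poly"
  assumes two: "(2::'a) = 0" and u: "u \<noteq> 0"
    and "smult u (A ^ 2 + [:0, 1:] * B ^ 2) + [:0, 1:] * A * B = [:k:]"
    and "degree (A ^ 2 + [:0, 1:] * B ^ 2) = r" and "lead_coeff (A ^ 2 + [:0, 1:] * B ^ 2) = 1"
  shows "A ^ 2 + [:0, 1:] * B ^ 2 = dickson_root u r"
  using assms(3-5)
proof (induction r arbitrary: A B k rule: less_induct)
  case (less r)
  have monic_const: "p = 1" if "degree p = 0" "lead_coeff p = 1" for p :: "'a poly"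
  proof -
    from that(1) obtain d where "p = [:d:]" by (rule degree_eq_zeroE)
    thus ?thesis using that(2) by (simp add: one_pCons)
  qed
  define x where "x = [:0, 1 :: 'a:]"
  define v where "v = [:u:]"
  have v: "smult u p = v * p" "smult (u ^ 4) p = v ^ 4 * p" for p by (simp_all add: v_def numeral_eq_Suc mult_ac)
  consider "r = 0" | "r = 1" | q where "r = 2 * q + 2" | q where "r = 2 * q + 3"
  proof (cases "r < 2")
    case True thus thesis using that(1,2) by (cases "r = 0") auto
  next
    case False
    then obtain j where "r = j + 2" by (metis add.commute le_Suc_ex not_less)
    thus thesis using that(3,4) by (cases "even j") (auto elim!: evenE oddE)
  qed
  thus ?case
  proof cases
    case 1
    thus ?thesis using monic_const less.prems by simp
  next
    case 2
    then obtain A' B' where AB: "A = smult u A'" "B = smult u B' + A'"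
      "degree (A' ^ 2 + [:0, 1:] * B' ^ 2) = 2 * 0" "lead_coeff (A' ^ 2 + [:0, 1:] * B' ^ 2) = 1"
      using char2_descent_odd[OF two u less.prems(1), of 0] less.prems by (metis add.left_neutral mult_zero_right)
    have P1: "A' ^ 2 + [:0, 1:] * B' ^ 2 = 1" using monic_const AB(3,4) by simp
    have "coeff B' i ^ 2 = 0" for i
      using char2_coeff_form[OF two, of A' B' "2 * i + 1"] unfolding P1 by simp
    hence B0: "B' = 0" by (intro poly_eqI) simp
    hence "A' ^ 2 = 1" using P1 by simp
    thus ?thesis using 2 AB B0 by (simp add: smult_power)
  next
    case (3 q)
    obtain A1 B1 where 1: "A = smult u A1 + [:0, 1:] * B1" "B = smult u B1"
      "smult u (A1 ^ 2 + [:0, 1:] * B1 ^ 2) + [:0, 1:] * A1 * B1 = [:k / u ^ 2:]"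
      "degree (A1 ^ 2 + [:0, 1:] * B1 ^ 2) = 2 * q + 1" "lead_coeff (A1 ^ 2 + [:0, 1:] * B1 ^ 2) = 1"
      using char2_descent_even[OF two u less.prems(1)] less.prems 3 by metis
    obtain A2 B2 where 2: "A1 = smult u A2" "B1 = smult u B2 + A2"
      "smult u (A2 ^ 2 + [:0, 1:] * B2 ^ 2) + [:0, 1:] * A2 * B2 = [:k / u ^ 2 / u ^ 2:]"
      "degree (A2 ^ 2 + [:0, 1:] * B2 ^ 2) = 2 * q" "lead_coeff (A2 ^ 2 + [:0, 1:] * B2 ^ 2) = 1"
      using char2_descent_odd[OF two u 1(3)] 1(4,5) by metis
    have IH: "A1 ^ 2 + [:0, 1:] * B1 ^ 2 = dickson_root u (2 * q + 1)"
      "A2 ^ 2 + [:0, 1:] * B2 ^ 2 = dickson_root u (2 * q)"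
      using less.IH[OF _ 1(3-5)] less.IH[OF _ 2(3-5)] 3 by auto
    have ring: "(v * (v * a) + x * (v * b + a)) ^ 2 + x * (v * (v * b + a)) ^ 2 =
        x * ((v * a) ^ 2 + x * (v * b + a) ^ 2) + v ^ 4 * (a ^ 2 + x * b ^ 2) +
        2 * (v ^ 2 * a * x * (v * b + a) + x * v ^ 3 * a * b)" for a b
      by (simp add: power2_eq_square power3_eq_cube power4_eq_xxxx algebra_simps)
    have "A ^ 2 + [:0, 1:] * B ^ 2 = [:0, 1:] * (A1 ^ 2 + [:0, 1:] * B1 ^ 2) +
        smult (u ^ 4) (A2 ^ 2 + [:0, 1:] * B2 ^ 2)"
      using ring[of A2 B2] char2_poly[OF two] unfolding 1(1,2) 2(1,2) v x_def by simp
    thus ?thesis unfolding IH using 3 by simp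
  next
    case (4 q)
    have d: "degree (A ^ 2 + [:0, 1:] * B ^ 2) = 2 * (q + 1) + 1" using less.prems 4 by simp
    obtain A1 B1 where 1: "A = smult u A1" "B = smult u B1 + A1"
      "smult u (A1 ^ 2 + [:0, 1:] * B1 ^ 2) + [:0, 1:] * A1 * B1 = [:k / u ^ 2:]"
      "degree (A1 ^ 2 + [:0, 1:] * B1 ^ 2) = 2 * (q + 1)" "lead_coeff (A1 ^ 2 + [:0, 1:] * B1 ^ 2) = 1"
      using char2_descent_odd[OF two u less.prems(1) d less.prems(3)] by metis
    have d1: "degree (A1 ^ 2 + [:0, 1:] * B1 ^ 2) = 2 * q + 2" using 1(4) by simp
    obtain A2 B2 where 2: "A1 = smult u A2 + [:0, 1:] * B2" "B1 = smult u B2"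
      "smult u (A2 ^ 2 + [:0, 1:] * B2 ^ 2) + [:0, 1:] * A2 * B2 = [:k / u ^ 2 / u ^ 2:]"
      "degree (A2 ^ 2 + [:0, 1:] * B2 ^ 2) = 2 * q + 1" "lead_coeff (A2 ^ 2 + [:0, 1:] * B2 ^ 2) = 1"
      using char2_descent_even[OF two u 1(3) d1 1(5)] by metis
    have IH: "A1 ^ 2 + [:0, 1:] * B1 ^ 2 = dickson_root u (2 * q + 2)"
      "A2 ^ 2 + [:0, 1:] * B2 ^ 2 = dickson_root u (2 * q + 1)"
      using less.IH[OF _ 1(3) d1 1(5)] less.IH[OF _ 2(3-5)] 4 by auto
    have ring: "(v * (v * a + x * b)) ^ 2 + x * (v * (v * b) + (v * a + x * b)) ^ 2 =
        x * ((v * a + x * b) ^ 2 + x * (v * b) ^ 2) + v ^ 4 * (a ^ 2 + x * b ^ 2) +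
        2 * (v ^ 3 * x * a * b + x * v * (v * a + x * b) * (v * b))" for a b
      by (simp add: power2_eq_square power3_eq_cube power4_eq_xxxx algebra_simps)
    have "A ^ 2 + [:0, 1:] * B ^ 2 = [:0, 1:] * (A1 ^ 2 + [:0, 1:] * B1 ^ 2) +
        smult (u ^ 4) (A2 ^ 2 + [:0, 1:] * B2 ^ 2)"
      using ring[of A2 B2] char2_poly[OF two] unfolding 1(1,2) 2(1,2) v x_def by simp
    moreover have "r = Suc (Suc (2 * q + 1))" using 4 by simp
    ultimately show ?thesis unfolding IH by simp
  qed
qed

lemma char2_even_odd_parts:
  fixes P :: "'a::alg_closed_field poly"
  assumes two: "(2::'a) = 0"
  obtains A B where "P = A ^ 2 + [:0, 1:] * B ^ 2"
proof -
  have "\<exists>s. \<forall>c::'a. s c ^ 2 = c" using nth_root_exists[of 2] by (metis zero_less_numeral)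
  then obtain s where s: "\<And>c::'a. s c ^ 2 = c" by blast
  have s0: "s 0 = 0" using s[of 0] by simp
  define A where "A = (\<Sum>i\<le>degree P. monom (s (coeff P (2 * i))) i)"
  define B where "B = (\<Sum>i\<le>degree P. monom (s (coeff P (2 * i + 1))) i)"
  have "coeff A i = s (coeff P (2 * i))" for i
    using s0 coeff_eq_0[of P "2 * i"] by (cases "i \<le> degree P") (auto simp: A_def coeff_sum)
  moreover have "coeff B i = s (coeff P (2 * i + 1))" for i
    using s0 coeff_eq_0[of P "2 * i + 1"] by (cases "i \<le> degree P") (auto simp: B_def coeff_sum)
  ultimately have "P = A ^ 2 + [:0, 1:] * B ^ 2"
    by (intro poly_eqI) (simp only: char2_coeff_form[OF two], auto simp: s elim!: evenE oddE)
  thus thesis by (rule that)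
qed

text \<open>Write P = A^2 + x B^2, so that P' = B^2. At a root a this gives A^2 = a B^2, hence (a A
  B)^2 = a^3 P'(a)^2 = k^2, and a A B = k because squaring is injective. So x A B + k vanishes on S
  and, having degree at most the cardinality of S, equals u P for a constant u: the equation of
  \<open>char2_pell\<close>.\<close>

lemma char2_dickson_of_roots:
  fixes S :: "'a::alg_closed_field set"
  assumes two: "(2::'a) = 0" and fin: "finite S" and k: "k \<noteq> 0"
  defines "P \<equiv> (\<Prod>a\<in>S. [:- a, 1:])"
  assumes roots: "\<And>a. a \<in> S \<Longrightarrow> a ^ 3 * poly (pderiv P) a ^ 2 = k ^ 2"
  obtains u where "u \<noteq> 0" "P = dickson_root u (card S)" "u * poly P 0 = k"
proof -
  define r where "r = card S"
  have degP: "degree P = r" unfolding P_def r_def by (subst degree_prod_eq_sum_degree) auto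
  have lcP: "lead_coeff P = 1" unfolding P_def by (simp add: lead_coeff_prod)
  obtain A B where AB: "P = A ^ 2 + [:0, 1:] * B ^ 2" using char2_even_odd_parts[OF two] by blast
  have P': "pderiv P = B ^ 2"
    unfolding AB using char2_poly[OF two] two
    by (simp add: pderiv_add pderiv_mult pderiv_power numeral_eq_Suc pderiv_pCons)
  define D where "D = [:0, 1:] * A * B + [:k:]"
  have D0: "poly D a = 0" if a: "a \<in> S" for a
  proof -
    have "poly P a = 0" using a fin by (auto simp: P_def poly_prod intro!: prod_zero)
    hence 1: "poly A a ^ 2 = a * poly B a ^ 2"
      using char2_minus[OF two] by (simp add: AB add_eq_0_iff)
    have "(a * poly A a * poly B a) ^ 2 = a ^ 2 * poly A a ^ 2 * poly B a ^ 2"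
      by (simp add: power_mult_distrib)
    also have "\<dots> = a ^ 3 * poly (pderiv P) a ^ 2"
      unfolding 1 P' by (simp add: power2_eq_square power3_eq_cube algebra_simps)
    also have "\<dots> = k ^ 2" by (rule roots[OF a])
    finally have "a * poly A a * poly B a = k" by (rule char2_power2_inj[OF two])
    moreover have "poly D a = a * poly A a * poly B a + k" by (simp add: D_def)
    ultimately show ?thesis using char2_add_self[OF two, of k] by simp
  qed
  show thesis
  proof (cases "r = 0")
    case True
    hence "P = 1" using fin by (simp add: P_def r_def)
    thus thesis using that[of k] k True by (simp add: r_def)
  next
    case False
    have form: "coeff P n = (if even n then coeff A (n div 2) ^ 2 else coeff B (n div 2) ^ 2)" for n
      unfolding AB by (rule char2_coeff_form[OF two])
    have degAB: "coeff (A * B) j = 0" if "j \<ge> r" for j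
    proof (cases "even r")
      case True
      then obtain q where q: "r = 2 * q" by blast
      have "coeff A i = 0" if "i > q" for i
        using form[of "2 * i"] coeff_eq_0[of P "2 * i"] degP q that by simp
      moreover have "coeff B i = 0" if "i > q - 1" for i
        using form[of "2 * i + 1"] coeff_eq_0[of P "2 * i + 1"] degP q that False by simp
      ultimately show ?thesis using coeff_mult_bounds(2)[of q A "q - 1" B j] that q False by auto
    next
      case odd: False
      then obtain q where q: "r = 2 * q + 1" by (auto elim: oddE)
      have "coeff A i = 0" if "i > q" for i
        using form[of "2 * i"] coeff_eq_0[of P "2 * i"] degP q that by simp
      moreover have "coeff B i = 0" if "i > q" for i
        using form[of "2 * i + 1"] coeff_eq_0[of P "2 * i + 1"] degP q that by simp
      ultimately show ?thesis using coeff_mult_bounds(2)[of q A q B j] that q by auto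
    qed
    have Dhigh: "coeff D j = 0" if "j > r" for j
      using that degAB by (cases j) (auto simp: D_def coeff_pCons split: nat.splits)
    define u where "u = coeff D r"
    have "D - smult u P = 0"
    proof (rule ccontr)
      assume nz: "D - smult u P \<noteq> 0"
      have "coeff (D - smult u P) j = 0" if "j \<ge> r" for j
        using that Dhigh[of j] degP lcP coeff_eq_0[of P j] by (cases "j = r") (auto simp: u_def)
      hence "degree (D - smult u P) < r"
        using nz by (metis leading_coeff_0_iff not_less)
      moreover have "S \<subseteq> {a. poly (D - smult u P) a = 0}"
        using D0 fin by (auto simp: P_def poly_prod)
      hence "card S \<le> card {a. poly (D - smult u P) a = 0}"
        using poly_roots_finite[OF nz] by (intro card_mono)
      ultimately show False using card_poly_roots_bound[OF nz] by (simp add: r_def)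
    qed
    hence DP: "D = smult u P" by simp
    have u0: "u \<noteq> 0"
    proof
      assume "u = 0"
      hence "poly D 0 = 0" using DP by simp
      thus False using k by (simp add: D_def)
    qed
    have "smult u (A ^ 2 + [:0, 1:] * B ^ 2) + [:0, 1:] * A * B = D + ([:0, 1:] * A * B)"
      unfolding DP AB[symmetric] ..
    also have "\<dots> = [:k:]"
      using char2_poly_add_self[OF two, of "[:0, 1:] * A * B"] by (simp add: D_def add.assoc add.left_commute)
    finally have "A ^ 2 + [:0, 1:] * B ^ 2 = dickson_root u r"
      using char2_pell[OF two u0] degP lcP unfolding AB by blast
    moreover have "u * poly P 0 = k"
      using arg_cong[OF DP, of "\<lambda>p. poly p 0"] by (simp add: D_def)
    ultimately show thesis using that[of u] u0 by (simp add: AB r_def)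
  qed
qed

section \<open>Wild ramification\<close>

text \<open>The compositional inverse of the power series h(t + X) - h(t), that is, the branch
  through t of the inverse of h, shifted to the origin. It is of use only where the derivative of h
  does not vanish.\<close>

definition local_param :: "'a::field poly \<Rightarrow> 'a \<Rightarrow> 'a fps" where
  "local_param h t = fps_inv (fps_of_poly (pcompose h [:t, 1:]) - fps_const (poly h t))"

text \<open>The power series expansion of p at t with respect to the local parameter h - h t.\<close>

definition expand :: "'a::field poly \<Rightarrow> 'a \<Rightarrow> 'a poly \<Rightarrow> 'a fps" where
  "expand h t p = fps_of_poly (pcompose p [:t, 1:]) oo local_param h t"

lemma local_param_0 [simp]: "local_param h t $ 0 = 0"
  by (simp add: local_param_def fps_inv_def)

lemma coeff_shift_0: "coeff (pcompose p [:t, 1:]) 0 = poly p t"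
  by (simp add: poly_pcompose flip: poly_0_coeff_0)

lemma coeff_shift_1: "coeff (pcompose p [:t, 1:]) 1 = poly (pderiv p) (t::'a::field)"
proof -
  have "coeff (pcompose p [:t, 1:]) 1 = poly (pderiv (pcompose p [:t, 1:])) 0"
    by (simp add: coeff_pderiv poly_0_coeff_0)
  also have "\<dots> = poly (pderiv p) t"
    by (simp add: pderiv_pcompose poly_pcompose pderiv_pCons)
  finally show ?thesis .
qed

lemma fps_compose_nth_1: "(a oo b) $ 1 = a $ 1 * b $ 1" for a b :: "'a::comm_ring_1 fps"
  by (simp add: fps_compose_nth)

lemma expand_gen:
  assumes "poly (pderiv h) t \<noteq> 0"
  shows "expand h t h = fps_const (poly h t) + fps_X"
proof -
  define H where "H = fps_of_poly (pcompose h [:t, 1:]) - fps_const (poly h t)"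
  have "H $ 0 = 0" "H $ 1 \<noteq> 0"
    using assms by (simp_all add: H_def coeff_shift_0 coeff_shift_1[simplified])
  hence "H oo fps_inv H = fps_X" by (rule fps_inv_right)
  moreover have "fps_of_poly (pcompose h [:t, 1:]) = fps_const (poly h t) + H" by (simp add: H_def)
  ultimately show ?thesis
    by (simp add: expand_def local_param_def fps_compose_add_distrib flip: H_def)
qed

lemma expand_add: "expand h t (p + q) = expand h t p + expand h t q"
  by (simp add: expand_def pcompose_add fps_of_poly_add fps_compose_add_distrib)

lemma expand_mult: "expand h t (p * q) = expand h t p * expand h t q"
  by (simp add: expand_def pcompose_mult fps_of_poly_mult fps_compose_mult_distrib)

lemma expand_const: "expand h t [:c:] = fps_const c"
  by (simp add: expand_def fps_of_poly_const)

lemma expand_pcompose: "expand h t (pcompose p q) = poly (map_poly fps_const p) (expand h t q)"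
proof (induction p)
  case (pCons a p)
  have "expand h t (pcompose (pCons a p) q) = expand h t ([:a:] + q * pcompose p q)"
    by (simp add: pcompose_pCons)
  thus ?case using pCons by (simp add: expand_add expand_mult expand_const map_poly_pCons)
qed (simp add: expand_const[of _ _ 0, simplified])

lemma expand_nth_0 [simp]: "expand h t p $ 0 = poly p t"
  by (simp add: expand_def coeff_shift_0)

lemma local_param_1:
  assumes "poly (pderiv h) t \<noteq> 0"
  shows "local_param h t $ 1 = 1 / poly (pderiv h) t"
proof -
  have "expand h t h $ 1 = poly (pderiv h) t * local_param h t $ 1"
    by (simp add: expand_def fps_compose_nth_1[simplified] coeff_shift_1[simplified])
  moreover have "expand h t h $ 1 = 1" using expand_gen[OF assms] by simp
  ultimately show ?thesis using assms by (simp add: field_simps)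
qed

lemma expand_nth_1:
  assumes "poly (pderiv h) t \<noteq> 0"
  shows "expand h t p $ 1 = poly (pderiv p) t / poly (pderiv h) t"
  using local_param_1[OF assms]
  by (simp add: expand_def fps_compose_nth_1[simplified] coeff_shift_1[simplified])

lemma expand_nonzero:
  assumes "poly (pderiv h) t \<noteq> 0" "p \<noteq> 0" shows "expand h t p \<noteq> 0"
proof
  assume "expand h t p = 0"
  moreover have "local_param h t \<noteq> 0"
    using local_param_1[OF assms(1)] assms(1) by (metis divide_eq_0_iff fps_zero_nth one_neq_zero)
  ultimately have "fps_of_poly (pcompose p [:t, 1:]) = 0"
    unfolding expand_def by (subst (asm) fps_compose_eq_0_iff) auto
  hence "pcompose p [:t, 1:] = 0" by (metis fps_of_poly_0 fps_of_poly_eq_iff)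
  thus False using assms(2) by (simp add: pcompose_eq_0_iff)
qed

lemma expand_gen_alg:
  assumes "p \<in> gen_alg h k" "expand h s h = expand h t h" "expand h s k = expand h t k"
  shows "expand h s p = expand h t p"
  using assms(1) by induction (simp_all add: assms expand_const expand_add expand_mult)

section \<open>Contact of branches over a wild critical value\<close>

context bidecomp begin

text \<open>If h and hs have equal expansions at s and t, so has every polynomial in h and hs.
  Through the conductor element q this extends to the polynomial x, whose expansion has the point
  itself as constant term.\<close>

lemma expand_inj:
  assumes "poly h s = poly h t" "poly (pderiv h) s \<noteq> 0" "poly (pderiv h) t \<noteq> 0"
    and "expand h s hs = expand h t hs"
  shows "s = t"
proof -
  obtain q where q: "q \<in> gen_alg h hs" "q \<noteq> 0" "[:0, 1:] * q \<in> gen_alg h hs"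
    using gen_alg_conductor[of h hs l m] lc deg cop l_ge l_less by auto
  have hh: "expand h s h = expand h t h" using expand_gen assms by metis
  have "expand h s [:0, 1:] * expand h s q = expand h t [:0, 1:] * expand h t q"
    using expand_gen_alg[OF q(3) hh assms(4)] by (simp only: expand_mult)
  hence "expand h s [:0, 1:] = expand h t [:0, 1:]"
    using expand_gen_alg[OF q(1) hh assms(4)] expand_nonzero[OF assms(3) q(2)] by simp
  hence "expand h s [:0, 1:] $ 0 = expand h t [:0, 1:] $ 0" by simp
  thus ?thesis by simp
qed

text \<open>Over an unramified value x of h the polynomial gs - g x splits into distinct branches, so the
  order of its derivative along one branch counts the contacts with the others.\<close>

lemma branch_derivative:
  assumes unram: "\<And>t. poly h t = x \<Longrightarrow> poly (pderiv h) t \<noteq> 0" and t1: "poly h t1 = x"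
  shows "expand h t1 (pcompose (pderiv gs) hs) =
         (\<Prod>t\<in>{t. poly h t = x} - {t1}. expand h t1 hs - expand h t hs)"
    and "card {t. poly h t = x} = l"
proof -
  define S where "S = {t. poly h t = x}"
  have finS: "finite S" using finite_fibre[OF deg_pos(2)] by (simp add: S_def)
  have ram1: "ram h t = 1" if "t \<in> S" for t
  proof -
    have "Polynomial.order t (pderiv h) = 0" using unram that by (intro order_0I) (auto simp: S_def)
    hence "ram h t \<le> 1" using order_pderiv_ge[OF h', of t] by simp
    thus ?thesis using ram_pos[OF deg_pos(2), of t] by simp
  qed
  have "l = (\<Sum>t\<in>S. ram h t)" using sum_ram[OF deg_pos(2) lc(2), of x] deg by (simp add: S_def)
  also have "\<dots> = card S" using ram1 by simp
  finally have cardS: "card S = l" ..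
  thus "card {t. poly h t = x} = l" by (simp add: S_def)
  define \<phi> where "\<phi> t = expand h t hs" for t
  have inj: "inj_on \<phi> S"
    using expand_inj unram by (auto simp: inj_on_def S_def \<phi>_def)
  define F where "F = map_poly fps_const gs"
  \<comment> \<open>\<gamma> is g(x + X). In the parameter X = h - x all branches of hs over x are
    roots of the same polynomial gs - \<gamma> over the power series, and being l distinct roots
    they factor it completely.\<close>
  define \<gamma> where "\<gamma> = poly (map_poly fps_const g) (fps_const x + fps_X)"
  define G where "G = F - [:\<gamma>:]"
  have degF: "degree F = l" "lead_coeff F = 1"
  proof -
    show d: "degree F = l" unfolding F_def using deg by (subst degree_map_poly) auto
    have "coeff F l = fps_const (coeff gs l)" by (simp add: F_def coeff_map_poly)
    thus "lead_coeff F = 1" using d lc(3) deg by simp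
  qed
  have degG: "degree G = l" "coeff G l = 1"
  proof -
    have "G = [:- \<gamma>:] + F"
      by (simp add: G_def diff_conv_add_uminus add.commute del: add_uminus_conv_diff)
    moreover have "degree ([:- \<gamma>:] + F) = degree F" using degF l_ge by (intro degree_add_eq_right) simp
    ultimately show "degree G = l" using degF by (simp only:)
    show "coeff G l = 1" using degF l_ge by (simp add: G_def coeff_pCons split: nat.splits)
  qed
  have root: "poly G (\<phi> t) = 0" if t: "t \<in> S" for t
  proof -
    have "poly F (\<phi> t) = expand h t (pcompose gs hs)" by (simp add: F_def \<phi>_def expand_pcompose)
    also have "\<dots> = expand h t (pcompose g h)" by (simp add: comp_eq)
    also have "\<dots> = \<gamma>" using t unram expand_gen[of h t] by (simp add: expand_pcompose \<gamma>_def S_def)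
    finally show ?thesis by (simp add: G_def)
  qed
  have prodG: "G = (\<Prod>t\<in>S. [:- \<phi> t, 1:])"
  proof (rule poly_eqI_degree_lead_coeff[where n = l and A = "\<phi> ` S"])
    have dp: "degree (\<Prod>t\<in>S. [:- \<phi> t, 1:]) = l"
      using cardS by (subst degree_prod_eq_sum_degree) auto
    moreover have "lead_coeff (\<Prod>t\<in>S. [:- \<phi> t, 1:]) = 1" by (simp add: lead_coeff_prod)
    ultimately show "coeff G l = coeff (\<Prod>t\<in>S. [:- \<phi> t, 1:]) l" using degG by simp
    show "degree (\<Prod>t\<in>S. [:- \<phi> t, 1:]) \<le> l" using dp by simp
    show "l \<le> card (\<phi> ` S)" using cardS inj by (simp add: card_image)
    show "poly G z = poly (\<Prod>t\<in>S. [:- \<phi> t, 1:]) z" if "z \<in> \<phi> ` S" for z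
      using that root finS by (auto simp: poly_prod intro!: prod_zero[symmetric])
  qed (use degG in simp)
  have t1S: "t1 \<in> S" using t1 by (simp add: S_def)
  define R where "R = (\<Prod>t\<in>S - {t1}. [:- \<phi> t, 1:])"
  have "G = [:- \<phi> t1, 1:] * R" using prodG t1S finS by (simp add: R_def prod.remove)
  hence "poly (pderiv G) (\<phi> t1) = poly R (\<phi> t1)"
    by (simp add: pderiv_mult pderiv_pCons del: mult_pCons_left)
  also have "\<dots> = (\<Prod>t\<in>S - {t1}. \<phi> t1 - \<phi> t)" by (simp add: R_def poly_prod)
  also have "pderiv G = map_poly fps_const (pderiv gs)"
    by (rule poly_eqI) (simp add: G_def F_def pderiv_diff pderiv_pCons coeff_pderiv coeff_map_poly fps_of_nat flip: fps_of_nat fps_const_mult)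
  finally show "expand h t1 (pcompose (pderiv gs) hs) =
         (\<Prod>t\<in>{t. poly h t = x} - {t1}. expand h t1 hs - expand h t hs)"
    by (simp add: expand_pcompose \<phi>_def S_def)
qed

text \<open>Above (x, y) there are L points, so L branches of hs pass through y. The quotient of the
  identity and its derivative shows that they all have the same slope, so any two of them have
  contact at least 2. The derivative of gs along one branch therefore vanishes to order at least 2
  (L - 1); on the other hand this order is L, because \<beta> = L and the branch has nonzero
  slope.\<close>

lemma wild_contact:
  assumes xy: "poly g x = poly gs y" and a: "ram g x = L" and b: "ram gs y = L"
    and \<beta>: "Polynomial.order y (pderiv gs) = L"
    and unram: "\<And>t. poly h t = x \<Longrightarrow> poly (pderiv h) t \<noteq> 0"
  shows "L \<le> 2"
proof -
  define T where "T = Ts x y"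
  have L0: "0 < L" using ram_pos[OF deg_pos(1), of x] a by simp
  have e1: "ram h t = 1" if "t \<in> T" for t
  proof -
    have "Polynomial.order t (pderiv h) = 0" using unram that by (intro order_0I) (auto simp: T_def Ts_def)
    hence "ram h t \<le> 1" using order_pderiv_ge[OF h', of t] by simp
    thus ?thesis using ram_pos[OF deg_pos(2), of t] by simp
  qed
  have es1: "ram hs t = 1" if t: "t \<in> T" for t
    using ram_rel[of t] e1[OF t] t a b L0 by (simp add: T_def Ts_def)
  have cardT: "card T = L" using sum_e[OF xy] e1 b by (simp add: T_def)
  have \<alpha>: "Polynomial.order x (pderiv g) = L"
  proof -
    obtain t where t: "t \<in> T" using cardT L0 by fastforce
    have "Polynomial.order t (pderiv h) = 0" using unram t by (intro order_0I) (auto simp: T_def Ts_def)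
    moreover have "Polynomial.order t (pderiv hs) = 0"
      using order_pderiv_eq[OF hs', of t] es1[OF t] by simp
    ultimately show ?thesis using order_rel[of t] t e1[OF t] es1[OF t] \<beta> by (simp add: T_def Ts_def)
  qed
  obtain gu where gu: "g - [:poly g x:] = [:-x, 1:] ^ L * gu" "\<not> [:-x, 1:] dvd gu"
    using order_decomp[OF diff_const_nz[OF deg_pos(1)]] a unfolding ram_def by metis
  obtain gv where gv: "gs - [:poly gs y:] = [:-y, 1:] ^ L * gv" "\<not> [:-y, 1:] dvd gv"
    using order_decomp[OF diff_const_nz[OF deg_pos(3)]] b unfolding ram_def by metis
  obtain u where u: "pderiv g = [:-x, 1:] ^ L * u" "\<not> [:-x, 1:] dvd u"
    using order_decomp[OF g', of x] \<alpha> by metis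
  obtain v where v: "pderiv gs = [:-y, 1:] ^ L * v" "\<not> [:-y, 1:] dvd v"
    using order_decomp[OF gs', of y] \<beta> by metis
  have nz: "poly gu x \<noteq> 0" "poly gv y \<noteq> 0" "poly u x \<noteq> 0" "poly v y \<noteq> 0"
    using gu(2) gv(2) u(2) v(2) by (simp_all add: poly_eq_0_iff_dvd)
  have lin: "pcompose [:-c, 1:] p = p - [:c:]" for c and p :: "'a poly" by (simp add: pcompose_pCons)
  have powc: "pcompose (p ^ n) q = (pcompose p q) ^ n" for p q :: "'a poly" and n
    by (induction n) (simp_all add: pcompose_mult pcompose_1)
  have E1: "(h - [:x:]) ^ L * pcompose gu h = (hs - [:y:]) ^ L * pcompose gv hs"
  proof -
    have "pcompose (g - [:poly g x:]) h = pcompose (gs - [:poly gs y:]) hs"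
      using comp_eq xy by (simp add: pcompose_diff)
    thus ?thesis unfolding gu(1) gv(1) by (simp only: pcompose_mult powc lin)
  qed
  have E2: "(h - [:x:]) ^ L * pcompose u h * pderiv h = (hs - [:y:]) ^ L * pcompose v hs * pderiv hs"
    using chain unfolding u(1) v(1) by (simp only: pcompose_mult powc lin)
  have E0: "(h - [:x:]) ^ L * (hs - [:y:]) ^ L \<noteq> 0"
    using diff_const_nz[OF deg_pos(2)] diff_const_nz[OF deg_pos(4)] by (simp only: mult_eq_0_iff power_eq_0_iff) blast
  have "((h - [:x:]) ^ L * (hs - [:y:]) ^ L) * (pcompose gu h * pcompose v hs * pderiv hs) =
        ((h - [:x:]) ^ L * pcompose gu h) * ((hs - [:y:]) ^ L * pcompose v hs * pderiv hs)"
    by (simp only: mult_ac)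
  also have "\<dots> = ((h - [:x:]) ^ L * (hs - [:y:]) ^ L) * (pcompose gv hs * pcompose u h * pderiv h)"
    unfolding E1 E2[symmetric] by (simp only: mult_ac)
  \<comment> \<open>Because the derivative orders equal the indices, the powers of h - x and hs - y
    cancel completely. At a point t above (x, y) what is left prescribes the quotient of the
    derivatives of hs and h in terms of x and y only.\<close>
  finally have E3: "pcompose gu h * pcompose v hs * pderiv hs = pcompose gv hs * pcompose u h * pderiv h"
    using E0 mult_left_cancel by blast
  define sl where "sl = poly gv y * poly u x / (poly gu x * poly v y)"
  have slope: "poly (pderiv hs) t / poly (pderiv h) t = sl" if t: "t \<in> T" for t
  proof -
    have tt: "poly h t = x" "poly hs t = y" using t by (auto simp: T_def Ts_def)
    have "poly gu x * poly v y * poly (pderiv hs) t = poly gv y * poly u x * poly (pderiv h) t"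
      using arg_cong[OF E3, of "\<lambda>p. poly p t"] tt by (simp add: poly_pcompose)
    thus ?thesis using nz unram[OF tt(1)] by (simp add: sl_def field_simps)
  qed
  obtain t1 where t1: "t1 \<in> T" using cardT L0 by fastforce
  have tt1: "poly h t1 = x" "poly hs t1 = y" using t1 by (auto simp: T_def Ts_def)
  have sl0: "sl \<noteq> 0" using nz by (simp add: sl_def)
  define S where "S = {t. poly h t = x}"
  have finS: "finite S" using finite_fibre[OF deg_pos(2)] by (simp add: S_def)
  have TS: "T \<subseteq> S" by (auto simp: T_def Ts_def S_def)
  have "expand h t1 (pcompose (pderiv gs) hs) =
        (expand h t1 hs - fps_const y) ^ L * expand h t1 (pcompose v hs)"
  proof -
    have "pcompose (pderiv gs) hs = (hs + [:-y:]) ^ L * pcompose v hs"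
    proof -
      have "hs - [:y:] = hs + [:-y:]" by (simp add: diff_conv_add_uminus del: add_uminus_conv_diff)
      thus ?thesis unfolding v(1) by (simp only: pcompose_mult powc lin)
    qed
    moreover have "expand h t1 (p ^ n) = expand h t1 p ^ n" for p n
      by (induction n) (simp_all add: expand_mult expand_const[of _ _ 1, folded one_pCons, simplified])
    moreover have "expand h t1 (hs + [:-y:]) = expand h t1 hs - fps_const y"
      by (simp add: expand_add expand_const)
    ultimately show ?thesis by (simp add: expand_mult)
  qed
  moreover have "subdegree (expand h t1 hs - fps_const y) = 1"
  proof (rule subdegreeI)
    show "(expand h t1 hs - fps_const y) $ 1 \<noteq> 0"
      using expand_nth_1[OF unram[OF tt1(1)], of hs] slope[OF t1] sl0 by simp
  qed (use tt1 in simp)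
  moreover from this have "expand h t1 hs - fps_const y \<noteq> 0" by auto
  moreover have "expand h t1 (pcompose v hs) $ 0 \<noteq> 0" using nz tt1 by (simp add: poly_pcompose)
  moreover from this have "expand h t1 (pcompose v hs) \<noteq> 0" by (metis fps_zero_nth)
  moreover from calculation have "subdegree (expand h t1 (pcompose v hs)) = 0"
    by (simp only: subdegree_eq_0_iff) blast
  ultimately have "L = subdegree (expand h t1 (pcompose (pderiv gs) hs))" by simp
  also have "\<dots> = (\<Sum>t\<in>S - {t1}. subdegree (expand h t1 hs - expand h t hs))"
  proof -
    have "expand h t1 (pcompose (pderiv gs) hs) = (\<Prod>t\<in>S - {t1}. expand h t1 hs - expand h t hs)"
      unfolding S_def by (rule branch_derivative(1)[OF unram tt1(1)])
    moreover have "expand h t1 hs - expand h t hs \<noteq> 0" if "t \<in> S - {t1}" for t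
      using expand_inj[of t1 t] unram tt1 that by (auto simp: S_def)
    ultimately show ?thesis by (simp only:) (rule subdegree_prod)
  qed
  also have "\<dots> \<ge> (\<Sum>t\<in>T - {t1}. subdegree (expand h t1 hs - expand h t hs))"
    using TS finS by (intro sum_mono2) auto
  finally have "(\<Sum>t\<in>T - {t1}. subdegree (expand h t1 hs - expand h t hs)) \<le> L" .
  moreover have "(\<Sum>t\<in>T - {t1}. 2) \<le> (\<Sum>t\<in>T - {t1}. subdegree (expand h t1 hs - expand h t hs))"
  proof (rule sum_mono)
    fix t assume t: "t \<in> T - {t1}"
    have tt: "poly h t = x" "poly hs t = y" using t by (auto simp: T_def Ts_def)
    show "2 \<le> subdegree (expand h t1 hs - expand h t hs)"
    proof (rule subdegree_geI)
      show "expand h t1 hs - expand h t hs \<noteq> 0"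
        using expand_inj[of t1 t] t tt tt1 unram by auto
      fix i :: nat assume "i < 2"
      hence "i = 0 \<or> i = 1" by auto
      thus "(expand h t1 hs - expand h t hs) $ i = 0"
        using tt tt1 t t1 slope expand_nth_1[OF unram[OF tt(1)], of hs] expand_nth_1[OF unram[OF tt1(1)], of hs]
        by auto
    qed
  qed
  ultimately have "2 * card (T - {t1}) \<le> L" by simp
  hence "2 * (L - 1) \<le> L" using t1 cardT finite_subset[OF TS finS] by simp
  thus ?thesis by simp
qed

lemma poly_eqI_ram:
  fixes p q :: "'a poly"
  assumes "0 < degree p" "lead_coeff p = 1" "q \<noteq> 0" "lead_coeff q = 1"
    and "\<And>t. poly p t = c \<Longrightarrow> ram p t = Polynomial.order t q"
    and "\<And>t. poly p t \<noteq> c \<Longrightarrow> poly q t \<noteq> 0"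
  shows "p = q + [:c:]"
proof -
  have "p - [:c:] = q"
  proof (rule poly_eqI_order)
    show "p - [:c:] \<noteq> 0" using diff_const_nz assms(1) by blast
    show "lead_coeff (p - [:c:]) = lead_coeff q" using lead_coeff_diff_const assms by metis
    fix t show "Polynomial.order t (p - [:c:]) = Polynomial.order t q"
    proof (cases "poly p t = c")
      case True thus ?thesis using assms(5)[OF True] by (simp add: ram_def)
    next
      case False thus ?thesis using assms(6)[OF False] by (simp add: order_0I)
    qed
  qed (use assms in simp)
  thus ?thesis by (simp add: diff_eq_eq)
qed

lemma order_prod_linear:
  "finite A \<Longrightarrow> Polynomial.order x (\<Prod>a\<in>A. [:- a, 1:]) = (if x \<in> A then 1 else 0)" for x :: 'a
proof (induction A rule: finite_induct)
  case (insert a A)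
  have "(\<Prod>a\<in>insert a A. [:- a, 1:]) \<noteq> 0"
    using insert(1) by (simp add: prod_zero_iff del: prod.insert)
  moreover have "Polynomial.order x [:- a, 1:] = (if x = a then 1 else 0)"
    using order_power_n_n[of a 1] by (auto intro: order_0I)
  ultimately show ?case using insert by (auto simp: order_mult simp del: mult_pCons_left)
qed simp

lemma eq_linear_square:
  fixes p :: "'a poly"
  assumes p: "0 < degree p" "lead_coeff p = 1" and c: "poly p r = c" "ram p r = 1"
    and 2: "\<And>t. poly p t = c \<Longrightarrow> t \<noteq> r \<Longrightarrow> ram p t = 2"
  shows "p = [:-r, 1:] * (\<Prod>t\<in>{t. poly p t = c} - {r}. [:- t, 1:]) ^ 2 + [:c:]"
proof (rule poly_eqI_ram[OF p])
  define S where "S = {t. poly p t = c} - {r}"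
  have fin: "finite S" using finite_fibre[OF p(1)] by (simp add: S_def)
  have nz: "(\<Prod>t\<in>S. [:- t, 1:]) \<noteq> (0 :: 'a poly)" using fin by (simp add: prod_zero_iff)
  have ordr: "Polynomial.order x [:- r, 1:] = (if x = r then 1 else 0)" for x
    using order_power_n_n[of r 1] by (auto intro: order_0I)
  show "[:-r, 1:] * (\<Prod>t\<in>S. [:- t, 1:]) ^ 2 \<noteq> 0" using nz by (simp del: mult_pCons_left)
  show "lead_coeff ([:-r, 1:] * (\<Prod>t\<in>S. [:- t, 1:]) ^ 2) = 1"
    by (simp only: lead_coeff_mult lead_coeff_power lead_coeff_prod) simp
  show "ram p t = Polynomial.order t ([:-r, 1:] * (\<Prod>t\<in>S. [:- t, 1:]) ^ 2)" if "poly p t = c" for t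
    using that c 2[of t] nz order_prod_linear[OF fin, of t]
    by (auto simp: order_mult order_power ordr S_def simp del: mult_pCons_left)
  show "poly ([:-r, 1:] * (\<Prod>t\<in>S. [:- t, 1:]) ^ 2) t \<noteq> 0" if "poly p t \<noteq> c" for t
    using that c fin by (auto simp: poly_prod S_def)
qed

text \<open>In the wild case the characteristic is 2 and g, h, gs, hs are, up to translations, of the form
  x P^2, t V^2, y W^2 and t S^2.\<close>

lemma wild_caseE:
  assumes c: "c \<in> C" and Bc: "rc.B c = int l - 1"
    and wild: "\<exists>y\<in>Ys c. ram gs y \<le> Polynomial.order y (pderiv gs)"
  obtains z \<tau> x1 where "z \<noteq> 0" "of_nat m \<noteq> (0::'a)"
    "h = pcompose (dickson z l) [:- \<tau>, 1:] + [:x1:]"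
    "g = pcompose (dickson (z ^ l) m) [:- x1, 1:] + [:c:]"
proof -
  define p where "p = CHAR('a)"
  have ch: "of_nat n = (0::'a) \<longleftrightarrow> p dvd n" for n by (simp add: p_def of_nat_eq_0_iff_char_dvd)
  have cX: "poly g x = c" if "x \<in> Xs c" for x using that by (simp add: Xs_def)
  have cY: "poly gs y = c" if "y \<in> Ys c" for y using that by (simp add: Ys_def)
  obtain x1 y1 L where w: "x1 \<in> Xs c" "y1 \<in> Ys c" "Xs c - {x1} \<noteq> {}" "Ys c - {y1} \<noteq> {}"
    "\<forall>x\<in>Xs c - {x1}. ram g x = L" "\<forall>y\<in>Ys c - {y1}. ram gs y = L" "ram g x1 dvd L" "ram gs y1 dvd L"
    "\<not> p dvd ram g x1" "p dvd L" "\<forall>x\<in>Xs c - {x1}. \<forall>y\<in>Ys c. D x y = 0"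
    "\<forall>y\<in>Ys c - {y1}. Polynomial.order y (pderiv gs) = L"
  proof (rule rc.wild_structure[OF c Bc wild, of p])
    show "p dvd ram gs y" if "y \<in> Ys c" "ram gs y \<le> Polynomial.order y (pderiv gs)" for y
      using wild_imp[OF that(2)] by (simp add: ch)
    show "ram gs y \<le> D x y" if "x \<in> Xs c" "y \<in> Ys c" "p dvd ram gs y" "\<not> p dvd ram g x" for x y
      using D_wild[of x y] that cX cY by (simp add: ch)
    show "\<exists>x\<in>Xs c. \<not> p dvd ram g x" using ex_tame[OF c] by (simp add: ch)
  qed (rule that)
  obtain x2 where x2: "x2 \<in> Xs c" "x2 \<noteq> x1" using w(3) by blast
  obtain y2 where y2: "y2 \<in> Ys c" "y2 \<noteq> y1" using w(4) by blast
  have unram: "poly (pderiv h) t \<noteq> 0" if x: "x \<in> Xs c" "x \<noteq> x1" and t: "poly h t = x" for x t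
  proof -
    have "poly hs t \<in> Ys c" using t cX[OF x(1)] ff_eq[of t] by (simp add: Ys_def)
    hence "D x (poly hs t) = 0" using w(11) x by blast
    moreover have "t \<in> Ts x (poly hs t)" using t by (simp add: Ts_def)
    ultimately have "Polynomial.order t (pderiv h) = 0" using finTs by (simp add: D_def)
    thus ?thesis using h' by (simp add: order_root)
  qed
  have "L \<le> 2"
    using wild_contact[of x2 y2 L] x2 y2 w cX cY unram by auto
  moreover have "L \<noteq> 0" using w(5) x2 ram_pos[OF deg_pos(1), of x2] by auto
  moreover have "L \<noteq> 1" using w(10) by (auto simp: p_def)
  ultimately have L2: "L = 2" by linarith
  have two: "(2::'a) = 0" using w(10) ch[of 2] L2 by simp
  have p2: "p dvd 2" using w(10) L2 by simp
  have a1: "ram g x1 = 1"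
  proof -
    have "ram g x1 \<le> 2" using w(7) L2 by (intro dvd_imp_le) auto
    moreover have "ram g x1 \<noteq> 2" using w(9) p2 by auto
    ultimately show ?thesis using ram_pos[OF deg_pos(1), of x1] by simp
  qed
  have suml: "l = ram gs y1 + 2 * card (Ys c - {y1})"
  proof -
    have "l = ram gs y1 + (\<Sum>y\<in>Ys c - {y1}. ram gs y)"
      using rc.sum_b[OF c] w(2) rc.finY[OF c] by (simp add: sum.remove)
    thus ?thesis using w(6) L2 by simp
  qed
  have b1: "ram gs y1 = 1"
  proof -
    have "ram gs y1 \<le> 2" using w(8) L2 by (intro dvd_imp_le) auto
    moreover have "ram gs y1 \<noteq> 2"
    proof
      assume "ram gs y1 = 2"
      hence "l = 2 * Suc (card (Ys c - {y1}))" using suml by simp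
      hence "p dvd l" using p2 dvd_mult2 by blast
      thus False using l_nz ch by blast
    qed
    ultimately show ?thesis using ram_pos[OF deg_pos(3), of y1] by simp
  qed
  have a2: "ram g x = 2" if "poly g x = c" "x \<noteq> x1" for x using w(5) that L2 by (auto simp: Xs_def)
  have b2: "ram gs y = 2" if "poly gs y = c" "y \<noteq> y1" for y using w(6) that L2 by (auto simp: Ys_def)
  have x1c: "poly g x1 = c" and y1c: "poly gs y1 = c" using w(1,2) cX cY by auto
  define SP where "SP = {x. poly g x = c} - {x1}"
  define SW where "SW = {y. poly gs y = c} - {y1}"
  define P where "P = (\<Prod>x\<in>SP. [:- x, 1:])"
  define W where "W = (\<Prod>y\<in>SW. [:- y, 1:])"
  have g_eq: "g = [:- x1, 1:] * P ^ 2 + [:c:]"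
    unfolding P_def SP_def using eq_linear_square[OF deg_pos(1) lc(1) x1c a1 a2] .
  have gs_eq: "gs = [:- y1, 1:] * W ^ 2 + [:c:]"
    unfolding W_def SW_def using eq_linear_square[OF deg_pos(3) lc(3) y1c b1 b2] .
  obtain \<tau> where \<tau>: "Ts x1 y1 = {\<tau>}"
  proof -
    have "(\<Sum>t\<in>Ts x1 y1. ram h t) = 1" using sum_e[of x1 y1] x1c y1c b1 by simp
    then obtain t where t: "t \<in> Ts x1 y1" by fastforce
    hence "Ts x1 y1 = {t}" using unramified_point(4)[of t] a1 by (auto simp: Ts_def)
    thus thesis by (rule that)
  qed
  have \<tau>': "poly h \<tau> = x1" "poly hs \<tau> = y1" using \<tau> by (auto simp: Ts_def)
  have fx: "poly gs (poly hs t) = c" if "poly h t = x1" for t using that x1c ff_eq[of t] by simp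
  have fy: "poly g (poly h t) = c" if "poly hs t = y1" for t using that y1c ff_eq[of t] by simp
  have h1: "ram h \<tau> = 1" using unramified_point(2)[of \<tau>] a1 b1 \<tau>' by simp
  have h2: "ram h t = 2" if t: "poly h t = x1" "t \<noteq> \<tau>" for t
  proof -
    have "poly hs t \<noteq> y1" using \<tau> t by (auto simp: Ts_def)
    thus ?thesis using unramified_point(2)[of t] t a1 b2[OF fx[OF t(1)]] by simp
  qed
  have e1: "ram h t = 1" if t: "poly hs t = y1" for t
  proof -
    have "(\<Sum>t\<in>Ts (poly h t) y1. ram h t) = 1" using sum_e[of "poly h t" y1] fy[OF t] y1c b1 by simp
    moreover have "ram h t \<le> (\<Sum>t\<in>Ts (poly h t) y1. ram h t)"
      using finTs t by (intro member_le_sum) (auto simp: Ts_def)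
    ultimately show ?thesis using ram_pos[OF deg_pos(2), of t] by simp
  qed
  have hs1: "ram hs \<tau> = 1" using unramified_point(1)[of \<tau>] a1 \<tau>' by simp
  have hs2: "ram hs t = 2" if t: "poly hs t = y1" "t \<noteq> \<tau>" for t
  proof -
    have "poly h t \<noteq> x1" using \<tau> t by (auto simp: Ts_def)
    thus ?thesis using ram_rel[of t] e1[OF t(1)] t b1 a2[OF fy[OF t(1)]] by simp
  qed
  define SV where "SV = {t. poly h t = x1} - {\<tau>}"
  define V where "V = (\<Prod>t\<in>SV. [:- t, 1:])"
  define S where "S = (\<Prod>t\<in>{t. poly hs t = y1} - {\<tau>}. [:- t, 1:])"
  have h_eq: "h = [:- \<tau>, 1:] * V ^ 2 + [:x1:]"
    unfolding V_def SV_def using eq_linear_square[OF deg_pos(2) lc(2) \<tau>'(1) h1 h2] .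
  have hs_eq: "hs = [:- \<tau>, 1:] * S ^ 2 + [:y1:]"
    unfolding S_def using eq_linear_square[OF deg_pos(4) lc(4) \<tau>'(2) hs1 hs2] .
  note two' = char2_poly[OF two]
  \<comment> \<open>A square root of the composition identity: without the constant c and the common
    factor t - \<tau> both sides are squares, and in characteristic 2 square roots are
    unique.\<close>
  have VP: "V * pcompose P h = S * pcompose W hs"
  proof (rule char2_power2_inj[OF two'])
    have powc: "pcompose (p ^ 2) q = (pcompose p q) ^ 2" for p q :: "'a poly"
      by (simp add: power2_eq_square pcompose_mult)
    have lin: "pcompose [:-d, 1:] q = q - [:d:]" for d and q :: "'a poly" by (simp add: pcompose_pCons)
    have "pcompose g h = (h - [:x1:]) * (pcompose P h) ^ 2 + [:c:]"
      by (subst g_eq) (simp only: pcompose_add pcompose_mult powc lin pcompose_const)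
    moreover have "pcompose gs hs = (hs - [:y1:]) * (pcompose W hs) ^ 2 + [:c:]"
      by (subst gs_eq) (simp only: pcompose_add pcompose_mult powc lin pcompose_const)
    moreover have "h - [:x1:] = [:- \<tau>, 1:] * V ^ 2" "hs - [:y1:] = [:- \<tau>, 1:] * S ^ 2"
      using h_eq hs_eq by (metis add_diff_cancel_right')+
    ultimately have "[:- \<tau>, 1:] * ((V * pcompose P h) ^ 2) = [:- \<tau>, 1:] * ((S * pcompose W hs) ^ 2)"
      using comp_eq by (simp only: power_mult_distrib mult.assoc add_right_cancel)
    thus "(V * pcompose P h) ^ 2 = (S * pcompose W hs) ^ 2"
      by (metis mult_left_cancel pCons_eq_0_iff zero_neq_one)
  qed
  have pd: "pderiv ([:-r, 1:] * q ^ 2 + [:d:]) = q ^ 2" for r d and q :: "'a poly"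
    using two' by (simp add: pderiv_add pderiv_mult pderiv_pCons power2_eq_square mult_2[symmetric] del: mult_pCons_left)
  have h'_eq: "pderiv h = V ^ 2" by (subst h_eq) (rule pd)
  have hs'_eq: "pderiv hs = S ^ 2" by (subst hs_eq) (rule pd)
  have finS: "finite SP" "finite SW" "finite SV"
    using finite_fibre deg_pos by (simp_all add: SP_def SW_def SV_def)
  have rootP: "poly P x = 0 \<longleftrightarrow> x \<in> SP" for x using finS by (auto simp: P_def poly_prod)
  have rootW: "poly W y = 0 \<longleftrightarrow> y \<in> SW" for y using finS by (auto simp: W_def poly_prod)
  have rootV: "poly V t = 0 \<longleftrightarrow> t \<in> SV" for t using finS by (auto simp: V_def poly_prod)
  have simpleW: "poly (pderiv W) y \<noteq> 0" if "y \<in> SW" for y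
  proof -
    have "W = [:-y, 1:] * (\<Prod>y\<in>SW - {y}. [:- y, 1:])" using that finS by (simp add: W_def prod.remove)
    hence "poly (pderiv W) y = poly (\<Prod>y\<in>SW - {y}. [:- y, 1:]) y"
      by (simp add: pderiv_mult pderiv_pCons del: mult_pCons_left)
    thus ?thesis using finS by (auto simp: poly_prod)
  qed
  have hval: "poly h t - x1 = (t - \<tau>) * poly V t ^ 2" for t
    using arg_cong[OF h_eq, of "\<lambda>p. poly p t"] by (simp add: algebra_simps)
  have hsval: "poly hs t - y1 = (t - \<tau>) * poly S t ^ 2" for t
    using arg_cong[OF hs_eq, of "\<lambda>p. poly p t"] by (simp add: algebra_simps)
  \<comment> \<open>The quantity that \<open>char2_dickson_of_roots\<close> wants to be constant.
    Differentiating \<open>VP\<close> at common preimages shows that it takes the same value for all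
    roots of W, as does its analogue for P; for V the value differs by the factor P(x1)^2.\<close>
  define K where "K y = (y - y1) ^ 3 * poly (pderiv W) y ^ 2" for y
  have KP: "(x - x1) ^ 3 * poly (pderiv P) x ^ 2 = K y" if x: "x \<in> SP" and y: "y \<in> SW" for x y
  proof -
    have xy: "poly g x = poly gs y" using x y by (simp add: SP_def SW_def)
    have "(\<Sum>t\<in>Ts x y. ram h t) \<noteq> 0" using sum_e[OF xy] b2[of y] y by (simp add: SW_def)
    then obtain t where t: "t \<in> Ts x y" by fastforce
    have tt: "poly h t = x" "poly hs t = y" using t by (auto simp: Ts_def)
    have PW: "poly P x = 0" "poly W y = 0" using x y rootP rootW by blast+
    have "poly (pderiv (V * pcompose P h)) t = poly (pderiv (S * pcompose W hs)) t" by (simp only: VP)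
    hence "poly V t * poly (pderiv P) x * poly (pderiv h) t = poly S t * poly (pderiv W) y * poly (pderiv hs) t"
      using PW tt by (simp add: pderiv_mult pderiv_pcompose poly_pcompose mult.assoc)
    hence *: "poly V t ^ 3 * poly (pderiv P) x = poly S t ^ 3 * poly (pderiv W) y"
      unfolding h'_eq hs'_eq by (simp add: power2_eq_square power3_eq_cube algebra_simps)
    have "(x - x1) ^ 3 * poly (pderiv P) x ^ 2 = (t - \<tau>) ^ 3 * (poly V t ^ 3 * poly (pderiv P) x) ^ 2"
      using hval[of t] tt by (simp add: power_mult_distrib power_mult[symmetric] mult.commute mult.left_commute)
    also have "\<dots> = K y"
      unfolding * K_def using hsval[of t] tt by (simp add: power_mult_distrib power_mult[symmetric] mult.commute mult.left_commute)
    finally show ?thesis .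
  qed
  have KV: "poly P x1 ^ 2 * ((t - \<tau>) ^ 3 * poly (pderiv V) t ^ 2) = K (poly hs t)" "poly hs t \<in> SW"
    if t: "t \<in> SV" for t
  proof -
    have ht: "poly h t = x1" using t by (simp add: SV_def)
    have "poly hs t \<noteq> y1" using \<tau> t by (auto simp: Ts_def SV_def)
    thus ySW: "poly hs t \<in> SW" using fx[OF ht] by (simp add: SW_def)
    have "poly (pderiv (V * pcompose P h)) t = poly (pderiv (S * pcompose W hs)) t" by (simp only: VP)
    moreover have "poly V t = 0" using t rootV by blast
    moreover have "poly W (poly hs t) = 0" using ySW rootW by blast
    ultimately have *: "poly (pderiv V) t * poly P x1 = poly S t ^ 3 * poly (pderiv W) (poly hs t)"
      using ht by (simp add: pderiv_mult pderiv_pcompose poly_pcompose hs'_eq power2_eq_square power3_eq_cube algebra_simps)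
    have "poly P x1 ^ 2 * ((t - \<tau>) ^ 3 * poly (pderiv V) t ^ 2) = (t - \<tau>) ^ 3 * (poly (pderiv V) t * poly P x1) ^ 2"
      by (simp add: power_mult_distrib mult_ac)
    also have "\<dots> = K (poly hs t)"
      unfolding * K_def using hsval[of t] by (simp add: power_mult_distrib power_mult[symmetric] mult.commute mult.left_commute)
    finally show "poly P x1 ^ 2 * ((t - \<tau>) ^ 3 * poly (pderiv V) t ^ 2) = K (poly hs t)" .
  qed
  have x2S: "x2 \<in> SP" and y2S: "y2 \<in> SW" using x2 y2 cX cY by (auto simp: SP_def SW_def)
  have Kconst: "K y = K y2" if "y \<in> SW" for y using KP[OF x2S that] KP[OF x2S y2S] by simp
  obtain k where k: "k ^ 2 = K y2" using nth_root_exists[of 2 "K y2"] by auto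
  have "K y2 \<noteq> 0" using simpleW[OF y2S] y2 by (simp add: K_def)
  hence k0: "k \<noteq> 0" using k by auto
  have P1: "poly P x1 \<noteq> 0" using rootP by (simp add: SP_def)
  have shiftprod: "pcompose (\<Prod>a\<in>A. [:- a, 1:]) [:d, 1:] = (\<Prod>a\<in>(\<lambda>a. a - d) ` A. [:- a, 1:])"
    for A :: "'a set" and d
    by (subst prod.reindex) (auto simp: inj_on_def pcompose_prod pcompose_pCons)
  have cardshift: "card ((\<lambda>a. a - d) ` A) = card A" for A :: "'a set" and d
    by (rule card_image) (auto simp: inj_on_def)
  define P0 where "P0 = pcompose P [:x1, 1:]"
  define V0 where "V0 = pcompose V [:\<tau>, 1:]"
  have pdshift: "poly (pderiv (pcompose q [:d, 1:])) (a - d) = poly (pderiv q) a" for q :: "'a poly" and a d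
    by (simp add: pderiv_pcompose poly_pcompose pderiv_pCons)
  have P0p: "P0 = (\<Prod>a\<in>(\<lambda>a. a - x1) ` SP. [:- a, 1:])" by (simp add: P0_def P_def shiftprod)
  have V0p: "V0 = (\<Prod>a\<in>(\<lambda>a. a - \<tau>) ` SV. [:- a, 1:])" by (simp add: V0_def V_def shiftprod)
  obtain u where u: "u \<noteq> 0" "P0 = dickson_root u (card SP)" "u * poly P0 0 = k"
  proof (rule char2_dickson_of_roots[OF two finite_imageI[OF finS(1)] k0, of "\<lambda>a. a - x1"])
    fix a assume "a \<in> (\<lambda>a. a - x1) ` SP"
    then obtain x where x: "x \<in> SP" "a = x - x1" by blast
    show "a ^ 3 * poly (pderiv (\<Prod>a\<in>(\<lambda>a. a - x1) ` SP. [:- a, 1:])) a ^ 2 = k ^ 2"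
      unfolding P0p[symmetric] P0_def x(2) pdshift k using KP[OF x(1) y2S] .
  qed (use that in \<open>simp add: cardshift P0p[symmetric]\<close>)
  have P00: "poly P0 0 = poly P x1" by (simp add: P0_def poly_pcompose)
  \<comment> \<open>By \<open>KV\<close> this u is also the constant that belongs to V. Hence v
    V(\<tau>) = u, and V(\<tau>) = v^(l-1) turns this into u = v^l, the reason why the parameter of
    g is the l-th power of the parameter of h.\<close>
  have uk: "u = k / poly P x1" using u(3) P1 by (simp add: P00 field_simps)
  obtain v where v: "v \<noteq> 0" "V0 = dickson_root v (card SV)" "v * poly V0 0 = u"
  proof (rule char2_dickson_of_roots[OF two finite_imageI[OF finS(3)] u(1), of "\<lambda>a. a - \<tau>"])
    fix a assume "a \<in> (\<lambda>a. a - \<tau>) ` SV"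
    then obtain t where t: "t \<in> SV" "a = t - \<tau>" by blast
    have "poly P x1 ^ 2 * ((t - \<tau>) ^ 3 * poly (pderiv V) t ^ 2) = k ^ 2"
      using KV[OF t(1)] Kconst k by simp
    hence "(t - \<tau>) ^ 3 * poly (pderiv V) t ^ 2 = u ^ 2"
      using P1 by (simp add: uk power_divide eq_divide_eq mult.commute)
    thus "a ^ 3 * poly (pderiv (\<Prod>a\<in>(\<lambda>a. a - \<tau>) ` SV. [:- a, 1:])) a ^ 2 = u ^ 2"
      unfolding V0p[symmetric] V0_def t(2) pdshift .
  qed (use that in \<open>simp add: cardshift V0p[symmetric]\<close>)
  have m_eq: "m = 2 * card SP + 1"
  proof -
    have "m = ram g x1 + (\<Sum>x\<in>Xs c - {x1}. ram g x)"
      using rc.sum_a[OF c] w(1) rc.finX[OF c] by (simp add: sum.remove)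
    thus ?thesis using w(5) L2 a1 by (simp add: SP_def Xs_def)
  qed
  have l_eq: "l = 2 * card SV + 1"
  proof -
    have "l = (\<Sum>t | poly h t = x1. ram h t)" using sum_ram[OF deg_pos(2) lc(2), of x1] deg by simp
    also have "\<dots> = ram h \<tau> + (\<Sum>t\<in>SV. ram h t)"
      using finite_fibre[OF deg_pos(2), of x1] \<tau>' by (simp add: sum.remove SV_def)
    also have "(\<Sum>t\<in>SV. ram h t) = 2 * card SV" using h2 by (simp add: SV_def)
    finally show ?thesis using h1 by simp
  qed
  have uv: "u = v ^ l"
    using v(3) char2_dickson_odd(2)[OF two, of v "card SV"] v(2) l_eq by simp
  have shift_back: "pcompose [:0, 1:] [:-d, 1:] = [:-d, 1 :: 'a:]" for d by (simp add: pcompose_pCons)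
  have comp_back: "pcompose ([:0, 1:] * Q ^ 2) [:-d, 1:] = [:-d, 1:] * (pcompose Q [:-d, 1:]) ^ 2" for Q :: "'a poly" and d
    by (simp only: pcompose_mult power2_eq_square shift_back)
  have "[:- \<tau>, 1:] * V ^ 2 = pcompose (dickson (v ^ 4) l) [:- \<tau>, 1:]"
    unfolding l_eq char2_dickson_odd(1)[OF two] v(2)[symmetric] comp_back V0_def pcompose_shift_inverse ..
  moreover have "[:- x1, 1:] * P ^ 2 = pcompose (dickson (u ^ 4) m) [:- x1, 1:]"
    unfolding m_eq char2_dickson_odd(1)[OF two] u(2)[symmetric] comp_back P0_def pcompose_shift_inverse ..
  moreover have "u ^ 4 = (v ^ 4) ^ l" by (simp add: uv power_mult[symmetric] mult.commute)
  moreover have "of_nat m \<noteq> (0::'a)" using m_eq two by simp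
  ultimately show thesis
    using that[of "v ^ 4" \<tau> x1] h_eq g_eq v(1) by simp
qed

lemma ritt_cases:
  "(\<exists>y c x1 \<tau>. gs = [:- y, 1:] ^ l + [:c:] \<and> h = [:- \<tau>, 1:] ^ l + [:x1:]) \<or>
   (\<exists>z \<tau> x c. z \<noteq> 0 \<and> of_nat m \<noteq> (0::'a) \<and>
      h = pcompose (dickson z l) [:- \<tau>, 1:] + [:x:] \<and>
      g = pcompose (dickson (z ^ l) m) [:- x, 1:] + [:c:])"
proof (cases "\<exists>c\<in>C. rc.B c = int l - 1 \<and> (\<exists>y\<in>Ys c. ram gs y \<le> Polynomial.order y (pderiv gs))")
  case True
  thus ?thesis using wild_caseE by metis
next
  case False
  have "Polynomial.order y (pderiv gs) = ram gs y - 1" if "c \<in> C" "y \<in> Ys c" "rc.B c = int l - 1" for c y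
  proof -
    have "\<not> ram gs y \<le> Polynomial.order y (pderiv gs)" using False that by blast
    thus ?thesis using order_pderiv_ge[OF gs', of y] by simp
  qed
  from rc.tame_trichotomy[OF this] show ?thesis
  proof
    assume "\<exists>c\<in>C. \<exists>y. Ys c = {y}"
    thus ?thesis using power_caseE by metis
  next
    assume "\<exists>c0 c1. rc.dickson_type c0 c1"
    then obtain c0 c1 where "rc.dickson_type c0 c1" by blast
    then obtain x1 x2 t1 t2 where d: "(2::'a) \<noteq> 0" "of_nat m \<noteq> (0::'a)" "x1 \<noteq> x2" "t1 \<noteq> t2"
      "smult ((of_nat m)^2) ((g - [:c0:]) * (g - [:c1:])) = [:-x1, 1:] * [:-x2, 1:] * pderiv g ^ 2"
      "smult ((of_nat l)^2) ((h - [:x1:]) * (h - [:x2:])) = [:-t1, 1:] * [:-t2, 1:] * pderiv h ^ 2"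
      by (rule dickson_caseE)
    have lg: "degree (pderiv g) = degree g - 1" "lead_coeff (pderiv g) = of_nat (degree g)"
      using degree_lead_pderiv[OF lc(1)] d(2) deg by auto
    have lh: "degree (pderiv h) = degree h - 1" "lead_coeff (pderiv h) = of_nat (degree h)"
      using degree_lead_pderiv[OF lc(2)] l_nz deg by auto
    have "1 \<le> degree h" "1 \<le> degree g" using l_ge l_less deg by auto
    note H = dickson_of_critical_values[OF d(1) this(1) _ lc(2) d(4) _ lh, of x1 x2, unfolded deg]
    note G = dickson_of_critical_values[OF d(1) \<open>1 \<le> degree g\<close> _ lc(1) d(3) _ lg, of c0 c1, unfolded deg]
    show ?thesis using H[OF l_nz d(6)] G[OF d(2) d(5)] d(2) by metis
  qed
qed

end

section \<open>Descent to the ground field\<close>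

text \<open>The composition (x - p(a)) o p o (x + a), the original translate of p. All polynomials
  of both cases are such translates of a few normal forms, and \<open>recenter_pcompose\<close>
  makes composition compatible with them.\<close>

definition recenter :: "'a::field poly \<Rightarrow> 'a \<Rightarrow> 'a poly" where
  "recenter p a = pcompose p [:a, 1:] - [:poly p a:]"

lemma pcompose_xplus: "pcompose (xplus c) p = p + [:c:]"
  by (simp add: xplus_def pcompose_pCons add.commute)

lemma recenter_conv_xplus: "poly p a = c \<Longrightarrow> recenter p a = pcompose (xplus (- c)) (pcompose p (xplus a))"
  by (simp add: recenter_def pcompose_xplus) (simp add: xplus_def)

lemma original_recenter: "original (recenter p a)"
  by (simp add: original_def recenter_def poly_pcompose)

lemma degree_recenter: "0 < degree p \<Longrightarrow> degree (recenter p a) = degree p"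
  by (simp add: recenter_def degree_diff_const degree_pcompose)

lemma lead_coeff_recenter: "0 < degree p \<Longrightarrow> lead_coeff (recenter p a) = lead_coeff p"
proof -
  assume "0 < degree p"
  hence "lead_coeff (pcompose p [:a, 1:] - [:poly p a:]) = lead_coeff (pcompose p [:a, 1:])"
    by (intro lead_coeff_diff_const) (simp add: degree_pcompose)
  thus ?thesis unfolding recenter_def lead_pcompose_linear .
qed

lemma pderiv_recenter: "pderiv (recenter p a) = pcompose (pderiv p) [:a, 1:]"
  by (simp add: recenter_def pderiv_pcompose pderiv_pCons)

lemma pderiv_recenter_eq_0_iff: "pderiv (recenter p a) = 0 \<longleftrightarrow> pderiv p = 0"
  by (simp add: pderiv_recenter pcompose_eq_0_iff)

lemma recenter_pcompose: "recenter (pcompose p q) a = pcompose (recenter p (poly q a)) (recenter q a)"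
proof -
  have "pcompose [:poly q a, 1:] (recenter q a) = pcompose q [:a, 1:]"
    by (simp add: recenter_def pcompose_pCons)
  hence "pcompose (pcompose p [:poly q a, 1:]) (recenter q a) = pcompose (pcompose p q) [:a, 1:]"
    by (simp flip: pcompose_assoc)
  thus ?thesis by (simp add: recenter_def[of p] recenter_def[of "pcompose p q"] pcompose_diff poly_pcompose)
qed

lemma recenter_add_const: "recenter (p + [:c:]) a = recenter p a"
  by (simp add: recenter_def pcompose_add)

lemma recenter_unique:
  assumes "original p" "p = pcompose q [:a, 1:] + [:c:]" shows "p = recenter q a"
proof -
  have "poly p 0 = poly q a + c" by (subst assms(2)) (simp add: poly_pcompose)
  hence "c = - poly q a" using assms(1) by (simp add: original_def eq_neg_iff_add_eq_0 add.commute)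
  thus ?thesis by (subst assms(2)) (simp add: recenter_def)
qed

lemma recenter_cancel:
  assumes "recenter p a = recenter q a" shows "p - [:poly p a:] = q - [:poly q a:]"
proof -
  have "pcompose (p - [:poly p a:]) [:a, 1:] = pcompose (q - [:poly q a:]) [:a, 1:]"
    using assms by (simp add: recenter_def pcompose_diff)
  thus ?thesis by (rule pcompose_right_cancel[rotated]) simp
qed

lemma decomp_hyps_recenter:
  assumes "lead_coeff g = 1" "lead_coeff h = 1" "lead_coeff gs = 1" "lead_coeff hs = 1"
    and "degree g = m" "degree hs = m" "degree h = l" "degree gs = l" "0 < l" "0 < m"
    and "pderiv g \<noteq> 0" "pderiv gs \<noteq> 0" "pcompose g h = pcompose gs hs"
  shows "decomp_hyps l m (recenter (pcompose g h) a) (recenter g (poly h a)) (recenter h a)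
           (recenter gs (poly hs a)) (recenter hs a)"
proof -
  have "lead_coeff (pcompose g h) = 1" using lead_coeff_comp[of h g] assms by simp
  hence "lead_coeff (recenter (pcompose g h) a) = 1"
    using lead_coeff_recenter[of "pcompose g h" a] assms(5,7,9,10) by (simp only: degree_pcompose) simp
  moreover have "lead_coeff (recenter g (poly h a)) = 1" "lead_coeff (recenter h a) = 1"
    "lead_coeff (recenter gs (poly hs a)) = 1" "lead_coeff (recenter hs a) = 1"
    using assms by (subst lead_coeff_recenter; simp)+
  moreover have "original (pcompose (recenter gs (poly hs a)) (recenter hs a))"
    using original_recenter[of "pcompose gs hs" a] by (simp only: recenter_pcompose)
  moreover have "recenter (pcompose g h) a = pcompose (recenter g (poly h a)) (recenter h a)"
    by (rule recenter_pcompose)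
  moreover have "recenter (pcompose g h) a = pcompose (recenter gs (poly hs a)) (recenter hs a)"
    unfolding assms(13) by (rule recenter_pcompose)
  ultimately show ?thesis
    unfolding decomp_hyps_def using assms
    by (simp add: original_recenter degree_recenter pderiv_recenter_eq_0_iff)
qed

text \<open>The cofactor is a sum of n monic products of equal degree, so its leading coefficient is
  n, which does not vanish.\<close>

lemma monic_power_diff:
  fixes p q :: "'a::field poly"
  assumes "lead_coeff p = 1" "lead_coeff q = 1" "degree p = d" "degree q = d" and n: "of_nat n \<noteq> (0::'a)"
  obtains S where "p ^ n - q ^ n = (p - q) * S" "degree S = (n - 1) * d" "lead_coeff S = of_nat n"
proof -
  define S where "S = (\<Sum>i<n. q ^ (n - Suc i) * p ^ i)"
  have pq: "p \<noteq> 0" "q \<noteq> 0" using assms by auto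
  have trm: "degree (q ^ (n - Suc i) * p ^ i) = (n - 1) * d" "coeff (q ^ (n - Suc i) * p ^ i) ((n - 1) * d) = 1"
    if "i < n" for i
  proof -
    have "degree (q ^ (n - Suc i) * p ^ i) = (n - Suc i) * d + i * d"
      using pq assms by (simp add: degree_mult_eq degree_power_eq)
    also have "\<dots> = (n - Suc i + i) * d" by (simp add: distrib_right)
    also have "n - Suc i + i = n - 1" using that by simp
    finally show d: "degree (q ^ (n - Suc i) * p ^ i) = (n - 1) * d" .
    have "lead_coeff (q ^ (n - Suc i) * p ^ i) = 1"
      unfolding lead_coeff_mult lead_coeff_power assms(1,2) by simp
    thus "coeff (q ^ (n - Suc i) * p ^ i) ((n - 1) * d) = 1" unfolding d .
  qed
  have c: "coeff S ((n - 1) * d) = of_nat n" using trm(2) by (simp add: S_def coeff_sum)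
  have "degree S \<le> (n - 1) * d" unfolding S_def using trm(1) by (intro degree_sum_le) auto
  moreover have "(n - 1) * d \<le> degree S" using c n by (intro le_degree) simp
  ultimately have d: "degree S = (n - 1) * d" by simp
  show thesis
    by (rule that[of S]) (use c d power_diff_sumr2[of p n q] in \<open>auto simp: S_def\<close>)
qed

lemma monic_power_inj:
  fixes p q :: "'a::field poly"
  assumes "lead_coeff p = 1" "lead_coeff q = 1" "degree p = degree q" "of_nat n \<noteq> (0::'a)" "p ^ n = q ^ n"
  shows "p = q"
proof -
  obtain S where S: "p ^ n - q ^ n = (p - q) * S" "lead_coeff S = of_nat n"
    using monic_power_diff[OF assms(1,2) _ _ assms(4), of "degree q"] assms(3) by metis
  have "S \<noteq> 0" using S(2) assms(4) by auto
  thus ?thesis using S(1) assms(5) by simp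
qed

lemma pcompose_monom_power: "pcompose (monom 1 n) p = p ^ n" for p :: "'a::comm_ring_1 poly"
  by (induction n) (simp_all add: monom_0 monom_Suc pcompose_pCons pcompose_1 flip: one_pCons)

lemma degree_sub_monom_le:
  assumes "lead_coeff g = 1" "degree g = m"
  shows "degree (g - monom (1::'a::field) m) \<le> m - 1"
  using assms by (intro degree_le) (auto simp: coeff_eq_0)

text \<open>In g(h) everything of degree above (m - 1) l comes from h^m, so h1^m - h2^m has degree
  at most (m - 1) l. It is h1 - h2 times a factor of exactly that degree, because m is nonzero in
  the field; so h1 - h2 is constant, and 0 as both are original.\<close>

lemma right_component_unique:
  fixes g1 g2 h1 h2 :: "'a::field poly"
  assumes g: "lead_coeff g1 = 1" "lead_coeff g2 = 1" "degree g1 = m" "degree g2 = m" "of_nat m \<noteq> (0::'a)"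
    and h: "lead_coeff h1 = 1" "lead_coeff h2 = 1" "degree h1 = l" "degree h2 = l" "0 < l"
      "original h1" "original h2"
    and eq: "pcompose g1 h1 = pcompose g2 h2"
  shows "h1 = h2"
proof (rule ccontr)
  assume ne: "h1 \<noteq> h2"
  obtain S where S: "h1 ^ m - h2 ^ m = (h1 - h2) * S" "degree S = (m - 1) * l" "lead_coeff S = of_nat m"
    using monic_power_diff[OF h(1-4) g(5)] by blast
  have Snz: "S \<noteq> 0" using S(3) g(5) by auto
  have split: "pcompose g h = h ^ m + pcompose (g - monom 1 m) h" for g h :: "'a poly"
    by (simp add: pcompose_diff pcompose_monom_power)
  have "h1 ^ m - h2 ^ m = pcompose (g2 - monom 1 m) h2 - pcompose (g1 - monom 1 m) h1"
    using eq unfolding split[of g1] split[of g2] by (simp add: algebra_simps)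
  also have "degree \<dots> \<le> (m - 1) * l"
  proof (rule degree_diff_le)
    show "degree (pcompose (g2 - monom 1 m) h2) \<le> (m - 1) * l"
      unfolding degree_pcompose h(4) by (intro mult_right_mono degree_sub_monom_le g) simp
    show "degree (pcompose (g1 - monom 1 m) h1) \<le> (m - 1) * l"
      unfolding degree_pcompose h(3) by (intro mult_right_mono degree_sub_monom_le g) simp
  qed
  finally have "degree (h1 - h2) + (m - 1) * l \<le> (m - 1) * l"
    using ne Snz S(2) unfolding S(1) by (simp add: degree_mult_eq)
  hence "degree (h1 - h2) = 0" by simp
  then obtain c where c: "h1 - h2 = [:c:]" by (rule degree_eq_zeroE)
  have "poly (h1 - h2) 0 = 0" using h(6,7) by (simp add: original_def)
  thus False using ne c by simp
qed

lemma coeff_shift_second: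
  fixes p :: "'a::field poly"
  assumes "degree p \<le> Suc n"
  shows "coeff (pcompose p [:a, 1:]) n = coeff p n + of_nat (Suc n) * a * coeff p (Suc n)"
proof -
  define c where "c = coeff p (Suc n)"
  define q where "q = p - monom c (Suc n)"
  have dq: "degree q \<le> n"
    using assms by (intro degree_le) (auto simp: q_def c_def coeff_eq_0)
  have "coeff (pcompose q [:a, 1:]) n = coeff q n"
  proof (cases "degree q = n")
    case True
    thus ?thesis using lead_pcompose_linear[of q a] degree_pcompose_linear[of q a] by simp
  next
    case False
    thus ?thesis using dq degree_pcompose_linear[of q a] by (simp add: coeff_eq_0)
  qed
  moreover have "coeff (pcompose (monom c (Suc n)) [:a, 1:]) n = c * (of_nat (Suc n) * a)"
  proof -
    have "monom c (Suc n) = smult c (monom 1 (Suc n))" by (simp add: smult_monom)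
    hence "pcompose (monom c (Suc n)) [:a, 1:] = smult c ([:a, 1:] ^ Suc n)"
      by (simp only: pcompose_smult pcompose_monom_power)
    moreover have "coeff ([:a, 1:] ^ Suc n) n = of_nat (Suc n) * a"
      using coeff_linear_poly_power[of n "Suc n" a 1] by (simp del: power_Suc of_nat_Suc)
    ultimately show ?thesis by (simp del: power_Suc)
  qed
  moreover have "p = q + monom c (Suc n)" by (simp add: q_def)
  ultimately have "coeff (pcompose p [:a, 1:]) n = coeff q n + c * (of_nat (Suc n) * a)"
    by (metis coeff_add pcompose_add)
  moreover have "coeff q n = coeff p n" by (simp add: q_def)
  ultimately show ?thesis by (simp add: c_def mult_ac)
qed

text \<open>Determines the translation a when the degree is nonzero in the field. The condition
  \<open>0 < n\<close> keeps the coefficient clear of the constant term, which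
  \<open>recenter\<close> changes.\<close>

lemma coeff_recenter_second:
  fixes p :: "'a::field poly"
  assumes "degree p = Suc n" "lead_coeff p = 1" "0 < n"
  shows "coeff (recenter p a) n = coeff p n + of_nat (Suc n) * a"
  using assms coeff_shift_second[of p n a] by (simp add: recenter_def coeff_pCons split: nat.splits)

section \<open>Coefficients and composition of Dickson polynomials\<close>

lemma dickson_coeffs:
  fixes z :: "'a::field"
  shows "(\<forall>k>n. coeff (dickson z n) k = 0) \<and> (n > 0 \<longrightarrow> coeff (dickson z n) n = 1) \<and>
         (n > 0 \<longrightarrow> coeff (dickson z n) (n - 1) = 0) \<and>
         (n > 1 \<longrightarrow> coeff (dickson z n) (n - 2) = - of_nat n * z)"
proof (induction n rule: induct_nat_012)
  case (ge2 n)
  have 1: "coeff (dickson z (Suc (Suc n))) k =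
      (case k of 0 \<Rightarrow> 0 | Suc j \<Rightarrow> coeff (dickson z (Suc n)) j) - z * coeff (dickson z n) k" for k
    by (simp add: coeff_pCons split: nat.splits)
  show ?case
  proof (cases "n = 0")
    case True
    thus ?thesis using 1 by (auto simp: coeff_pCons numeral_eq_Suc split: nat.splits)
  next
    case False
    then obtain j where j: "n = Suc j" by (cases n) auto
    show ?thesis using ge2 unfolding 1 j
      by (auto simp: coeff_pCons algebra_simps split: nat.splits)
  qed
qed (auto simp: coeff_pCons split: nat.splits)

lemma degree_dickson: "0 < n \<Longrightarrow> degree (dickson z n) = n" "0 < n \<Longrightarrow> lead_coeff (dickson z n) = (1::'a::field)"
  using dickson_coeffs[of n z] degree_lead_eqI[of "dickson z n" n] by auto

lemma pderiv_dickson_nonzero: "of_nat n \<noteq> (0::'a::field) \<Longrightarrow> pderiv (dickson (z::'a) n) \<noteq> 0"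
  using degree_lead_pderiv(2)[of "dickson z n"] degree_dickson[of n z]
  by (cases "n = 0") (auto simp del: dickson.simps)

text \<open>With x = u + v and z = u v this is the identity u^(n+2b) + v^(n+2b) = (u^(n+b) +
  v^(n+b)) (u^b + v^b) - (u v)^b (u^n + v^n). The induction uses the recurrence alone and so needs
  no roots u and v.\<close>

lemma dickson_product:
  "dickson z (n + 2 * b) = dickson z (n + b) * dickson z b - smult (z ^ b) (dickson z n)"
proof (induction b arbitrary: n rule: induct_nat_012)
  case 0
  show ?case by (simp add: mult_2_right numeral_poly[symmetric])
next
  case 1
  show ?case using dickson_Suc_Suc[of z n] by (simp add: mult.commute)
next
  case (ge2 b)
  define x where "x = [:0, 1 :: 'a:]"
  have rec: "dickson z (k + 2) = x * dickson z (k + 1) - smult z (dickson z k)" for k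
    unfolding x_def by (rule dickson_Suc_Suc)
  have i1: "dickson z (n + 1 + 2 * Suc b) = dickson z (n + 1 + Suc b) * dickson z (Suc b) - smult (z ^ Suc b) (dickson z (n + 1))"
    by (rule ge2(2))
  have i2: "dickson z (n + 2 + 2 * b) = dickson z (n + 2 + b) * dickson z b - smult (z ^ b) (dickson z (n + 2))"
    by (rule ge2(1))
  have e: "n + 1 + Suc b = n + Suc (Suc b)" "n + 2 + b = n + Suc (Suc b)" by auto
  have "dickson z (n + 2 * Suc (Suc b)) = x * dickson z (n + 1 + 2 * Suc b) - smult z (dickson z (n + 2 + 2 * b))"
    using rec[of "n + 2 * b + 2"] by (simp add: numeral_eq_Suc del: dickson.simps)
  also have "\<dots> = dickson z (n + Suc (Suc b)) * (x * dickson z (b + 1) - smult z (dickson z b)) -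
      smult (z ^ Suc b) (x * dickson z (n + 1) - dickson z (n + 2))"
    unfolding i1 i2 e
    by (simp add: algebra_simps smult_diff_right del: dickson.simps)
  also have "x * dickson z (b + 1) - smult z (dickson z b) = dickson z (Suc (Suc b))"
    using rec[of b] by (simp del: dickson.simps)
  also have "x * dickson z (n + 1) - dickson z (n + 2) = smult z (dickson z n)"
    using rec[of n] by simp
  finally show ?case by (simp add: mult.commute del: dickson.simps)
qed

text \<open>By \<open>dickson_product\<close> with b = l, the sequence T_(l m) in m satisfies the
  Dickson recurrence with T_l in place of x and z^l in place of z.\<close>

lemma dickson_mult: "dickson z (l * m) = pcompose (dickson (z ^ l) m) (dickson z l)"
  for z :: "'a::comm_ring_1"
proof (induction m rule: induct_nat_012)
  case 0 show ?case by simp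
next
  case 1 show ?case by (simp add: pcompose_pCons)
next
  case (ge2 m)
  have "l * Suc (Suc m) = l * m + 2 * l" by simp
  hence "dickson z (l * Suc (Suc m)) = dickson z (l * m + 2 * l)" by (simp only:)
  also have "\<dots> = dickson z (l * Suc m) * dickson z l - smult (z ^ l) (dickson z (l * m))"
    unfolding dickson_product by (simp add: add.commute)
  finally show ?case unfolding ge2
    by (simp add: pcompose_diff pcompose_mult pcompose_smult pcompose_pCons mult.commute del: mult_pCons_left)
qed

lemma dickson_odd_form:
  "\<exists>w. dickson z (2 * r + 1) = [:0, 1:] * pcompose w (monom 1 2)" for z :: "'a::comm_ring_1"
proof (induction r rule: induct_nat_012)
  case 0 show ?case by (intro exI[of _ 1]) (simp add: pcompose_1)
next
  case 1 show ?case
    by (intro exI[of _ "[:- (3 * z), 1:]"]) (simp add: pcompose_pCons monom_Suc numeral_eq_Suc monom_0)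
next
  case (ge2 r)
  then obtain w1 w2 where w: "dickson z (2 * r + 1) = [:0, 1:] * pcompose w1 (monom 1 2)"
    "dickson z (2 * Suc r + 1) = [:0, 1:] * pcompose w2 (monom 1 2)" by blast
  have "dickson z (2 * Suc (Suc r) + 1) = dickson z (2 * r + 1 + 4)" by (simp add: numeral_eq_Suc)
  also have "\<dots> = [:- 2 * z, 0, 1:] * dickson z (2 * Suc r + 1) - smult (z ^ 2) (dickson z (2 * r + 1))"
    unfolding dickson_step2 by simp
  also have "[:- 2 * z, 0, 1:] = pcompose [:- 2 * z, 1:] (monom 1 2)"
    by (simp add: pcompose_pCons monom_Suc numeral_eq_Suc monom_0)
  finally have "dickson z (2 * Suc (Suc r) + 1) =
     [:0, 1:] * pcompose ([:- 2 * z, 1:] * w2 - smult (z ^ 2) w1) (monom 1 2)"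
    unfolding w by (simp only: pcompose_diff pcompose_mult pcompose_smult right_diff_distrib mult_smult_right mult.left_commute)
  thus ?case by blast
qed

section \<open>Both families as recentred normal forms\<close>

lemma sc_recenter:
  shows "sc_f l m z a = recenter (pcompose (dickson (z ^ l) m) (dickson z l)) a"
    and "sc_g l m z a = recenter (dickson (z ^ l) m) (poly (dickson z l) a)"
    and "sc_h l m z a = recenter (dickson z l) a"
    and "sc_gs l m z a = recenter (dickson (z ^ m) l) (poly (dickson z m) a)"
    and "sc_hs l m z a = recenter (dickson z m) a"
proof -
  have e: "poly (dickson (z ^ l) m) (poly (dickson z l) a) = poly (dickson z (l * m)) a"
    "poly (dickson (z ^ m) l) (poly (dickson z m) a) = poly (dickson z (l * m)) a"
    unfolding dickson_mult[of z l m] by (simp_all add: poly_pcompose[symmetric] dickson_mult[symmetric] mult.commute)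
  show "sc_f l m z a = recenter (pcompose (dickson (z ^ l) m) (dickson z l)) a"
    unfolding sc_f_def dickson_mult[symmetric] by (rule recenter_conv_xplus[symmetric]) simp
  show "sc_g l m z a = recenter (dickson (z ^ l) m) (poly (dickson z l) a)"
    unfolding sc_g_def by (rule recenter_conv_xplus[OF e(1), symmetric])
  show "sc_h l m z a = recenter (dickson z l) a"
    unfolding sc_h_def by (rule recenter_conv_xplus[symmetric]) simp
  show "sc_gs l m z a = recenter (dickson (z ^ m) l) (poly (dickson z m) a)"
    unfolding sc_gs_def by (rule recenter_conv_xplus[OF e(2), symmetric])
  show "sc_hs l m z a = recenter (dickson z m) a"
    unfolding sc_hs_def by (rule recenter_conv_xplus[symmetric]) simp
qed

lemma dickson_comp_comm: "pcompose (dickson (z ^ l) m) (dickson z l) = pcompose (dickson (z ^ m) l) (dickson z m)"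
  by (simp add: dickson_mult[symmetric] mult.commute)

text \<open>The components of the first case for a = 0: with G as in \<open>fcG\<close>, the
  identity \<open>fc_comp\<close> reads G o x^l = x^l o N. The translations by a are left to
  \<open>recenter\<close>.\<close>

definition fcN :: "nat \<Rightarrow> nat \<Rightarrow> 'a::field poly \<Rightarrow> 'a poly" where
  "fcN l k w = monom 1 k * pcompose w (monom 1 l)"

definition fcG :: "nat \<Rightarrow> nat \<Rightarrow> 'a::field poly \<Rightarrow> 'a poly" where
  "fcG l k w = monom 1 k * w ^ l"

lemma fc_comp: "pcompose (fcG l k w) (monom 1 l) = pcompose (monom 1 l) (fcN l k w)"
proof -
  have pc: "pcompose (w ^ n) q = (pcompose w q) ^ n" for q :: "'a poly" and n
    by (induction n) (simp_all add: pcompose_mult pcompose_1)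
  show ?thesis
    by (simp add: fcG_def fcN_def pcompose_mult pc pcompose_monom_power power_mult_distrib monom_power mult.commute)
qed

lemma fc_recenter:
  shows "fc_f l m w a = recenter (pcompose (fcG l (m mod l) w) (monom 1 l)) a"
    and "fc_g l m w a = recenter (fcG l (m mod l) w) (poly (monom 1 l) a)"
    and "fc_h l m w a = recenter (monom 1 l) a"
    and "fc_gs l m w a = recenter (monom 1 l) (poly (fcN l (m mod l) w) a)"
    and "fc_hs l m w a = recenter (fcN l (m mod l) w) a"
proof -
  define k where "k = m mod l"
  have f: "pcompose (fcG l k w) (monom 1 l) = monom 1 (k * l) * (pcompose w (monom 1 l)) ^ l"
    unfolding fc_comp by (simp add: fcN_def pcompose_monom_power power_mult_distrib monom_power)
  show "fc_f l m w a = recenter (pcompose (fcG l (m mod l) w) (monom 1 l)) a"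
    unfolding fc_f_def Let_def f[unfolded k_def]
    by (rule recenter_conv_xplus[symmetric]) (simp add: poly_monom poly_pcompose)
  show "fc_g l m w a = recenter (fcG l (m mod l) w) (poly (monom 1 l) a)"
    unfolding fc_g_def Let_def fcG_def poly_monom mult_1
    by (rule recenter_conv_xplus[symmetric]) (simp add: poly_monom power_mult[symmetric] mult.commute)
  show "fc_h l m w a = recenter (monom 1 l) a"
    unfolding fc_h_def by (rule recenter_conv_xplus[symmetric]) (simp add: poly_monom)
  show "fc_gs l m w a = recenter (monom 1 l) (poly (fcN l (m mod l) w) a)"
  proof -
    have "poly (fcN l (m mod l) w) a = a ^ (m mod l) * poly w (a ^ l)"
      by (simp add: fcN_def poly_monom poly_pcompose)
    thus ?thesis
      unfolding fc_gs_def Let_def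
      by (simp only:) (rule recenter_conv_xplus[symmetric],
          simp add: poly_monom power_mult_distrib power_mult[symmetric])
  qed
  show "fc_hs l m w a = recenter (fcN l (m mod l) w) a"
    unfolding fc_hs_def Let_def fcN_def
    by (rule recenter_conv_xplus[symmetric]) (simp add: poly_monom poly_pcompose)
qed

lemma fcN_degree:
  assumes "lead_coeff w = 1" "degree w = m div l" "0 < l"
  shows "degree (fcN l (m mod l) w) = m" "lead_coeff (fcN l (m mod l) w) = 1"
    "degree (fcG l (m mod l) w) = m mod l + l * (m div l)" "lead_coeff (fcG l (m mod l) w) = 1"
proof -
  have w0: "w \<noteq> 0" using assms(1) by auto
  have nz: "pcompose w (monom 1 l) \<noteq> 0" using w0 assms(3) by (subst pcompose_eq_0_iff) (auto simp: degree_monom_eq)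
  show "degree (fcN l (m mod l) w) = m"
    using nz assms by (simp add: fcN_def degree_mult_eq degree_monom_eq degree_pcompose mult.commute)
  show "lead_coeff (fcN l (m mod l) w) = 1"
    unfolding fcN_def lead_coeff_mult using assms lead_coeff_comp[of "monom 1 l" w]
    by (simp add: degree_monom_eq)
  show "degree (fcG l (m mod l) w) = m mod l + l * (m div l)"
    using w0 assms by (simp add: fcG_def degree_mult_eq degree_monom_eq degree_power_eq)
  show "lead_coeff (fcG l (m mod l) w) = 1"
    unfolding fcG_def lead_coeff_mult lead_coeff_power using assms by (simp add: degree_monom_eq)
qed

text \<open>The origin of the condition k w + l x w' \<noteq> 0: the other factors never vanish, so
  it says exactly that the derivative of g is nonzero.\<close>

lemma pderiv_fcG:
  assumes "0 < k" "0 < l"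
  shows "pderiv (fcG l k w) = monom 1 (k - 1) * w ^ (l - 1) *
           (smult (of_nat k) w + smult (of_nat l) ([:0, 1:] * pderiv w))"
proof -
  obtain k' l' where kl: "k = Suc k'" "l = Suc l'" using assms by (metis gr0_implies_Suc)
  have X: "monom 1 (Suc k') = [:0, 1:] * monom (1::'a) k'" by (simp add: monom_Suc)
  have M: "monom (of_nat (Suc k')) k' = smult (of_nat (Suc k')) (monom (1::'a) k')" by (simp add: smult_monom)
  have "pderiv (fcG l k w) = monom 1 (Suc k') * (smult (of_nat (Suc l')) (w ^ l') * pderiv w) +
      smult (of_nat (Suc k')) (monom 1 k') * w ^ Suc l'"
    unfolding kl fcG_def pderiv_mult pderiv_monom pderiv_power_Suc using M
    by (simp add: mult.commute del: of_nat_Suc power_Suc)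
  thus ?thesis unfolding kl X
    by (simp add: distrib_left smult_add_right mult_ac del: of_nat_Suc mult_pCons_left mult_pCons_right)
qed

lemma mod_pos_of_coprime:
  assumes "2 \<le> l" "coprime l m" shows "0 < m mod (l::nat)"
proof (rule ccontr)
  assume "\<not> 0 < m mod l"
  hence "l dvd m" by (simp add: dvd_eq_mod_eq_0)
  hence "is_unit l" using assms(2) coprime_absorb_left by blast
  thus False using assms(1) by simp
qed

lemma fc_converse:
  fixes w :: "'a::field poly"
  assumes "2 \<le> l" "l < m" "coprime l m" and w: "fc_param l m w"
  shows "decomp_hyps l m (fc_f l m w a) (fc_g l m w a) (fc_h l m w a) (fc_gs l m w a) (fc_hs l m w a)"
proof -
  define k where "k = m mod l"
  have l0: "0 < l" using assms by simp
  have k0: "0 < k" unfolding k_def by (rule mod_pos_of_coprime[OF assms(1,3)])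
  have lnz: "of_nat l \<noteq> (0::'a)" using w by (simp add: fc_param_def of_nat_eq_0_iff_char_dvd)
  have lw: "lead_coeff w = 1" "degree w = m div l" using w by (auto simp: fc_param_def)
  note dN = fcN_degree[OF lw l0]
  have "w \<noteq> 0" using lw by auto
  hence "pderiv (fcG l k w) \<noteq> 0"
    unfolding pderiv_fcG[OF k0 l0] using w by (simp add: fc_param_def k_def)
  moreover have "pderiv (monom (1::'a) l) \<noteq> 0" using lnz by (simp add: pderiv_monom)
  ultimately show ?thesis
    unfolding fc_recenter using dN fc_comp[of l k w] l0 assms(2)
    by (intro decomp_hyps_recenter) (auto simp: k_def degree_monom_eq)
qed

lemma sc_converse:
  fixes z a :: "'a::field"
  assumes "0 < l" "0 < m" and n: "\<not> CHAR('a) dvd (l * m)"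
  shows "decomp_hyps l m (sc_f l m z a) (sc_g l m z a) (sc_h l m z a) (sc_gs l m z a) (sc_hs l m z a)"
proof -
  have "of_nat (l * m) \<noteq> (0::'a)" using n by (simp add: of_nat_eq_0_iff_char_dvd del: of_nat_mult)
  hence "of_nat l \<noteq> (0::'a)" "of_nat m \<noteq> (0::'a)" by auto
  hence "pderiv (dickson (z ^ l) m) \<noteq> 0" "pderiv (dickson (z ^ m) l) \<noteq> 0"
    by (auto dest: pderiv_dickson_nonzero)
  thus ?thesis
    unfolding sc_recenter using assms degree_dickson[of l] degree_dickson[of m]
    by (intro decomp_hyps_recenter) (auto simp: dickson_comp_comm)
qed

lemma recenter_monom_unique:
  fixes a a' :: "'a::field"
  assumes "of_nat l \<noteq> (0::'a)" "2 \<le> l" "recenter (monom 1 l) a = recenter (monom 1 l) a'"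
  shows "a = a'"
proof -
  obtain n where n: "l = Suc n" "0 < n" using assms(2) by (cases l) auto
  have d: "degree (monom (1::'a) l) = Suc n" "lead_coeff (monom (1::'a) l) = 1"
    using n by (simp_all add: degree_monom_eq)
  have "coeff (monom 1 l) n + of_nat (Suc n) * a = coeff (monom 1 l) n + of_nat (Suc n) * a'"
    using assms(3) coeff_recenter_second[OF d n(2)] by metis
  hence "of_nat l * a = of_nat l * a'" unfolding n(1) by (rule add_left_imp_eq)
  thus ?thesis using assms(1) by simp
qed

text \<open>As m is nonzero in the field, f determines its right component h and thereby a.
  Cancelling h determines x^k w^l up to a constant, which is fixed by the zero at 0 because k > 0,
  and a monic l-th root is unique because l is nonzero in the field.\<close>

lemma fc_unique:
  fixes w w' :: "'a::field poly"
  assumes lm: "2 \<le> l" "l < m" "coprime l m" and lnz: "of_nat l \<noteq> (0::'a)" and mnz: "of_nat m \<noteq> (0::'a)"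
    and w: "lead_coeff w = 1" "degree w = m div l" and w': "lead_coeff w' = 1" "degree w' = m div l"
    and eq: "fc_f l m w a = fc_f l m w' a'"
  shows "w = w' \<and> a = a'"
proof -
  define k where "k = m mod l"
  have l0: "0 < l" using lm by simp
  have k0: "0 < k" unfolding k_def by (rule mod_pos_of_coprime[OF lm(1,3)])
  define b where "b = poly (monom 1 l) a"
  define b' where "b' = poly (monom 1 l) a'"
  note dw = fcN_degree[OF w l0] and dw' = fcN_degree[OF w' l0]
  have md: "m mod l + l * (m div l) = m" by simp
  have m0: "0 < m" using lm by simp
  have dg: "degree (fcG l k w) = m" "degree (fcG l k w') = m" "lead_coeff (fcG l k w) = 1" "lead_coeff (fcG l k w') = 1"
    using dw(3,4) dw'(3,4) unfolding k_def md by auto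
  have dm: "degree (monom (1::'a) l) = l" by (simp add: degree_monom_eq)
  have eq': "pcompose (recenter (fcG l k w) b) (recenter (monom 1 l) a) =
        pcompose (recenter (fcG l k w') b') (recenter (monom 1 l) a')"
    using eq unfolding fc_recenter recenter_pcompose k_def b_def b'_def .
  have h: "recenter (monom 1 l) a = recenter (monom 1 l) a'"
  proof (rule right_component_unique[OF _ _ _ _ mnz _ _ _ _ l0 _ _ eq'])
    show "lead_coeff (recenter (fcG l k w) b) = 1" "lead_coeff (recenter (fcG l k w') b') = 1"
      using lead_coeff_recenter dg m0 by metis+
    show "lead_coeff (recenter (monom (1::'a) l) a) = 1" "lead_coeff (recenter (monom (1::'a) l) a') = 1"
      using lead_coeff_recenter[of "monom (1::'a) l"] dm l0 by simp_all
  qed (use dg m0 l0 dm in \<open>simp_all add: degree_recenter original_recenter\<close>)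
  have aa: "a = a'" by (rule recenter_monom_unique[OF lnz lm(1) h])
  have "recenter (fcG l k w) b = recenter (fcG l k w') b"
    using eq' unfolding aa b_def b'_def
    by (rule pcompose_right_cancel[rotated]) (use l0 dm in \<open>simp add: degree_recenter\<close>)
  hence c: "fcG l k w - [:poly (fcG l k w) b:] = fcG l k w' - [:poly (fcG l k w') b:]"
    by (rule recenter_cancel)
  have z: "poly (fcG l k v) 0 = 0" for v :: "'a poly" using k0 by (simp add: fcG_def poly_monom)
  have "poly (fcG l k w) b = poly (fcG l k w') b"
    using arg_cong[OF c, of "\<lambda>p. poly p 0"] z by simp
  hence "fcG l k w = fcG l k w'" using c by simp
  hence "w ^ l = w' ^ l" by (simp add: fcG_def)
  hence "w = w'" using monic_power_inj[OF w(1) w'(1) _ lnz] w(2) w'(2) by simp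
  thus ?thesis using aa by simp
qed

lemma sc_f_recenter: "sc_f l m z a = recenter (dickson z (l * m)) a"
  unfolding sc_recenter dickson_mult[symmetric] ..

text \<open>A vanishing second coefficient normalises the translation, so equal translates of two
  such polynomials come from the same point. With 3 \<le> n the coefficient of degree n - 2 is not
  the constant term and survives recentring; for Dickson polynomials it is - n z.\<close>

lemma recenter_eqD:
  fixes p q :: "'a::field poly"
  assumes p: "degree p = n" "lead_coeff p = 1" "coeff p (n - 1) = 0"
    and q: "degree q = n" "lead_coeff q = 1" "coeff q (n - 1) = 0"
    and n: "3 \<le> n" "of_nat n \<noteq> (0::'a)" and eq: "recenter p a = recenter q b"
  shows "a = b" "coeff p (n - 2) = coeff q (n - 2)"
proof -
  obtain j where j: "n = Suc (Suc j)" "0 < j"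
  proof -
    have "n = Suc (Suc (n - 2))" "0 < n - 2" using n(1) by auto
    thus thesis by (rule that)
  qed
  note P = coeff_recenter_second[OF p(1)[unfolded j] p(2) zero_less_Suc, of a]
    and Q = coeff_recenter_second[OF q(1)[unfolded j] q(2) zero_less_Suc, of b]
  have "coeff p (Suc j) = 0" "coeff q (Suc j) = 0" using p(3) q(3) j by simp_all
  hence "of_nat n * a = of_nat n * b"
    using P Q unfolding eq j(1)[symmetric] by (metis add_0)
  thus ab: "a = b" using n by simp
  have "p - [:poly p b:] = q - [:poly q b:]"
    using eq unfolding ab by (rule recenter_cancel)
  hence "coeff (p - [:poly p b:]) j = coeff (q - [:poly q b:]) j" by (rule arg_cong)
  thus "coeff p (n - 2) = coeff q (n - 2)" using j by (simp add: coeff_pCons split: nat.splits)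
qed

lemma sc_unique:
  fixes z z' a a' :: "'a::field"
  assumes lm: "2 \<le> l" "l < m" and nz: "of_nat (l * m) \<noteq> (0::'a)" and eq: "sc_f l m z a = sc_f l m z' a'"
  shows "z = z' \<and> a = a'"
proof -
  define n where "n = l * m"
  have "2 * 2 \<le> l * m" using lm by (intro mult_mono) auto
  hence n3: "3 \<le> n" and n0: "0 < n" unfolding n_def by linarith+
  note D = degree_dickson[OF n0]
  have C: "coeff (dickson y n) (n - 1) = 0" "coeff (dickson y n) (n - 2) = - of_nat n * y" for y :: 'a
    using dickson_coeffs[of n y] n3 by auto
  note E = recenter_eqD[OF D C(1) D C(1) n3 nz[folded n_def] eq[unfolded sc_f_recenter, folded n_def]]
  have "of_nat n * z = of_nat n * z'" using E(2) unfolding C by simp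
  thus ?thesis using E(1) nz[folded n_def] by simp
qed

text \<open>The coefficient of degree l - 2 in the normal form of h is 0 for x^l and - l z for T_l.
  For l = 2 it is the constant term and the argument breaks down, as it must.\<close>

lemma cases_exclusive:
  fixes f g h gs hs :: "'a::field poly"
  assumes l3: "3 \<le> l" and f: "first_case l m f g h gs hs" and s: "second_case l m f g h gs hs"
  shows False
proof -
  obtain w :: "'a poly" and a where w: "fc_param l m w" "h = recenter (monom 1 l) a"
    using f unfolding first_case_def fc_recenter by blast
  obtain z b where z: "z \<noteq> 0" "h = recenter (dickson z l) b"
    using s unfolding second_case_def sc_recenter by blast
  have lnz: "of_nat l \<noteq> (0::'a)" using w(1) by (simp add: fc_param_def of_nat_eq_0_iff_char_dvd)
  have l0: "0 < l" using l3 by simp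
  have e: "recenter (monom 1 l) a = recenter (dickson z l) b" using w z by simp
  have "coeff (monom (1::'a) l) (l - 2) = coeff (dickson z l) (l - 2)"
    by (rule recenter_eqD(2)[OF _ _ _ degree_dickson[OF l0] _ l3 lnz e])
      (use dickson_coeffs[of l z] l3 in \<open>auto simp: degree_monom_eq\<close>)
  moreover have "l \<noteq> l - 2" using l3 by simp
  ultimately have "of_nat l * z = 0" using dickson_coeffs[of l z] l3 by simp
  thus False using lnz z(1) by simp
qed

text \<open>f is recovered as gs o hs and g by cancelling h on the right; the nonzero derivative of
  g then yields the condition on w.\<close>

lemma first_caseI:
  fixes g h gs hs :: "'a::field poly"
  assumes hyps: "decomp_hyps l m f g h gs hs" and lm: "2 \<le> l" "l < m" "coprime l m" "of_nat l \<noteq> (0::'a)"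
    and w: "lead_coeff w = 1" "degree w = m div l"
    and h: "h = recenter (monom 1 l) a" and hs: "hs = recenter (fcN l (m mod l) w) a"
    and gs: "gs = recenter (monom 1 l) (poly (fcN l (m mod l) w) a)"
  shows "first_case l m f g h gs hs"
proof -
  define k where "k = m mod l"
  have l0: "0 < l" using lm by simp
  have k0: "0 < k" unfolding k_def by (rule mod_pos_of_coprime[OF lm(1,3)])
  have comp: "f = pcompose g h" "f = pcompose gs hs" and g': "pderiv g \<noteq> 0"
    and dh: "degree h = l" using hyps by (auto simp: decomp_hyps_def)
  have f: "f = recenter (pcompose (fcG l k w) (monom 1 l)) a"
    unfolding comp(2) gs hs fc_comp k_def by (rule recenter_pcompose[symmetric])
  have "pcompose g h = pcompose (recenter (fcG l k w) (poly (monom 1 l) a)) h"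
    using comp(1) f unfolding recenter_pcompose h by simp
  hence g: "g = recenter (fcG l k w) (poly (monom 1 l) a)"
    by (rule pcompose_right_cancel[rotated]) (use dh l0 in simp)
  have "pderiv (fcG l k w) \<noteq> 0" using g' unfolding g by (simp add: pderiv_recenter_eq_0_iff)
  hence "smult (of_nat k) w + smult (of_nat l) ([:0, 1:] * pderiv w) \<noteq> 0"
    unfolding pderiv_fcG[OF k0 l0] by auto
  hence "fc_param l m w" using w lm(4) by (simp add: fc_param_def k_def of_nat_eq_0_iff_char_dvd)
  thus ?thesis unfolding first_case_def fc_recenter using f g h hs gs unfolding k_def by blast
qed

text \<open>T_2 = x^2 - 2 z differs from x^2 by a constant, which recentring forgets, and T_m has
  the form x w(x^2) because m is odd.\<close>

lemma second_imp_first: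
  fixes g h gs hs :: "'a::field poly"
  assumes hyps: "decomp_hyps 2 m f g h gs hs" and m: "2 < m" "coprime 2 m"
    and s: "second_case 2 m f g h gs hs"
  shows "first_case 2 m f g h gs hs"
proof -
  obtain z a where z: "h = recenter (dickson z 2) a" "gs = recenter (dickson (z ^ m) 2) (poly (dickson z m) a)"
    "hs = recenter (dickson z m) a"
    using s unfolding second_case_def sc_recenter by blast
  have "of_nat (2 * m) \<noteq> (0::'a)"
    using s by (simp add: second_case_def of_nat_eq_0_iff_char_dvd del: of_nat_mult)
  hence two: "of_nat 2 \<noteq> (0::'a)" by auto
  have T2: "dickson y 2 = monom 1 2 + [:- 2 * y:]" for y :: 'a
    by (simp add: numeral_eq_Suc monom_Suc monom_0)
  have "odd m" using m(2) by simp
  then obtain r where r: "m = 2 * r + 1" by (rule oddE)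
  obtain w where w: "dickson z m = [:0, 1:] * pcompose w (monom 1 2)" using dickson_odd_form[of z r] r by blast
  have N: "fcN 2 (m mod 2) w = dickson z m" unfolding w using r by (simp add: fcN_def monom_Suc monom_0)
  have w0: "w \<noteq> 0"
  proof
    assume "w = 0"
    hence "dickson z m = 0" using w by simp
    thus False using degree_dickson(2)[of m z] m by simp
  qed
  have nz: "pcompose w (monom 1 2) \<noteq> 0" using w0 by (subst pcompose_eq_0_iff) (auto simp: degree_monom_eq)
  have "m = 1 + degree w * 2"
    using degree_dickson(1)[of m z] m nz unfolding w
    by (simp add: degree_mult_eq degree_pcompose degree_monom_eq del: mult_pCons_left)
  hence dw: "degree w = m div 2" by simp
  have "lead_coeff (pcompose w (monom 1 2)) = 1"
    using degree_dickson(2)[of m z] m unfolding w lead_coeff_mult by simp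
  hence lw: "lead_coeff w = 1" using lead_coeff_comp[of "monom 1 2" w] by (simp add: degree_monom_eq)
  show ?thesis
    by (rule first_caseI[OF hyps _ m two lw dw]) (simp_all only: N z T2 recenter_add_const)
qed

lemma coeff_pcompose_monom:
  assumes "0 < l" "\<not> l dvd n"
  shows "coeff (pcompose p (monom 1 l)) n = (0::'a::field)"
  using assms
proof (induction p arbitrary: n)
  case (pCons a p)
  have n0: "n \<noteq> 0" using pCons.prems(2) by (metis dvd_0_right)
  have "coeff (pcompose (pCons a p) (monom 1 l)) n = coeff (monom 1 l * pcompose p (monom 1 l)) n"
    using n0 by (simp add: pcompose_pCons coeff_pCons split: nat.splits)
  also have "\<dots> = (if n < l then 0 else coeff (pcompose p (monom 1 l)) (n - l))"
    by (simp add: coeff_monom_mult)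
  also have "\<dots> = 0" using pCons.IH[OF assms(1), of "n - l"] pCons.prems
    by (auto simp: dvd_minus_self)
  finally show ?case .
qed simp

text \<open>Let M collect the terms of N whose exponents are congruent to m modulo l; it has the
  required form, and its l-th power is also a polynomial in x^l. If N - M had degree d, then N^l -
  M^l would have degree d + (l - 1) m. This is a multiple of l, so d is congruent to m, but in these
  degrees N and M agree.\<close>

lemma power_in_monom:
  fixes N Q :: "'a::field poly"
  assumes l: "0 < l" "of_nat l \<noteq> (0::'a)" and N: "lead_coeff N = 1" "degree N = m"
    and eq: "N ^ l = pcompose Q (monom 1 l)"
  obtains w where "N = fcN l (m mod l) w" "lead_coeff w = 1" "degree w = m div l"
proof -
  define k where "k = m mod l"
  define s where "s = m div l"
  have mk: "m = k + s * l" by (simp add: k_def s_def)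
  define w where "w = (\<Sum>i\<le>s. monom (coeff N (k + i * l)) i)"
  have cw: "coeff w i = (if i \<le> s then coeff N (k + i * l) else 0)" for i
    by (simp add: w_def coeff_sum)
  have ws: "coeff w s = 1" using cw[of s] N mk by simp
  have dw: "degree w = s" "lead_coeff w = 1"
    using degree_lead_eqI[of w s] ws cw by auto
  define M where "M = fcN l k w"
  have dM: "degree M = m" "lead_coeff M = 1"
    using fcN_degree[OF dw(2) dw(1)[unfolded s_def] l(1)] unfolding M_def k_def by blast+
  have Msum: "pcompose w (monom 1 l) = (\<Sum>i\<le>s. monom (coeff N (k + i * l)) (i * l))"
  proof -
    have "pcompose (monom c i) (monom 1 l) = monom c (i * l)" for c :: 'a and i
      by (induction i) (simp_all add: monom_0 monom_Suc pcompose_pCons mult_monom)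
    thus ?thesis by (simp add: w_def pcompose_sum)
  qed
  have M_coeff: "coeff M n = coeff N n" if nk: "n mod l = k" for n
  proof (cases "n \<le> m")
    case True
    have "n = k + (n div l) * l" unfolding nk[symmetric] by simp
    then obtain i where i: "n = k + i * l" by blast
    have "i \<le> s" using True mk i l by simp
    have "coeff M n = coeff (\<Sum>j\<le>s. monom (coeff N (k + j * l)) (j * l)) (i * l)"
      unfolding M_def fcN_def Msum i by (simp add: coeff_monom_mult)
    also have "\<dots> = (\<Sum>j\<le>s. if j = i then coeff N (k + j * l) else 0)"
      unfolding coeff_sum using l by (intro sum.cong) auto
    also have "\<dots> = coeff N n" using \<open>i \<le> s\<close> i by simp
    finally show ?thesis .
  next
    case False
    thus ?thesis using N dM by (simp add: coeff_eq_0)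
  qed
  have "N - M = 0"
  proof (rule ccontr)
    assume nz: "N - M \<noteq> 0"
    obtain S where S: "N ^ l - M ^ l = (N - M) * S" "degree S = (l - 1) * m" "lead_coeff S = of_nat l"
      using monic_power_diff[OF N(1) dM(2) N(2) dM(1) l(2)] .
    have Snz: "S \<noteq> 0" using S(3) l by auto
    define d where "d = degree (N - M)"
    have "lead_coeff ((N - M) * S) \<noteq> 0" using nz Snz by (simp del: lead_coeff_mult)
    hence c: "coeff (N ^ l - M ^ l) (d + (l - 1) * m) \<noteq> 0"
      unfolding S(1) using degree_mult_eq[OF nz Snz] S(2) by (simp add: d_def)
    have "M ^ l = pcompose (fcG l k w) (monom 1 l)"
      unfolding fc_comp M_def pcompose_monom_power ..
    hence e: "N ^ l - M ^ l = pcompose (Q - fcG l k w) (monom 1 l)" unfolding eq by (simp add: pcompose_diff)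
    have "l dvd d + (l - 1) * m"
      using c coeff_pcompose_monom[OF l(1)] unfolding e by blast
    moreover have "d + (l - 1) * m + m = d + l * m"
      using l(1) by (cases l) auto
    ultimately have "(d + l * m) mod l = m mod l"
      by (metis add.commute dvd_imp_mod_0 mod_add_eq add_0 mod_mod_trivial)
    hence "d mod l = k" by (simp add: k_def)
    hence "coeff (N - M) d = 0" using M_coeff by simp
    thus False using nz unfolding d_def by (metis leading_coeff_0_iff)
  qed
  hence "N = fcN l (m mod l) w" by (simp add: M_def k_def)
  thus thesis using that dw by (simp add: s_def)
qed

section \<open>Passage to the algebraic closure and back\<close>

abbreviation lift :: "'a::field poly \<Rightarrow> 'a alg_closure poly" where
  "lift \<equiv> map_poly to_ac"

lemma coeff_lift [simp]: "coeff (lift p) n = to_ac (coeff p n)"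
  by (simp add: coeff_map_poly)

lemma lift_eq_iff [simp]: "lift p = lift q \<longleftrightarrow> p = q"
  by (auto simp: poly_eq_iff)

lemma degree_lift [simp]: "degree (lift p) = degree p"
  by (rule degree_map_poly) simp

lemma lead_coeff_lift: "lead_coeff (lift p) = to_ac (lead_coeff p)"
  by simp

lemma lift_add: "lift (p + q) = lift p + lift q" and lift_diff: "lift (p - q) = lift p - lift q"
  by (simp_all add: poly_eq_iff)

lemma lift_smult: "lift (smult c p) = smult (to_ac c) (lift p)"
  by (simp add: poly_eq_iff)

lemma lift_mult: "lift (p * q) = lift p * lift q"
  by (simp add: poly_eq_iff coeff_mult to_ac_sum)

lemma lift_pCons: "lift (pCons a p) = pCons (to_ac a) (lift p)"
  by (simp add: poly_eq_iff coeff_pCons split: nat.splits)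

lemma lift_0 [simp]: "lift 0 = 0"
  by simp

lemma lift_pcompose: "lift (pcompose p q) = pcompose (lift p) (lift q)"
  by (induction p) (simp_all add: pcompose_pCons lift_add lift_mult lift_pCons)

lemma poly_lift: "poly (lift p) (to_ac x) = to_ac (poly p x)"
  by (induction p) (simp_all add: lift_pCons)

lemma lift_pderiv: "lift (pderiv p) = pderiv (lift p)"
  by (simp add: poly_eq_iff coeff_pderiv)

lemma lift_dickson: "lift (dickson z n) = dickson (to_ac z) n"
  by (induction n rule: induct_nat_012) (simp_all add: lift_diff lift_mult lift_smult lift_pCons)

lemma lift_recenter: "lift (recenter p a) = recenter (lift p) (to_ac a)"
  by (simp add: recenter_def lift_diff lift_pcompose lift_pCons poly_lift)

lemma original_lift: "original p \<Longrightarrow> original (lift p)"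
  using poly_lift[of p 0] by (simp add: original_def)

lemma linear_power_recenter:
  fixes p :: "'a::field poly"
  assumes lnz: "of_nat l \<noteq> (0::'a)" and l: "2 \<le> l" and orig: "original p"
    and lc: "lift p = [:- t, 1:] ^ l + [:c:]"
  obtains a where "p = recenter (monom 1 l) a"
proof -
  obtain n where n: "l = Suc n" "0 < n" using l by (cases l) auto
  define a where "a = coeff p n / of_nat l"
  have P: "lift p = recenter (monom 1 l) (- t)"
  proof (rule recenter_unique[OF original_lift[OF orig]])
    show "lift p = pcompose (monom 1 l) [:- t, 1:] + [:c:]" using lc by (simp add: pcompose_monom_power)
  qed
  have d: "degree (monom (1::'a alg_closure) l) = Suc n" "lead_coeff (monom (1::'a alg_closure) l) = 1"
    using n by (simp_all add: degree_monom_eq)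
  have "to_ac (coeff p n) = coeff (lift p) n" by simp
  also have "\<dots> = coeff (monom 1 l) n + of_nat l * (- t)"
    unfolding P n(1)[symmetric] using coeff_recenter_second[OF d n(2)] n(1) by metis
  also have "\<dots> = of_nat l * (- t)" using n(1) by simp
  finally have "to_ac a = - t" using lnz unfolding a_def to_ac_divide to_ac_of_nat
    by (metis nonzero_mult_div_cancel_left to_ac_eq_0_iff to_ac_of_nat)
  moreover have "lift (monom (1::'a) l) = monom 1 l" by (simp add: poly_eq_iff)
  ultimately have "lift p = lift (recenter (monom 1 l) a)" using P by (simp only: lift_recenter)
  thus thesis using that by simp
qed

text \<open>Once h and gs are translates of x^l over the ground field, removing the translations
  turns the two decompositions into N^l = G(x^l), with N a translate of hs, and
  \<open>power_in_monom\<close> produces w.\<close>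

lemma first_case_of_powers:
  fixes g h gs hs :: "'a::field poly"
  assumes hyps: "decomp_hyps l m f g h gs hs" and lm: "2 \<le> l" "l < m" "coprime l m" "of_nat l \<noteq> (0::'a)"
    and gs: "lift gs = [:- y, 1:] ^ l + [:c:]" and h: "lift h = [:- t, 1:] ^ l + [:x:]"
  shows "first_case l m f g h gs hs"
proof -
  note H = hyps[unfolded decomp_hyps_def]
  obtain a where a: "h = recenter (monom 1 l) a"
    using linear_power_recenter[OF lm(4,1) _ h] H by blast
  obtain b where b: "gs = recenter (monom 1 l) b"
    using linear_power_recenter[OF lm(4,1) _ gs] H by blast
  define N where "N = pcompose (hs + [:b:]) [:- a, 1:]"
  have m0: "0 < degree hs" using H lm by simp
  have "hs - [:- b:] = hs + [:b:]" by (simp add: poly_eq_iff coeff_pCons split: nat.splits)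
  hence "degree (hs + [:b:]) = degree hs" "lead_coeff (hs + [:b:]) = lead_coeff hs"
    using degree_diff_const[OF m0, of "- b"] lead_coeff_diff_const[OF m0, of "- b"] by metis+
  hence N: "lead_coeff N = 1" "degree N = m"
    unfolding N_def using H lead_pcompose_linear degree_pcompose_linear by metis+
  have NN: "pcompose N [:a, 1:] = hs + [:b:]"
    using pcompose_shift_inverse[of "hs + [:b:]" "- a"] by (simp add: N_def)
  define G where "G = pcompose (g + [:b ^ l:]) [:- (a ^ l), 1:]"
  have pc: "pcompose (p ^ n) q = (pcompose p q) ^ n" for p q :: "'a poly" and n
    by (induction n) (simp_all add: pcompose_mult pcompose_1)
  have "pcompose (N ^ l) [:a, 1:] = (hs + [:b:]) ^ l" by (simp add: pc NN)
  also have "\<dots> = pcompose gs hs + [:b ^ l:]"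
    unfolding b recenter_def
    by (simp add: pcompose_diff pcompose_monom_power pc poly_monom pcompose_pCons add.commute)
  also have "pcompose gs hs = pcompose g h" using H by metis
  also have "pcompose g h + [:b ^ l:] = pcompose (pcompose G (monom 1 l)) [:a, 1:]"
  proof -
    have "pcompose (pcompose G (monom 1 l)) [:a, 1:] =
        pcompose (g + [:b ^ l:]) (pcompose [:- (a ^ l), 1:] (pcompose (monom 1 l) [:a, 1:]))"
      by (simp add: G_def pcompose_assoc)
    also have "pcompose [:- (a ^ l), 1:] (pcompose (monom 1 l) [:a, 1:]) = h"
      unfolding a recenter_def by (simp add: pcompose_pCons poly_monom)
    finally show ?thesis by (simp add: pcompose_add)
  qed
  finally have "N ^ l = pcompose G (monom 1 l)"
    by (rule pcompose_right_cancel[rotated]) simp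
  then obtain w where w: "N = fcN l (m mod l) w" "lead_coeff w = 1" "degree w = m div l"
    using power_in_monom[OF _ lm(4) N] lm(1) by (metis not_numeral_le_zero gr0I)
  have hsN: "hs = recenter N a"
    by (rule recenter_unique[where c = "- b"]) (use H NN in auto)
  have "hs = pcompose N [:a, 1:] - [:b:]" using NN by simp
  hence "poly N a = b"
    using H arg_cong[of hs "pcompose N [:a, 1:] - [:b:]" "\<lambda>p. poly p 0"]
    by (simp add: original_def poly_pcompose)
  thus ?thesis
    using first_caseI[OF hyps lm w(2,3) a] hsN b w(1) by simp
qed

text \<open>Only h and g are known to be Dickson polynomials at first. Their composition also
  decomposes as T_l(x, z^m) o T_m(x, z), and since l is nonzero in the field, uniqueness of the
  right component identifies hs, then gs. For l \<ge> 3 the coefficient of degree l - 2, from which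
  z is read, lies above the constant term.\<close>

lemma second_case_of_dickson:
  fixes g h gs hs :: "'a::field poly"
  assumes hyps: "decomp_hyps l m f g h gs hs" and lm: "3 \<le> l" "l < m"
    and nz: "of_nat l \<noteq> (0::'a)" "of_nat m \<noteq> (0::'a)" "z \<noteq> 0"
    and h: "lift h = pcompose (dickson z l) [:- t, 1:] + [:x:]"
    and g: "lift g = pcompose (dickson (z ^ l) m) [:- x, 1:] + [:c:]"
  shows "second_case l m f g h gs hs"
proof -
  note H = hyps[unfolded decomp_hyps_def]
  obtain j where j: "l = Suc (Suc j)" "0 < j"
  proof -
    have "l = Suc (Suc (l - 2))" "0 < l - 2" using lm by auto
    thus thesis by (rule that)
  qed
  have lnz: "of_nat l \<noteq> (0::'a alg_closure)" using nz(1) by (metis to_ac_eq_0_iff to_ac_of_nat)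
  have hr: "lift h = recenter (dickson z l) (- t)"
    by (rule recenter_unique[OF original_lift h]) (use H in simp)
  have d: "degree (dickson z l) = Suc (Suc j)" "lead_coeff (dickson z l) = 1"
    using degree_dickson[of l z] j by (simp_all del: dickson.simps)
  define a where "a = coeff h (Suc j) / of_nat l"
  have "coeff (dickson z l) (Suc j) = 0" using dickson_coeffs[of l z] j by simp
  hence "coeff (lift h) (Suc j) = of_nat l * (- t)"
    unfolding hr using coeff_recenter_second[OF d zero_less_Suc] j(1) by (metis add_0)
  hence ta: "to_ac a = - t" using lnz by (simp add: a_def)
  define z0 where "z0 = - coeff (pcompose h [:- a, 1:]) j / of_nat l"
  have "lift (pcompose h [:- a, 1:]) = pcompose (pcompose (dickson z l) [:- t, 1:] + [:x:]) [:t, 1:]"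
    using ta by (simp add: lift_pcompose lift_pCons h)
  also have "\<dots> = dickson z l + [:x:]"
    using pcompose_shift_inverse[of "dickson z l" "- t"] by (simp add: pcompose_add)
  finally have "coeff (lift (pcompose h [:- a, 1:])) j = coeff (dickson z l + [:x:]) j" by simp
  also have "\<dots> = - of_nat l * z"
    using dickson_coeffs[of l z] j by (simp add: coeff_pCons split: nat.splits)
  finally have tz: "to_ac z0 = z" using lnz by (simp add: z0_def)
  have "lift h = lift (recenter (dickson z0 l) a)"
    using hr ta tz by (simp add: lift_recenter lift_dickson)
  hence h0: "h = recenter (dickson z0 l) a" by simp
  have "poly (lift h) 0 = 0" using original_lift[of h] H by (simp add: original_def)
  hence "x = - poly (dickson z l) (- t)"
    unfolding h by (simp add: poly_pcompose eq_neg_iff_add_eq_0 add.commute)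
  hence xx: "- x = to_ac (poly (dickson z0 l) a)"
    using poly_lift[of "dickson z0 l" a] ta tz by (simp add: lift_dickson)
  have gr: "lift g = recenter (dickson (z ^ l) m) (- x)"
    by (rule recenter_unique[OF original_lift g]) (use H in simp)
  have "lift g = lift (recenter (dickson (z0 ^ l) m) (poly (dickson z0 l) a))"
    unfolding gr xx lift_recenter lift_dickson to_ac_power tz ..
  hence g0: "g = recenter (dickson (z0 ^ l) m) (poly (dickson z0 l) a)" by simp
  have l0: "0 < l" and m0: "0 < m" using lm by auto
  have f0: "f = recenter (pcompose (dickson (z0 ^ l) m) (dickson z0 l)) a"
    using H unfolding g0 h0 recenter_pcompose by simp
  define hs0 where "hs0 = recenter (dickson z0 m) a"
  define gs0 where "gs0 = recenter (dickson (z0 ^ m) l) (poly (dickson z0 m) a)"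
  have comp0: "pcompose gs hs = pcompose gs0 hs0"
    using H f0 unfolding dickson_comp_comm[of z0 l m] recenter_pcompose gs0_def hs0_def by metis
  have d0: "degree gs0 = l" "degree hs0 = m"
    unfolding gs0_def hs0_def using degree_dickson(1)[OF l0] degree_dickson(1)[OF m0] l0 m0 degree_recenter
    by metis+
  have "lead_coeff gs0 = 1" "lead_coeff hs0 = 1"
    unfolding gs0_def hs0_def using lead_coeff_recenter degree_dickson l0 m0 by metis+
  hence hs: "hs = hs0"
    by (intro right_component_unique[OF _ _ _ d0(1) nz(1) _ _ _ d0(2) m0 _ _ comp0])
      (use H in \<open>metis hs0_def original_recenter\<close>)+
  have gs: "gs = gs0"
    using comp0 unfolding hs by (rule pcompose_right_cancel[rotated]) (use d0 m0 in simp)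
  have "z0 \<noteq> 0" using tz nz(3) by auto
  moreover have "of_nat (l * m) \<noteq> (0::'a)" using nz by simp
  hence "\<not> CHAR('a) dvd (l * m)" by (simp add: of_nat_eq_0_iff_char_dvd del: of_nat_mult)
  ultimately show ?thesis
    unfolding second_case_def sc_recenter using f0 g0 h0 hs gs unfolding hs0_def gs0_def by blast
qed

lemma quadratic_complete_square:
  fixes p :: "'a::field poly"
  assumes "(2::'a) \<noteq> 0" "degree p = 2" "lead_coeff p = 1"
  shows "\<exists>t c. p = [:- t, 1:] ^ 2 + [:c:]"
proof -
  define b where "b = coeff p 1 / 2"
  have "p = [:b, 1:] ^ 2 + [:coeff p 0 - b ^ 2:]"
  proof (rule poly_eqI)
    fix n :: nat
    have b2: "b + b = coeff p 1" using assms(1) by (simp add: b_def flip: mult_2)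
    have sq: "[:b, 1:] ^ 2 + [:coeff p 0 - b ^ 2:] = [:coeff p 0, coeff p 1, 1:]"
      using b2 by (simp add: power2_eq_square)
    consider "n = 0" | "n = 1" | "n = 2" | "n > 2" by linarith
    thus "coeff p n = coeff ([:b, 1:] ^ 2 + [:coeff p 0 - b ^ 2:]) n"
      unfolding sq using assms(2,3)
      by cases (auto simp: coeff_pCons coeff_eq_0 numeral_eq_Suc split: nat.splits)
  qed
  hence "p = [:- (- b), 1:] ^ 2 + [:coeff p 0 - b ^ 2:]" by simp
  thus ?thesis by blast
qed

lemma ritt_second_forward:
  fixes f g h gs hs :: "'a::field poly"
  assumes lm: "2 \<le> l" "l < m" "coprime l m" and hyps: "decomp_hyps l m f g h gs hs"
  shows "first_case l m f g h gs hs \<or> second_case l m f g h gs hs"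
proof -
  note H = hyps[unfolded decomp_hyps_def]
  interpret bidecomp "lift g" "lift h" "lift gs" "lift hs" l m
  proof
    have "pderiv g * pderiv gs \<noteq> 0" using H by blast
    hence "pderiv g \<noteq> 0" "pderiv gs \<noteq> 0" by auto
    thus "pderiv (lift g) \<noteq> 0" "pderiv (lift gs) \<noteq> 0"
      unfolding lift_pderiv[symmetric] by (metis lift_0 lift_eq_iff)+
    have "pcompose g h = pcompose gs hs" using H by argo
    thus "pcompose (lift g) (lift h) = pcompose (lift gs) (lift hs)"
      by (metis lift_pcompose)
    show "lead_coeff (lift g) = 1" "lead_coeff (lift h) = 1" "lead_coeff (lift gs) = 1" "lead_coeff (lift hs) = 1"
      unfolding lead_coeff_lift using H by (metis to_ac_1)+
  qed (use H lm in simp_all)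
  have lnz: "of_nat l \<noteq> (0::'a)" using l_nz by (metis to_ac_0 to_ac_of_nat)
  show ?thesis
  proof (cases "l = 2")
    \<comment> \<open>For l = 2 the parameter z cannot be recovered from h. But 2 = l is nonzero by
      \<open>l_nz\<close>, so completing the square makes gs and h translates of x^2, and the first
      case applies without any count.\<close>
    case True
    have two: "(2::'a alg_closure) \<noteq> 0" using l_nz True by simp
    obtain y c where y: "lift gs = [:- y, 1:] ^ 2 + [:c:]"
      using quadratic_complete_square[OF two, of "lift gs"] H True by auto
    obtain t x where t: "lift h = [:- t, 1:] ^ 2 + [:x:]"
      using quadratic_complete_square[OF two, of "lift h"] H True by auto
    show ?thesis using first_case_of_powers[OF hyps lm lnz] y t True by blast
  next
    case False
    hence l3: "3 \<le> l" using lm by simp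
    from ritt_cases show ?thesis
    proof (elim disjE exE conjE)
      fix y c x1 \<tau>
      assume "lift gs = [:- y, 1:] ^ l + [:c:]" "lift h = [:- \<tau>, 1:] ^ l + [:x1:]"
      thus ?thesis using first_case_of_powers[OF hyps lm lnz] by blast
    next
      fix z \<tau> x c
      assume z: "z \<noteq> 0" "of_nat m \<noteq> (0::'a alg_closure)"
        "lift h = pcompose (dickson z l) [:- \<tau>, 1:] + [:x:]"
        "lift g = pcompose (dickson (z ^ l) m) [:- x, 1:] + [:c:]"
      have "of_nat m \<noteq> (0::'a)" using z(2) by (metis to_ac_0 to_ac_of_nat)
      thus ?thesis using second_case_of_dickson[OF hyps l3 lm(2) lnz _ z(1,3,4)] by blast
    qed
  qed
qed

theorem theorem4p3:
  fixes l m :: nat and f g h gs hs :: "'a::field poly"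
  assumes "2 \<le> l" and "l < m" and "coprime l m"
    and hyps: "decomp_hyps l m f g h gs hs"
  shows
    "(first_case l m f g h gs hs \<or> second_case l m f g h gs hs)
     \<comment> \<open>(1): uniqueness of (w,a) when p does not divide m\<close>
     \<and> (first_case l m f g h gs hs \<and> \<not> CHAR('a) dvd m \<longrightarrow>
          (\<forall>w a w' a'. lead_coeff w = 1 \<and> degree w = m div l \<and> f = fc_f l m w a \<and>
              lead_coeff w' = 1 \<and> degree w' = m div l \<and> f = fc_f l m w' a'
              \<longrightarrow> w = w' \<and> a = a'))
     \<comment> \<open>(1): converse\<close>
     \<and> (\<forall>(w::'a poly) a. fc_param l m w \<longrightarrow>
          decomp_hyps l m (fc_f l m w a) (fc_g l m w a) (fc_h l m w a)
            (fc_gs l m w a) (fc_hs l m w a))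
     \<comment> \<open>(2): uniqueness of (z,a)\<close>
     \<and> (second_case l m f g h gs hs \<longrightarrow>
          (\<forall>z a z' a'. z \<noteq> 0 \<and> f = sc_f l m z a \<and> z' \<noteq> 0 \<and> f = sc_f l m z' a'
              \<longrightarrow> z = z' \<and> a = a'))
     \<comment> \<open>(2): converse\<close>
     \<and> (\<not> CHAR('a) dvd (l * m) \<longrightarrow>
          (\<forall>z a :: 'a. z \<noteq> 0 \<longrightarrow>
             decomp_hyps l m (sc_f l m z a) (sc_g l m z a) (sc_h l m z a)
               (sc_gs l m z a) (sc_hs l m z a)))
     \<comment> \<open>(3)\<close>
     \<and> (3 \<le> l \<longrightarrow> \<not> (first_case l m f g h gs hs \<and> second_case l m f g h gs hs))
     \<and> (l = 2 \<longrightarrow> second_case l m f g h gs hs \<longrightarrow> first_case l m f g h gs hs)"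
proof (intro conjI impI allI)
  show "first_case l m f g h gs hs \<or> second_case l m f g h gs hs"
    by (rule ritt_second_forward[OF assms])
next
  fix w w' :: "'a poly" and a a'
  assume 1: "first_case l m f g h gs hs \<and> \<not> CHAR('a) dvd m"
    and 2: "lead_coeff w = 1 \<and> degree w = m div l \<and> f = fc_f l m w a \<and>
              lead_coeff w' = 1 \<and> degree w' = m div l \<and> f = fc_f l m w' a'"
  have "of_nat l \<noteq> (0::'a)" "of_nat m \<noteq> (0::'a)"
    using 1 by (auto simp: first_case_def fc_param_def of_nat_eq_0_iff_char_dvd)
  from fc_unique[OF assms(1-3) this, of w w' a a'] 2 have "w = w' \<and> a = a'" by blast
  thus "w = w'" "a = a'" by blast+
next
  fix w :: "'a poly" and a
  assume "fc_param l m w"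
  thus "decomp_hyps l m (fc_f l m w a) (fc_g l m w a) (fc_h l m w a) (fc_gs l m w a) (fc_hs l m w a)"
    by (rule fc_converse[OF assms(1-3)])
next
  fix z a z' a' :: 'a
  assume 1: "second_case l m f g h gs hs"
    and 2: "z \<noteq> 0 \<and> f = sc_f l m z a \<and> z' \<noteq> 0 \<and> f = sc_f l m z' a'"
  have "of_nat (l * m) \<noteq> (0::'a)"
    using 1 by (simp add: second_case_def of_nat_eq_0_iff_char_dvd del: of_nat_mult)
  from sc_unique[OF assms(1,2) this, of z a z' a'] 2 have "z = z' \<and> a = a'" by metis
  thus "z = z'" "a = a'" by blast+
next
  fix z a :: 'a
  assume "\<not> CHAR('a) dvd (l * m)"
  thus "decomp_hyps l m (sc_f l m z a) (sc_g l m z a) (sc_h l m z a) (sc_gs l m z a) (sc_hs l m z a)"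
    using assms(1,2) by (intro sc_converse) auto
next
  assume "3 \<le> l"
  thus "\<not> (first_case l m f g h gs hs \<and> second_case l m f g h gs hs)"
    using cases_exclusive by blast
next
  assume "l = 2" "second_case l m f g h gs hs"
  thus "first_case l m f g h gs hs" using second_imp_first assms by blast
qed

end
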